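(* Let $d\ge1$. Every $2d$-regular graphing $\mathcal{G}$ is the local isomorphic image of some graphing $\mathcal{G}'$ that comes from a probability measure preserving (p.m.p.) action of $F_d$. That is, the edges of $\mathcal{G}'$ have a measurable orientation and a measurable coloring with $[d]=\{1,\dots,d\}$ such that every vertex has exactly one incoming and exactly one outgoing edge of each color.
   Context: A graphing is a simple undirected graph $\mathcal{G}=(X,E,\nu)$ whose vertex set $X$ is a standard Borel space with a Borel probability measure $\nu$, whose (symmetric) edge set $E\subseteq X\times X$ is Borel, whose degrees are uniformly bounded, and such that $\int_A\deg(x,B)\,d\nu(x)=\int_B\deg(x,A)\,d\nu(x)$ for all measurable $A,B\subseteq X$, where $\deg(x,S)$ is the number of edges from $x$ to $S$. $C_{\mathcal{G}}(x)$ denotes the connected component of $x$. A graphing $\mathcal{G}_1=(X_1,E_1,\nu_1)$ is the local isomorphic image of a graphing $\mathcal{G}_2=(X_2,E_2,\nu_2)$ if there is a measurable map $\varphi:X_2\to X_1$ with $\varphi_*\nu_2=\nu_1$ such that for $\nu_2$-almost every $x\in X_2$ the restriction of $\varphi$ to $C_{\mathcal{G}_2}(x)$ is a rooted isomorphism from $(C_{\mathcal{G}_2}(x),x)$ to $(C_{\mathcal{G}_1}(\varphi(x)),\varphi(x))$. $F_d$ is the free group on $d$ generators with standard generating set $S$. Given a p.m.p. action $F_d\curvearrowright(X',\nu')$ on a standard Borel probability space, the graphing coming from the action is its Schreier graph $\mathrm{Sch}(F_d\curvearrowright X',S)$, with an edge from $x$ to $s.x$ for every $x\in X'$ and $s\in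 S$, oriented towards $s.x$ and colored by $s$. A measurable orientation and coloring as in the claim is equivalent to such an action. Measurability statements are up to null sets. *)

theory Defs
  imports "HOL-Probability.Probability" "HOL-Algebra.Group_Action"
begin

section \<open>Graphings\<close>

definition standard_borel :: "'a measure \<Rightarrow> bool" where
  "standard_borel M \<longleftrightarrow>
     (\<exists>T. completely_metrizable_space T \<and> second_countable T \<and> topspace T = space M \<and>
          sets M = sigma_sets (topspace T) {U. openin T U})"

definition degree_in :: "('a \<times> 'a) set \<Rightarrow> 'a \<Rightarrow> 'a set \<Rightarrow> nat" where
  "degree_in E x B = card {y \<in> B. (x, y) \<in> E}"

text \<open>
  An undirected edge is represented by its two ordered pairs.  The integrals are Lebesgue integrals
  of nonnegative functions.
\<close>

definition graphing :: "'a measure \<Rightarrow> ('a \<times> 'a) set \<Rightarrow> bool" where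
  "graphing M E \<longleftrightarrow>
     prob_space M \<and> standard_borel M \<and>
     E \<in> sets (M \<Otimes>\<^sub>M M) \<and> sym E \<and> irrefl E \<and>
     (\<exists>D. \<forall>x \<in> space M. finite {y. (x, y) \<in> E} \<and> degree_in E x (space M) \<le> D) \<and>
     (\<forall>A \<in> sets M. \<forall>B \<in> sets M.
        (\<integral>\<^sup>+x\<in>A. of_nat (degree_in E x B) \<partial>M) = (\<integral>\<^sup>+x\<in>B. of_nat (degree_in E x A) \<partial>M))"

definition regular_graphing :: "nat \<Rightarrow> 'a measure \<Rightarrow> ('a \<times> 'a) set \<Rightarrow> bool" where
  "regular_graphing k M E \<longleftrightarrow> graphing M E \<and> (\<forall>x \<in> space M. degree_in E x (space M) = k)"

definition component :: "('a \<times> 'a) set \<Rightarrow> 'a \<Rightarrow> 'a set" where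
  "component E x = {y. (x, y) \<in> E\<^sup>*}"

definition graph_iso_on ::
    "('a \<times> 'a) set \<Rightarrow> 'a set \<Rightarrow> ('b \<times> 'b) set \<Rightarrow> 'b set \<Rightarrow> ('a \<Rightarrow> 'b) \<Rightarrow> bool" where
  "graph_iso_on E C F D f \<longleftrightarrow>
     bij_betw f C D \<and> (\<forall>u \<in> C. \<forall>v \<in> C. (u, v) \<in> E \<longleftrightarrow> (f u, f v) \<in> F)"

text \<open>
  The isomorphism between components is rooted by construction: the target component is the one
  with root \<open>\<phi> x\<close>.
\<close>

definition local_isomorphic_image ::
    "'a measure \<Rightarrow> ('a \<times> 'a) set \<Rightarrow> 'b measure \<Rightarrow> ('b \<times> 'b) set \<Rightarrow> bool" where
  "local_isomorphic_image M\<^sub>1 E\<^sub>1 M\<^sub>2 E\<^sub>2 \<longleftrightarrow>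
     (\<exists>\<phi> \<in> measurable M\<^sub>2 M\<^sub>1. distr M\<^sub>2 M\<^sub>1 \<phi> = M\<^sub>1 \<and>
        (AE x in M\<^sub>2. graph_iso_on E\<^sub>2 (component E\<^sub>2 x) E\<^sub>1 (component E\<^sub>1 (\<phi> x)) \<phi>))"


section \<open>The free group of rank \<open>d\<close>\<close>

text \<open>
  Elements are reduced words.  The letter \<open>(i, True)\<close> is the \<open>i\<close>-th generator and
  \<open>(i, False)\<close> its inverse.
\<close>

type_synonym letter = "nat \<times> bool"

definition letter_inv :: "letter \<Rightarrow> letter" where
  "letter_inv a = (fst a, \<not> snd a)"

definition reduced_word :: "letter list \<Rightarrow> bool" where
  "reduced_word w \<longleftrightarrow> successively (\<lambda>a b. b \<noteq> letter_inv a) w"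

fun push_letter :: "letter \<Rightarrow> letter list \<Rightarrow> letter list" where
  "push_letter a [] = [a]"
| "push_letter a (b # w) = (if b = letter_inv a then w else a # b # w)"

definition free_group :: "nat \<Rightarrow> letter list monoid" where
  "free_group d =
     \<lparr>carrier = {w. reduced_word w \<and> set w \<subseteq> {1..d} \<times> UNIV},
      mult = foldr push_letter,
      one = []\<rparr>"

definition generator :: "nat \<Rightarrow> letter list" where
  "generator i = [(i, True)]"

lemma letter_inv_inv [simp]: "letter_inv (letter_inv a) = a"
  by (simp add: letter_inv_def)

lemma reduced_Nil [simp]: "reduced_word []"
  by (simp add: reduced_word_def)

lemma reduced_Cons: "reduced_word (a # w) \<longleftrightarrow> reduced_word w \<and> (w = [] \<or> hd w \<noteq> letter_inv a)"
  by (cases w) (auto simp: reduced_word_def)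

lemma reduced_push: "reduced_word w \<Longrightarrow> reduced_word (push_letter a w)"
  by (cases w) (auto simp: reduced_Cons)

lemma reduced_foldr_push: "reduced_word w \<Longrightarrow> reduced_word (foldr push_letter u w)"
  by (induction u) (auto simp: reduced_push)

lemma set_push: "set (push_letter a w) \<subseteq> insert a (set w)"
  by (cases w) auto

lemma set_foldr_push: "set (foldr push_letter u w) \<subseteq> set u \<union> set w"
proof (induction u)
  case (Cons a u)
  then show ?case using set_push[of a "foldr push_letter u w"] by auto
qed simp

lemma push_push_inv:
  assumes "reduced_word w"
  shows "push_letter a (push_letter (letter_inv a) w) = w"
proof (cases w)
  case (Cons b v)
  then show ?thesis using assms by (cases v) (auto simp: reduced_Cons)
qed simp

lemma foldr_push_push:
  assumes "reduced_word w"
  shows "foldr push_letter (push_letter a u) w = push_letter a (foldr push_letter u w)"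
proof (cases u)
  case (Cons b v)
  then show ?thesis
    using push_push_inv[OF reduced_foldr_push[OF assms], of a v] by auto
qed simp

lemma foldr_push_assoc:
  assumes "reduced_word w"
  shows "foldr push_letter (foldr push_letter u v) w = foldr push_letter u (foldr push_letter v w)"
  by (induction u) (simp_all add: foldr_push_push[OF assms])

lemma foldr_push_Nil: "reduced_word w \<Longrightarrow> foldr push_letter w [] = w"
proof (induction w)
  case (Cons a w)
  then show ?case by (cases w) (auto simp: reduced_Cons)
qed simp

lemma foldr_push_inverse:
  "reduced_word v \<Longrightarrow> foldr push_letter (rev (map letter_inv w)) (foldr push_letter w v) = v"
proof (induction w)
  case (Cons a w)
  have "push_letter (letter_inv a) (push_letter a (foldr push_letter w v)) = foldr push_letter w v"
    using push_push_inv[OF reduced_foldr_push[OF Cons.prems], of "letter_inv a" w] by simp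
  then show ?case using Cons by simp
qed simp

lemma group_free_group: "group (free_group d)"
proof (rule groupI)
  fix x assume x: "x \<in> carrier (free_group d)"
  let ?y = "foldr push_letter (rev (map letter_inv x)) []"
  have "set (rev (map letter_inv x)) \<subseteq> {1..d} \<times> UNIV"
    using x by (auto simp: free_group_def letter_inv_def)
  then have "set ?y \<subseteq> {1..d} \<times> UNIV"
    using set_foldr_push[of "rev (map letter_inv x)" "[]"] by simp
  then have "?y \<in> carrier (free_group d)"
    using reduced_foldr_push[of "[]"] by (simp add: free_group_def reduced_word_def)
  moreover have "foldr push_letter ?y x = []"
  proof -
    have r: "reduced_word x" "reduced_word []" using x by (auto simp: free_group_def reduced_word_def)
    have "foldr push_letter ?y x
        = foldr push_letter (rev (map letter_inv x)) (foldr push_letter [] x)"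
      using foldr_push_assoc[OF r(1), of "rev (map letter_inv x)" "[]"] .
    also have "\<dots> = foldr push_letter (rev (map letter_inv x)) (foldr push_letter x [])"
      using foldr_push_Nil[OF r(1)] by simp
    also have "\<dots> = []" by (rule foldr_push_inverse[OF r(2)])
    finally show ?thesis .
  qed
  ultimately show "\<exists>y\<in>carrier (free_group d). y \<otimes>\<^bsub>free_group d\<^esub> x = \<one>\<^bsub>free_group d\<^esub>"
    by (auto simp: free_group_def)
next
  fix x y assume "x \<in> carrier (free_group d)" "y \<in> carrier (free_group d)"
  then show "x \<otimes>\<^bsub>free_group d\<^esub> y \<in> carrier (free_group d)"
    using set_foldr_push[of x y] by (auto simp: free_group_def intro: reduced_foldr_push)
next
  fix x y z
  assume "x \<in> carrier (free_group d)" "y \<in> carrier (free_group d)" "z \<in> carrier (free_group d)"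
  then show "x \<otimes>\<^bsub>free_group d\<^esub> y \<otimes>\<^bsub>free_group d\<^esub> z =
             x \<otimes>\<^bsub>free_group d\<^esub> (y \<otimes>\<^bsub>free_group d\<^esub> z)"
    by (auto simp: free_group_def foldr_push_assoc)
qed (auto simp: free_group_def reduced_word_def)


section \<open>Schreier graphs and Schreier decorations\<close>

definition pmp_action ::
    "('g, 'm) monoid_scheme \<Rightarrow> 'a measure \<Rightarrow> ('g \<Rightarrow> 'a \<Rightarrow> 'a) \<Rightarrow> bool" where
  "pmp_action G M act \<longleftrightarrow>
     prob_space M \<and> standard_borel M \<and> group_action G (space M) act \<and>
     (\<forall>g \<in> carrier G. act g \<in> measurable M M \<and> distr M M (act g) = M)"

text \<open>The arc \<open>(x, y, i)\<close> goes from \<open>x\<close> to \<open>y\<close> and has colour \<open>i\<close>.\<close>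

definition schreier_arcs ::
    "nat \<Rightarrow> 'a measure \<Rightarrow> (letter list \<Rightarrow> 'a \<Rightarrow> 'a) \<Rightarrow> ('a \<times> 'a \<times> nat) set" where
  "schreier_arcs d M act = {(x, act (generator i) x, i) | x i. x \<in> space M \<and> i \<in> {1..d}}"

definition measurable_orientation ::
    "'a measure \<Rightarrow> ('a \<times> 'a) set \<Rightarrow> ('a \<times> 'a) set \<Rightarrow> bool" where
  "measurable_orientation M E Or \<longleftrightarrow>
     Or \<in> sets (M \<Otimes>\<^sub>M M) \<and> Or \<subseteq> E \<and> (\<forall>(x, y) \<in> E. (x, y) \<in> Or \<longleftrightarrow> (y, x) \<notin> Or)"

definition measurable_edge_coloring ::
    "nat \<Rightarrow> 'a measure \<Rightarrow> ('a \<times> 'a) set \<Rightarrow> ('a \<times> 'a \<Rightarrow> nat) \<Rightarrow> bool" where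
  "measurable_edge_coloring d M E c \<longleftrightarrow>
     c \<in> measurable (restrict_space (M \<Otimes>\<^sub>M M) E) (count_space {1..d}) \<and>
     (\<forall>(x, y) \<in> E. c (x, y) = c (y, x))"

definition schreier_decoration ::
    "nat \<Rightarrow> 'a measure \<Rightarrow> ('a \<times> 'a) set \<Rightarrow> ('a \<times> 'a) set \<Rightarrow> ('a \<times> 'a \<Rightarrow> nat) \<Rightarrow> bool" where
  "schreier_decoration d M E Or c \<longleftrightarrow>
     measurable_orientation M E Or \<and> measurable_edge_coloring d M E c \<and>
     (\<forall>x \<in> space M. \<forall>i \<in> {1..d}.
        (\<exists>!y. (x, y) \<in> Or \<and> c (x, y) = i) \<and> (\<exists>!y. (y, x) \<in> Or \<and> c (y, x) = i))"

text \<open>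
  \<open>E\<close>, oriented by \<open>Or\<close> and coloured by \<open>c\<close>, is the Schreier graph of a p.m.p. action of the free
  group.  Every edge has exactly one orientation and one colour, so the Schreier graph has no loops
  or multiple edges and \<open>E\<close> is its underlying simple graph.
\<close>

definition comes_from_action ::
    "nat \<Rightarrow> 'a measure \<Rightarrow> ('a \<times> 'a) set \<Rightarrow> (letter list \<Rightarrow> 'a \<Rightarrow> 'a) \<Rightarrow>
     ('a \<times> 'a) set \<Rightarrow> ('a \<times> 'a \<Rightarrow> nat) \<Rightarrow> bool" where
  "comes_from_action d M E act Or c \<longleftrightarrow>
     pmp_action (free_group d) M act \<and>
     schreier_decoration d M E Or c \<and>
     {(x, y, i). (x, y) \<in> Or \<and> c (x, y) = i} = schreier_arcs d M act"

text \<open>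
  HOL cannot quantify existentially over types, so the vertices of the covering graphing are taken
  from a fixed type.  This is no restriction: a standard Borel space has at most the cardinality
  of the continuum, so it can be transported along an injection into the type below.
\<close>

type_synonym 'a cover = "'a \<times> (nat \<Rightarrow> nat)"

end

theory Submission
  imports Defs
begin

text \<open>
  The neighbours of almost every vertex are enumerated measurably, so that a (partial) Schreier
  decoration of the component of \<open>x\<close> becomes a point of the Cantor-like space of labellings of the
  walks starting at \<open>x\<close>.  Consider the probability measures on pairs (vertex, partial decoration of
  its component) that project to the given measure and are invariant under moving the root.  By
  compactness of the space of labellings, weak limits of such measures exist, and hence there is a
  measure maximizing the expected number of decorated edges at the root.

  A maximizer decorates every edge.  If an edge \<open>xy\<close> is undecorated, then \<open>x\<close> misses some slot \<open>s\<close>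
  and \<open>y\<close> misses some slot \<open>t\<close>, where a slot is a colour together with a direction.  Exchanging
  \<open>t\<close> with the conjugate of \<open>s\<close> along the Kempe chain of \<open>y\<close> makes room for \<open>xy\<close>.  The chain may be
  infinite, and since \<open>x\<close> misses \<open>s\<close> and \<open>y\<close> misses \<open>t\<close>, no chain enters an endpoint of another
  undecorated edge of the same kind.  Hence this is done simultaneously for a set of edges of
  positive measure, and it raises the expected number of decorated edges at the root.
\<close>

section \<open>Weak limits of measures on labelled spaces\<close>

text \<open>Limits are tested on sets that are arbitrary measurable in the vertex and depend on
  finitely many labels, so no topology on the vertices enters. Countable additivity of the limit
  comes from compactness of the labels over each vertex and from the fixed marginal. Goodness of a
  labelling is a countable conjunction of such tests, and invariance and coverage are stated through
  their measures. The definition of a graphing does not postulate measurable degrees. They are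
  obtained, up to a null set, from the mass transport identity itself instead of the Lusin-Novikov
  theorem; the null set is then enlarged to a union of components. There are as many slots as darts
  at a vertex, namely \<open>d\<close> colours in two directions at degree \<open>2 * d\<close>.
  Hence an undecorated edge forces a missing slot at each end. To add many edges at once, they are
  first sorted by their darts, their missing slots and a measurable set that contains one end but
  not the other, which makes them disjoint and directs them.\<close>

abbreviation label_space :: "(nat \<Rightarrow> nat) measure" where
  "label_space \<equiv> Pi\<^sub>M UNIV (\<lambda>_. count_space UNIV)"

abbreviation labelled :: "'a measure \<Rightarrow> ('a \<times> (nat \<Rightarrow> nat)) measure" where
  "labelled M \<equiv> M \<Otimes>\<^sub>M label_space"

definition depends_below :: "nat \<Rightarrow> ('a \<times> (nat \<Rightarrow> nat)) set \<Rightarrow> bool" where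
  "depends_below k S \<longleftrightarrow> (\<forall>x \<sigma> \<tau>. (\<forall>p<k. \<sigma> p = \<tau> p) \<longrightarrow> (x, \<sigma>) \<in> S \<longrightarrow> (x, \<tau>) \<in> S)"

text \<open>Only the dependence on labels is restricted. The vertex part may be any measurable set,
  so that events such as the coincidence of two walks are cylinders.\<close>

definition cylinders :: "'a measure \<Rightarrow> ('a \<times> (nat \<Rightarrow> nat)) set set" where
  "cylinders M = {S \<in> sets (labelled M). \<exists>k. depends_below k S}"

lemma space_labelled: "space (labelled M) = space M \<times> UNIV"
  by (simp add: space_pair_measure space_PiM)

lemma depends_below_mono: "depends_below k S \<Longrightarrow> k \<le> l \<Longrightarrow> depends_below l S"
  unfolding depends_below_def by (meson order_less_le_trans)

lemma cylinders_sets: "S \<in> cylinders M \<Longrightarrow> S \<in> sets (labelled M)"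
  by (simp add: cylinders_def)

lemma cylinders_algebra: "algebra (space (labelled M)) (cylinders M)"
proof (subst algebra_iff_Un, intro conjI ballI)
  show "cylinders M \<subseteq> Pow (space (labelled M))"
    using sets.space_closed[of "labelled M"] by (auto simp: cylinders_def)
  show "{} \<in> cylinders M" by (auto simp: cylinders_def depends_below_def)
next
  fix S assume S: "S \<in> cylinders M"
  then obtain k where k: "depends_below k S" "S \<in> sets (labelled M)" by (auto simp: cylinders_def)
  have "depends_below k (space (labelled M) - S)"
    unfolding depends_below_def space_labelled
    using k(1)[unfolded depends_below_def] by (metis Diff_iff SigmaE2 SigmaI UNIV_I)
  then show "space (labelled M) - S \<in> cylinders M" using k(2) by (auto simp: cylinders_def)
next
  fix S T assume S: "S \<in> cylinders M" and T: "T \<in> cylinders M"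
  then obtain k l where k: "depends_below k S" "S \<in> sets (labelled M)"
    and l: "depends_below l T" "T \<in> sets (labelled M)" by (auto simp: cylinders_def)
  have "depends_below (max k l) S" "depends_below (max k l) T"
    using depends_below_mono[OF k(1)] depends_below_mono[OF l(1)] by auto
  then have "depends_below (max k l) (S \<union> T)" unfolding depends_below_def by (metis Un_iff)
  then show "S \<union> T \<in> cylinders M" using k(2) l(2) by (auto simp: cylinders_def)
qed

lemma label_coordinate [measurable]:
  "(\<lambda>\<sigma>. \<sigma> p) \<in> measurable label_space (count_space UNIV)"
  by measurable

lemma measurable_into_label_space:
  assumes "\<And>p. (\<lambda>x. f x p) \<in> measurable M (count_space UNIV)"
  shows "f \<in> measurable M label_space"
  by (rule measurable_PiM_single') (use assms in \<open>auto simp: PiE_def\<close>)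

text \<open>Both projections are measurable for the generated sigma-algebra, hence so is the
  identity into \<open>labelled M\<close>, which pulls back every measurable set.\<close>

lemma sigma_sets_cylinders: "sigma_sets (space (labelled M)) (cylinders M) = sets (labelled M)"
proof
  show "sigma_sets (space (labelled M)) (cylinders M) \<subseteq> sets (labelled M)"
    by (rule sets.sigma_sets_subset) (auto simp: cylinders_def)
next
  let ?S = "sigma (space (labelled M)) (cylinders M)"
  have P: "cylinders M \<subseteq> Pow (space (labelled M))"
    using sets.space_closed[of "labelled M"] by (auto simp: cylinders_def)
  have 1: "fst \<in> measurable ?S M"
  proof (rule measurableI)
    fix A assume A: "A \<in> sets M"
    have "A \<times> UNIV \<in> cylinders M" 
      using A pair_measureI[OF A, of UNIV label_space] sets.top[of label_space]
      by (auto simp: cylinders_def depends_below_def space_PiM)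
    moreover have "fst -` A \<inter> space ?S = A \<times> UNIV"
      using P sets.sets_into_space[OF A] by (auto simp: space_labelled)
    ultimately show "fst -` A \<inter> space ?S \<in> sets ?S" using P by (auto simp: sets_measure_of)
  qed (use P in \<open>auto simp: space_labelled\<close>)
  have 2: "snd \<in> measurable ?S label_space"
  proof (rule measurable_into_label_space)
    fix p
    show "(\<lambda>x. snd x p) \<in> measurable ?S (count_space UNIV)"
    proof (rule measurableI)
      fix A :: "nat set"
      have "(\<lambda>x. snd x p) \<in> measurable (labelled M) (count_space UNIV)" by measurable
      then have "(\<lambda>x. snd x p) -` A \<inter> space (labelled M) \<in> sets (labelled M)"
        by (rule measurable_sets) simp
      moreover have "depends_below (Suc p) ((\<lambda>x. snd x p) -` A \<inter> space (labelled M))"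
        by (auto simp: depends_below_def space_labelled)
      ultimately have "(\<lambda>x. snd x p) -` A \<inter> space (labelled M) \<in> cylinders M"
        unfolding cylinders_def by blast
      then show "(\<lambda>x. snd x p) -` A \<inter> space ?S \<in> sets ?S" using P by (auto simp: sets_measure_of)
    qed auto
  qed
  have "(\<lambda>x. (fst x, snd x)) \<in> measurable ?S (labelled M)"
    by (intro measurable_Pair 1 2)
  then have id: "(\<lambda>x. x) \<in> measurable ?S (labelled M)" by simp
  show "sets (labelled M) \<subseteq> sigma_sets (space (labelled M)) (cylinders M)"
  proof
    fix A assume A: "A \<in> sets (labelled M)"
    have "A \<subseteq> space (labelled M)" using sets.sets_into_space[OF A] .
    then show "A \<in> sigma_sets (space (labelled M)) (cylinders M)"
      using measurable_sets[OF id A] P by (simp add: sets_measure_of Int_absorb2)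
  qed
qed

section \<open>Compactness and limits of measures\<close>

text \<open>Tychonoff's theorem for a cube over an arbitrary index set. It is applied with sets as
  indices; a subsequence convergent at all of them need not exist, so the limit is taken along a
  filter finer than \<open>sequentially\<close>.\<close>

lemma ex_limit_along_filter:
  fixes f :: "nat \<Rightarrow> 'i \<Rightarrow> real"
  assumes "\<And>t i. 0 \<le> f t i \<and> f t i \<le> 1"
  shows "\<exists>l F. F \<noteq> bot \<and> F \<le> sequentially \<and> (\<forall>i. ((\<lambda>t. f t i) \<longlongrightarrow> l i) F)"
proof -
  have "compactin (product_topology (\<lambda>i. euclidean) UNIV) (Pi\<^sub>E UNIV (\<lambda>_::'i. {0..1::real}))"
    by (subst compactin_PiE) auto
  then have "compact (Pi\<^sub>E UNIV (\<lambda>_::'i. {0..1::real}))"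
    by (simp add: euclidean_product_topology)
  then obtain l where l: "inf (nhds l) (filtermap f sequentially) \<noteq> bot"
    unfolding compact_filter using assms
    by (auto elim!: allE[where x="filtermap f sequentially"] simp: eventually_filtermap filtermap_bot_iff PiE_def Pi_def)
  \<comment> \<open>The times at which \<open>f t\<close> is close to the cluster point
    \<open>l\<close>.\<close>
  define F where "F = inf sequentially (filtercomap f (nhds l))"
  have "F \<noteq> bot"
  proof
    assume "F = bot"
    then obtain P Q where P: "eventually P sequentially" and Q: "eventually Q (nhds l)"
      and PQ: "\<And>t. P t \<Longrightarrow> Q (f t) \<Longrightarrow> False"
      unfolding F_def trivial_limit_def eventually_inf eventually_filtercomap by metis
    have "eventually (\<lambda>g. g \<in> f ` {t. P t}) (filtermap f sequentially)"
      unfolding eventually_filtermap using P by (auto elim: eventually_mono)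
    then have "eventually (\<lambda>g. False) (inf (nhds l) (filtermap f sequentially))"
      unfolding eventually_inf using Q PQ by blast
    then show False using l by (simp add: trivial_limit_def)
  qed
  moreover have "F \<le> sequentially" by (simp add: F_def)
  moreover have "((\<lambda>t. f t i) \<longlongrightarrow> l i) F" for i
  proof (rule topological_tendstoI)
    fix S :: "real set" assume S: "open S" "l i \<in> S"
    have "open {g :: 'i \<Rightarrow> real. g i \<in> S}"
      using open_vimage[OF S(1) continuous_on_product_coordinates[of i]] by (simp add: vimage_def)
    then have "eventually (\<lambda>g. g i \<in> S) (nhds l)"
      using S(2) unfolding eventually_nhds by blast
    then have "eventually (\<lambda>t. f t i \<in> S) (filtercomap f (nhds l))"
      by (rule eventually_filtercomapI)
    then show "eventually (\<lambda>t. f t i \<in> S) F"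
      unfolding F_def by (rule filter_leD[OF inf.cobounded2])
  qed
  ultimately show ?thesis by blast
qed

lemma compact_bounded_labels: "compact {\<sigma> :: nat \<Rightarrow> nat. \<forall>p. \<sigma> p \<le> b}"
proof -
  have "compactin (product_topology (\<lambda>i. euclidean) UNIV) (Pi\<^sub>E UNIV (\<lambda>_::nat. {..b}))"
    by (subst compactin_PiE) (auto intro: finite_imp_compact)
  moreover have "Pi\<^sub>E UNIV (\<lambda>_::nat. {..b}) = {\<sigma>. \<forall>p. \<sigma> p \<le> b}" by (auto simp: PiE_def)
  ultimately show ?thesis by (simp add: euclidean_product_topology)
qed

text \<open>Labels are discrete, so fixing the first \<open>k\<close> of them is an open condition,
  and it decides membership in \<open>S\<close>.\<close>

lemma closed_section:
  assumes "depends_below k S"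
  shows "closed {\<sigma>. (x, \<sigma>) \<in> S}"
proof -
  have "open (- {\<sigma>. (x, \<sigma>) \<in> S})"
  proof (subst open_subopen, intro ballI)
    fix \<sigma> assume \<sigma>: "\<sigma> \<in> - {\<sigma>. (x, \<sigma>) \<in> S}"
    let ?T = "Pi\<^sub>E UNIV (\<lambda>p. if p < k then {\<sigma> p} else UNIV)"
    have "open ?T"
      by (rule open_PiE) (auto intro: finite_subset[of _ "{..<k}"] simp: Topological_Spaces.open_discrete)
    moreover have "\<sigma> \<in> ?T" by (auto simp: PiE_def)
    moreover have "?T \<subseteq> - {\<sigma>. (x, \<sigma>) \<in> S}"
    proof
      fix \<tau> assume "\<tau> \<in> ?T"
      then have "\<forall>p<k. \<tau> p = \<sigma> p" by (auto simp: PiE_def Pi_def split: if_splits)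
      then show "\<tau> \<in> - {\<sigma>. (x, \<sigma>) \<in> S}" using assms \<sigma> unfolding depends_below_def by auto
    qed
    ultimately show "\<exists>T. open T \<and> \<sigma> \<in> T \<and> T \<subseteq> - {\<sigma>. (x, \<sigma>) \<in> S}" by blast
  qed
  then show ?thesis by (simp add: closed_def)
qed

text \<open>Projections of measurable sets need not be measurable. Here finitely many labels decide
  membership, so the quantifier can run over finite lists, of which there are countably many;
  padding with 0 respects the bound \<open>b\<close>.\<close>

lemma sets_bounded_projection:
  assumes "S \<in> cylinders M"
  shows "{x \<in> space M. \<exists>\<sigma>. (\<forall>p. \<sigma> p \<le> b) \<and> (x, \<sigma>) \<in> S} \<in> sets M"
proof -
  obtain k where k: "depends_below k S" and S[measurable]: "S \<in> sets (labelled M)"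
    using assms by (auto simp: cylinders_def)
  define ext where "ext l = (\<lambda>p. if p < length l then l ! p else (0::nat))" for l
  have "(\<exists>\<sigma>. (\<forall>p. \<sigma> p \<le> b) \<and> (x, \<sigma>) \<in> S) \<longleftrightarrow> (\<exists>l. set l \<subseteq> {..b} \<and> (x, ext l) \<in> S)" for x
  proof
    assume "\<exists>\<sigma>. (\<forall>p. \<sigma> p \<le> b) \<and> (x, \<sigma>) \<in> S"
    then obtain \<sigma> where \<sigma>: "\<forall>p. \<sigma> p \<le> b" "(x, \<sigma>) \<in> S" by blast
    have "(x, ext (map \<sigma> [0..<k])) \<in> S"
      by (rule k[unfolded depends_below_def, rule_format, OF _ \<sigma>(2)]) (simp add: ext_def)
    then show "\<exists>l. set l \<subseteq> {..b} \<and> (x, ext l) \<in> S"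
      using \<sigma>(1) by (intro exI[of _ "map \<sigma> [0..<k]"]) auto
  next
    assume "\<exists>l. set l \<subseteq> {..b} \<and> (x, ext l) \<in> S"
    then obtain l where l: "set l \<subseteq> {..b}" "(x, ext l) \<in> S" by blast
    have "ext l p \<le> b" for p using l(1) nth_mem[of p l] by (auto simp: ext_def simp del: nth_mem)
    then show "\<exists>\<sigma>. (\<forall>p. \<sigma> p \<le> b) \<and> (x, \<sigma>) \<in> S" using l(2) by blast
  qed
  moreover have "{x \<in> space M. \<exists>l. set l \<subseteq> {..b} \<and> (x, ext l) \<in> S} \<in> sets M"
  proof -
    have "(\<lambda>x. (x, ext l)) \<in> measurable M (labelled M)" for l
      by (rule measurable_Pair) (auto intro: measurable_into_label_space)
    then have [measurable]: "Measurable.pred M (\<lambda>x. (x, ext l) \<in> S)" for l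
      by (rule measurable_compose) (simp add: pred_sets1 S)
    show ?thesis by measurable
  qed
  ultimately show ?thesis by simp
qed

text \<open>Caratheodory's extension theorem, applied to the limit values on cylinders. The bound
  \<open>b\<close> confines the labels to a compact set, and the common marginal keeps mass from
  escaping in the vertices.\<close>

lemma weak_limit:
  fixes M :: "'a measure" and \<mu> :: "nat \<Rightarrow> ('a \<times> (nat \<Rightarrow> nat)) measure"
  assumes M: "prob_space M" and \<mu>: "\<And>t. prob_space (\<mu> t)"
    and sets: "\<And>t. sets (\<mu> t) = sets (labelled M)"
    and marginal: "\<And>t. distr (\<mu> t) M fst = M"
    and bounded: "\<And>t. AE \<xi> in \<mu> t. \<forall>p. snd \<xi> p \<le> b"
  shows "\<exists>m F. prob_space m \<and> sets m = sets (labelled M) \<and> F \<noteq> bot \<and> F \<le> sequentially \<and>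
    (\<forall>S \<in> cylinders M. ((\<lambda>t. measure (\<mu> t) S) \<longlongrightarrow> measure m S) F)"
proof -
  interpret M: prob_space M by fact
  interpret \<mu>: prob_space "\<mu> t" for t by fact
  interpret cyl: algebra "space (labelled M)" "cylinders M" by (rule cylinders_algebra)
  have sp: "space (\<mu> t) = space (labelled M)" for t using sets by (rule sets_eq_imp_space_eq)
  obtain g F where F: "F \<noteq> bot" "F \<le> sequentially"
    and lim: "\<And>S. ((\<lambda>t. measure (\<mu> t) S) \<longlongrightarrow> g S) F"
    using ex_limit_along_filter[of "\<lambda>t S. measure (\<mu> t) S"] by auto
  have g0: "0 \<le> g S" for S
    by (rule tendsto_lowerbound[OF lim _ F(1)]) simp
  have gadd: "g (S \<union> T) = g S + g T" if "S \<in> sets (labelled M)" "T \<in> sets (labelled M)" "S \<inter> T = {}" for S T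
  proof (rule tendsto_unique[OF F(1) lim])
    show "((\<lambda>t. measure (\<mu> t) (S \<union> T)) \<longlongrightarrow> g S + g T) F"
      using tendsto_add[OF lim lim] \<mu>.finite_measure_Union that sets by simp
  qed
  have gempty: "g {} = 0" by (rule tendsto_unique[OF F(1) lim]) simp
  \<comment> \<open>The right-hand side does not depend on \<open>t\<close> because all marginals
    are \<open>M\<close>, so the bound survives the limit.\<close>
  have gle: "g S \<le> measure M A" if "S \<in> sets (labelled M)" "A \<in> sets M"
    "\<And>x \<sigma>. (x, \<sigma>) \<in> S \<Longrightarrow> (\<forall>p. \<sigma> p \<le> b) \<Longrightarrow> x \<in> A" for S A
  proof (rule tendsto_upperbound[OF lim _ F(1)], intro always_eventually allI)
    fix t
    have [measurable]: "fst \<in> measurable (\<mu> t) M" using measurable_fst[of M label_space] sets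
      by (simp cong: measurable_cong_sets)
    have "measure (\<mu> t) S \<le> measure (\<mu> t) (fst -` A \<inter> space (\<mu> t))"
    proof (rule \<mu>.finite_measure_mono_AE)
      show "AE x in \<mu> t. x \<in> S \<longrightarrow> x \<in> fst -` A \<inter> space (\<mu> t)"
        using bounded[of t] AE_space by eventually_elim (use that(3) in force)
      show "fst -` A \<inter> space (\<mu> t) \<in> sets (\<mu> t)" using that(2) by measurable
    qed
    also have "\<dots> = measure (distr (\<mu> t) M fst) A" using that(2) by (simp add: measure_distr)
    also have "\<dots> = measure M A" by (simp add: marginal)
    finally show "measure (\<mu> t) S \<le> measure M A" .
  qed
  have "\<exists>\<mu>'. (\<forall>s\<in>cylinders M. \<mu>' s = ennreal (g s)) \<and>
      measure_space (space (labelled M)) (sigma_sets (space (labelled M)) (cylinders M)) \<mu>'"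
  proof (rule cyl.caratheodory_empty_continuous)
    show "positive (cylinders M) (\<lambda>s. ennreal (g s))" by (auto simp: positive_def gempty)
    show "additive (cylinders M) (\<lambda>s. ennreal (g s))"
      by (auto simp: additive_def gadd cylinders_sets g0 ennreal_plus)
    fix A :: "nat \<Rightarrow> ('a \<times> (nat \<Rightarrow> nat)) set"
    assume A: "range A \<subseteq> cylinders M" "decseq A" "(\<Inter>i. A i) = {}"
    then have cylA: "A i \<in> cylinders M" for i by auto
    define X where "X i = {x \<in> space M. \<exists>\<sigma>. (\<forall>p. \<sigma> p \<le> b) \<and> (x, \<sigma>) \<in> A i}" for i
    have X: "X i \<in> sets M" for i unfolding X_def by (rule sets_bounded_projection[OF cylA])
    have "decseq X" using A(2) unfolding X_def decseq_def by blast
    \<comment> \<open>Over a fixed \<open>x\<close> the bounded labels with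
      \<open>(x, \<sigma>)\<close> in \<open>A i\<close> form a decreasing sequence of nonempty
      compact sets; a common point would lie in every \<open>A i\<close>.\<close>
    have "(\<Inter>i. X i) = {}"
    proof (rule ccontr)
      assume "(\<Inter>i. X i) \<noteq> {}"
      then obtain x where x: "\<And>i. x \<in> X i" by blast
      let ?C = "\<lambda>i. {\<sigma>. (x, \<sigma>) \<in> A i}"
      have "{\<sigma>. \<forall>p. \<sigma> p \<le> b} \<inter> (\<Inter>(range ?C)) \<noteq> {}"
      proof (rule compact_imp_fip[OF compact_bounded_labels])
        fix T assume "T \<in> range ?C"
        then obtain i where "T = ?C i" by blast
        moreover obtain k where "depends_below k (A i)" using cylA[of i] by (auto simp: cylinders_def)
        ultimately show "closed T" using closed_section by simp
      next
        fix G assume G: "finite G" "G \<subseteq> range ?C"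
        then obtain I where I: "finite I" "G = ?C ` I" using finite_subset_image by metis
        obtain N where N: "\<forall>i\<in>I. i \<le> N" using I(1) finite_nat_set_iff_bounded_le by metis
        have "?C N \<subseteq> \<Inter>G" using A(2) N I(2) unfolding decseq_def by blast
        moreover obtain \<sigma> where "\<forall>p. \<sigma> p \<le> b" "(x, \<sigma>) \<in> A N" using x[of N] by (auto simp: X_def)
        ultimately show "{\<sigma>. \<forall>p. \<sigma> p \<le> b} \<inter> \<Inter>G \<noteq> {}" by blast
      qed
      then show False using A(3) by auto
    qed
    then have "(\<lambda>i. measure M (X i)) \<longlonglongrightarrow> 0"
      using M.finite_Lim_measure_decseq[of X] \<open>decseq X\<close> X by (auto simp: image_subset_iff)
    then have "(\<lambda>i. g (A i)) \<longlonglongrightarrow> 0"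
    proof (rule tendsto_0_le[where K=1], intro always_eventually allI)
      fix i show "norm (g (A i)) \<le> norm (measure M (X i)) * 1"
        using gle[OF cylinders_sets[OF cylA] X, of i i] g0[of "A i"] X_def sets.sets_into_space[OF cylinders_sets[OF cylA[of i]]]
        by (auto simp: space_labelled)
    qed
    then show "(\<lambda>i. ennreal (g (A i))) \<longlonglongrightarrow> 0"
      using tendsto_ennrealI by (metis ennreal_0)
  qed auto
  then obtain m' where m': "\<And>s. s \<in> cylinders M \<Longrightarrow> m' s = ennreal (g s)"
    "measure_space (space (labelled M)) (sigma_sets (space (labelled M)) (cylinders M)) m'" by blast
  define m where "m = measure_of (space (labelled M)) (cylinders M) m'"
  have sub: "cylinders M \<subseteq> Pow (space (labelled M))" by (rule cyl.space_closed)
  have sm: "sets m = sets (labelled M)"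
    unfolding m_def by (simp add: sets_measure_of[OF sub] sigma_sets_cylinders)
  have em: "emeasure m s = ennreal (g s)" if "s \<in> cylinders M" for s
  proof -
    have "emeasure m s = m' s"
      unfolding m_def using m'(2) sub that
      by (intro emeasure_measure_of[OF refl sub]) (auto simp: measure_space_def)
    then show ?thesis using m'(1)[OF that] by simp
  qed
  have "g (space (labelled M)) = 1"
  proof (rule tendsto_unique[OF F(1) lim])
    show "((\<lambda>t. measure (\<mu> t) (space (labelled M))) \<longlongrightarrow> 1) F"
      using \<mu>.prob_space by (simp add: sp)
  qed
  then have "prob_space m"
    using em[OF cyl.top] sets_eq_imp_space_eq[OF sm] by (intro prob_spaceI) simp
  moreover have "measure m S = g S" if "S \<in> cylinders M" for S
    using em[OF that] g0 by (simp add: measure_def)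
  ultimately show ?thesis using F sm lim by (intro exI[of _ m] exI[of _ F]) simp
qed

section \<open>Measurable enumeration of the neighbours\<close>

text \<open>The integral of a nonmeasurable \<open>f\<close> is a supremum over simple functions
  below \<open>f\<close>; the pointwise supremum of a maximizing sequence attains it.\<close>

lemma ex_measurable_minorant:
  fixes f :: "'a \<Rightarrow> ennreal"
  shows "\<exists>g \<in> borel_measurable M. (\<forall>x \<in> space M. g x \<le> f x) \<and> (\<integral>\<^sup>+x. g x \<partial>M) = (\<integral>\<^sup>+x. f x \<partial>M)"
proof -
  let ?A = "integral\<^sup>S M ` {g. simple_function M g \<and> g \<le> f}"
  have "?A \<noteq> {}" by (auto intro!: exI[of _ "\<lambda>_. 0"] simp: le_fun_def)
  from ennreal_Sup_countable_SUP[OF this] obtain h :: "nat \<Rightarrow> ennreal"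
    where h: "incseq h" "range h \<subseteq> ?A" "Sup ?A = (SUP i. h i)" by auto
  then have "\<forall>i. \<exists>g. simple_function M g \<and> g \<le> f \<and> h i = integral\<^sup>S M g" by blast
  then obtain G where G: "\<And>i. simple_function M (G i)" "\<And>i. G i \<le> f" "\<And>i. h i = integral\<^sup>S M (G i)"
    by metis
  let ?g = "\<lambda>x. SUP i. G i x"
  have m: "?g \<in> borel_measurable M" using G(1) by (intro borel_measurable_SUP) (auto intro: borel_measurable_simple_function)
  have le: "?g x \<le> f x" for x using G(2) by (auto intro!: SUP_least simp: le_fun_def)
  have "(\<integral>\<^sup>+x. ?g x \<partial>M) \<le> (\<integral>\<^sup>+x. f x \<partial>M)" by (intro nn_integral_mono le)
  moreover have "(\<integral>\<^sup>+x. f x \<partial>M) \<le> (\<integral>\<^sup>+x. ?g x \<partial>M)"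
  proof -
    have "(\<integral>\<^sup>+x. f x \<partial>M) = (SUP i. h i)" unfolding nn_integral_def h(3)[symmetric] by (simp add: image_def)
    also have "\<dots> \<le> (\<integral>\<^sup>+x. ?g x \<partial>M)"
    proof (rule SUP_least)
      fix i
      have "h i = (\<integral>\<^sup>+x. G i x \<partial>M)" using G by (simp add: nn_integral_eq_simple_integral)
      also have "\<dots> \<le> (\<integral>\<^sup>+x. ?g x \<partial>M)" by (intro nn_integral_mono SUP_upper) auto
      finally show "h i \<le> (\<integral>\<^sup>+x. ?g x \<partial>M)" .
    qed
    finally show ?thesis .
  qed
  ultimately show ?thesis using m le by (intro bexI[of _ ?g]) auto
qed

text \<open>Finite intersections of a countable base: stable under intersection, as pi-lambda
  inductions require, and separating points because the topology is Hausdorff.\<close>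

lemma standard_borel_countable_generator:
  assumes "standard_borel M"
  shows "\<exists>G. countable G \<and> Int_stable G \<and> G \<subseteq> Pow (space M) \<and> sets M = sigma_sets (space M) G \<and> space M \<in> G \<and>
    (\<forall>x\<in>space M. \<forall>y\<in>space M. x \<noteq> y \<longrightarrow> (\<exists>U\<in>G. x \<in> U \<and> y \<notin> U))"
proof -
  from assms obtain T where T: "completely_metrizable_space T" "second_countable T"
    and top: "topspace T = space M" and sets: "sets M = sigma_sets (topspace T) {U. openin T U}"
    unfolding standard_borel_def by blast
  from T(2) obtain B where B: "countable B" "\<And>V. V \<in> B \<Longrightarrow> openin T V"
    "\<And>U x. openin T U \<Longrightarrow> x \<in> U \<Longrightarrow> \<exists>V\<in>B. x \<in> V \<and> V \<subseteq> U"
    unfolding second_countable_def by metis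
  define G where "G = (\<lambda>F. space M \<inter> \<Inter>F) ` {F. F \<subseteq> B \<and> finite F}"
  have "countable G" unfolding G_def using countable_Collect_finite_subset[OF B(1)]
    by (intro countable_image) (simp add: conj_commute)
  moreover have "Int_stable G"
  proof (rule Int_stableI)
    fix a b assume "a \<in> G" "b \<in> G"
    then obtain F F' where F: "F \<subseteq> B" "finite F" "a = space M \<inter> \<Inter>F" "F' \<subseteq> B" "finite F'" "b = space M \<inter> \<Inter>F'"
      unfolding G_def by auto
    have "a \<inter> b = space M \<inter> \<Inter>(F \<union> F')" using F by auto
    then show "a \<inter> b \<in> G" unfolding G_def using F by (intro image_eqI[of _ _ "F \<union> F'"]) auto
  qed
  moreover have GP: "G \<subseteq> Pow (space M)" unfolding G_def by auto
  moreover have top_G: "space M \<in> G" unfolding G_def by (intro image_eqI[of _ _ "{}"]) auto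
  ultimately have 1: "countable G" "Int_stable G" "G \<subseteq> Pow (space M)" "space M \<in> G" by auto
  have BG: "V \<in> G" if "V \<in> B" for V
  proof -
    have "V = space M \<inter> \<Inter>{V}" using openin_subset[OF B(2)[OF that]] top by auto
    then show ?thesis unfolding G_def using that by (intro image_eqI[of _ _ "{V}"]) auto
  qed
  have "sets M = sigma_sets (space M) G"
  proof
    show "sets M \<subseteq> sigma_sets (space M) G"
    proof -
      have "U \<in> sigma_sets (space M) G" if U: "openin T U" for U
      proof -
        have "U = \<Union>{V\<in>B. V \<subseteq> U}" using B(3)[OF U] by blast
        moreover have "\<Union>{V\<in>B. V \<subseteq> U} \<in> sigma_sets (space M) G"
          using B(1) BG by (intro sigma_sets_UNION) (auto intro: countable_subset)
        ultimately show ?thesis by simp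
      qed
      then show ?thesis unfolding sets top by (intro sigma_sets_mono) auto
    qed
    have "g \<in> sets M" if "g \<in> G" for g
    proof -
      from that obtain F where F: "F \<subseteq> B" "finite F" "g = space M \<inter> \<Inter>F" unfolding G_def by auto
      have "openin T g" unfolding F(3) top[symmetric] 
      proof (cases "F = {}")
        case False
        then have "openin T (\<Inter>F)" using F B(2) by (intro openin_Inter) auto
        then show "openin T (topspace T \<inter> \<Inter>F)" by blast
      qed simp
      then show ?thesis unfolding sets by blast
    qed
    then show "sigma_sets (space M) G \<subseteq> sets M" by (intro sets.sigma_sets_subset) auto
  qed
  moreover have "\<exists>U\<in>G. x \<in> U \<and> y \<notin> U" if xy: "x\<in>space M" "y\<in>space M" "x \<noteq> y" for x y
  proof -
    have "Hausdorff_space T"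
      using T(1) completely_metrizable_imp_metrizable_space metrizable_imp_Hausdorff_space by blast
    then obtain U V where "openin T U" "x \<in> U" "openin T V" "y \<in> V" "disjnt U V"
      using xy top unfolding Hausdorff_space_def by metis
    then show ?thesis using B(3)[of U x] BG by (auto simp: disjnt_iff)
  qed
  ultimately show ?thesis using 1 by (intro exI[of _ G]) simp
qed

text \<open>Separation holds for ordered pairs, so one implication for each of the countably many
  \<open>U i\<close> already decides equality.\<close>

lemma pred_eq_of_separating:
  assumes "\<And>i::nat. U i \<in> sets M"
    and sep: "\<And>x y. x \<in> space M \<Longrightarrow> y \<in> space M \<Longrightarrow> x \<noteq> y \<Longrightarrow> \<exists>i. x \<in> U i \<and> y \<notin> U i"
    and fg: "f \<in> measurable K M" "g \<in> measurable K M"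
  shows "Measurable.pred K (\<lambda>x. f x = g x)"
proof -
  have [measurable]: "U i \<in> sets M" "f \<in> measurable K M" "g \<in> measurable K M" for i by fact+
  have "f x = g x \<longleftrightarrow> (\<forall>i. f x \<in> U i \<longrightarrow> g x \<in> U i)" if "x \<in> space K" for x
    using sep[of "f x" "g x"] measurable_space[OF fg(1) that] measurable_space[OF fg(2) that] by metis
  then show ?thesis by (subst measurable_cong) (assumption, measurable)
qed

text \<open>Serves to number the neighbours of a vertex in the order of their codes.\<close>

lemma bij_betw_rank:
  fixes f :: "'a \<Rightarrow> nat"
  assumes "finite S" "inj_on f S"
  shows "bij_betw (\<lambda>y. card {z \<in> S. f z < f y}) S {..<card S}"
proof -
  let ?rk = "\<lambda>y. card {z \<in> S. f z < f y}"
  have less: "?rk y < ?rk y'" if "y \<in> S" "y' \<in> S" "f y < f y'" for y y'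
    using that assms(1) by (intro psubset_card_mono) auto
  have inj: "inj_on ?rk S"
  proof (rule inj_onI, rule ccontr)
    fix y y' assume y: "y \<in> S" "y' \<in> S" "?rk y = ?rk y'" "y \<noteq> y'"
    then have "f y \<noteq> f y'" using assms(2) by (auto dest: inj_onD)
    then show False using less[OF y(1,2)] less[OF y(2,1)] y(3) by linarith
  qed
  have "?rk ` S \<subseteq> {..<card S}"
  proof (safe, goal_cases)
    case (1 _ y)
    then have "{z \<in> S. f z < f y} \<subset> S" by auto
    then show ?case using assms(1) by (simp add: psubset_card_mono)
  qed
  moreover have "card (?rk ` S) = card {..<card S}" using inj by (simp add: card_image)
  ultimately have "?rk ` S = {..<card S}" by (intro card_subset_eq) auto
  then show ?thesis using inj by (simp add: bij_betw_def)
qed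

lemma AE_eq_const_of_le_const:
  fixes f :: "'a \<Rightarrow> ennreal"
  assumes "prob_space M" "f \<in> borel_measurable M" "\<And>x. x \<in> space M \<Longrightarrow> f x \<le> c" "c \<noteq> \<infinity>"
    and "(\<integral>\<^sup>+x. f x \<partial>M) = c"
  shows "AE x in M. f x = c"
proof -
  interpret prob_space M by fact
  have "(\<integral>\<^sup>+x. c - f x \<partial>M) = (\<integral>\<^sup>+x. c \<partial>M) - (\<integral>\<^sup>+x. f x \<partial>M)"
    using assms by (intro nn_integral_diff) (auto simp: top.not_eq_extremum)
  also have "\<dots> = 0" using assms(4,5) by (simp add: emeasure_space_1)
  finally have "AE x in M. c - f x = 0"
    using assms(2) by (subst (asm) nn_integral_0_iff_AE) auto
  then show ?thesis using AE_space
  proof eventually_elim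
    case (elim x)
    then show ?case using assms(3)[of x] by (metis diff_eq_0_iff_ennreal order_antisym)
  qed
qed

section \<open>Regular graphings: measurability of degrees\<close>

locale regular_graph_measure =
  fixes n :: nat and M :: "'a measure" and E :: "('a \<times> 'a) set"
  assumes regular: "regular_graphing n M E"
begin

sublocale prob_space M using regular by (simp add: regular_graphing_def graphing_def)

lemma edges_in_space: "(x, y) \<in> E \<Longrightarrow> x \<in> space M \<and> y \<in> space M"
proof -
  have "E \<in> sets (M \<Otimes>\<^sub>M M)" using regular by (simp add: regular_graphing_def graphing_def)
  then show "(x, y) \<in> E \<Longrightarrow> x \<in> space M \<and> y \<in> space M"
    using sets.sets_into_space[of E "M \<Otimes>\<^sub>M M"] by (auto simp: space_pair_measure)
qed

lemma finite_neighbours: "finite {y. (x, y) \<in> E}"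
proof (cases "x \<in> space M")
  case True
  then show ?thesis using regular by (auto simp: regular_graphing_def graphing_def)
next
  case False
  then have "{y. (x, y) \<in> E} = {}" using edges_in_space by auto
  then show ?thesis by simp
qed

lemma card_neighbours: "x \<in> space M \<Longrightarrow> card {y. (x, y) \<in> E} = n"
proof -
  assume x: "x \<in> space M"
  then have "degree_in E x (space M) = n" using regular by (auto simp: regular_graphing_def)
  moreover have "{y \<in> space M. (x, y) \<in> E} = {y. (x, y) \<in> E}" using edges_in_space by auto
  ultimately show ?thesis by (simp add: degree_in_def)
qed

lemma edge_sym: "(x, y) \<in> E \<Longrightarrow> (y, x) \<in> E"
  using regular by (auto simp: regular_graphing_def graphing_def dest: symD)

lemma edge_neq: "(x, y) \<in> E \<Longrightarrow> x \<noteq> y"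
  using regular by (auto simp: regular_graphing_def graphing_def irrefl_def)

lemma mass_transport:
  "A \<in> sets M \<Longrightarrow> B \<in> sets M \<Longrightarrow>
    (\<integral>\<^sup>+x\<in>A. of_nat (degree_in E x B) \<partial>M) = (\<integral>\<^sup>+x\<in>B. of_nat (degree_in E x A) \<partial>M)"
  using regular by (simp add: regular_graphing_def graphing_def)

text \<open>As a counting measure the degree is countably additive in \<open>B\<close>.\<close>

lemma degree_in_emeasure:
  "(of_nat (degree_in E x B) :: ennreal) = emeasure (count_space UNIV) (B \<inter> {y. (x, y) \<in> E})"
proof -
  have "{y \<in> B. (x, y) \<in> E} = B \<inter> {y. (x, y) \<in> E}" by auto
  then show ?thesis using finite_neighbours[of x]
    by (simp add: degree_in_def emeasure_count_space)
qed

lemma degree_in_compl: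
  assumes "x \<in> space M" "B \<subseteq> space M"
  shows "degree_in E x B + degree_in E x (space M - B) = n"
proof -
  have "degree_in E x B + degree_in E x (space M - B)
    = card ({y \<in> B. (x, y) \<in> E} \<union> {y \<in> space M - B. (x, y) \<in> E})"
    unfolding degree_in_def using finite_neighbours[of x]
    by (intro card_Un_disjoint[symmetric]) (auto intro: finite_subset)
  also have "{y \<in> B. (x, y) \<in> E} \<union> {y \<in> space M - B. (x, y) \<in> E} = {y. (x, y) \<in> E}"
    using edges_in_space assms by auto
  finally show ?thesis using card_neighbours[OF assms(1)] by simp
qed

text \<open>Mass transport between \<open>B\<close> and the whole space, into which the degree is
  constant.\<close>

lemma nn_integral_degree_in:
  assumes "B \<in> sets M"
  shows "(\<integral>\<^sup>+x. of_nat (degree_in E x B) \<partial>M) = of_nat n * emeasure M B"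
proof -
  have "(\<integral>\<^sup>+x. of_nat (degree_in E x B) \<partial>M) = (\<integral>\<^sup>+x\<in>space M. of_nat (degree_in E x B) \<partial>M)"
    by (intro nn_integral_cong) auto
  also have "\<dots> = (\<integral>\<^sup>+x\<in>B. of_nat (degree_in E x (space M)) \<partial>M)"
    using assms by (intro mass_transport) auto
  also have "\<dots> = (\<integral>\<^sup>+x. of_nat n * indicator B x \<partial>M)"
    using regular by (intro nn_integral_cong) (auto simp: regular_graphing_def)
  also have "\<dots> = of_nat n * emeasure M B"
    using assms by (simp add: nn_integral_cmult_indicator)
  finally show ?thesis .
qed

text \<open>
  The integral of a nonmeasurable function is a lower integral.  The lower integrals of the
  complementary degrees \<open>degree_in E x B\<close> and \<open>n - degree_in E x B\<close> add up to \<open>n\<close>, so the upper and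
  the lower integral of the degree coincide and the degree is measurable up to a null set.
\<close>

lemma degree_in_AE_measurable:
  assumes B: "B \<in> sets M"
  shows "\<exists>Y \<in> sets M. \<exists>g \<in> borel_measurable M. emeasure M (space M - Y) = 0 \<and>
    (\<forall>x\<in>Y. of_nat (degree_in E x B) = (g x :: ennreal))"
proof -
  let ?d = "\<lambda>B x. of_nat (degree_in E x B) :: ennreal"
  obtain g where [measurable]: "g \<in> borel_measurable M" and g: "\<And>x. x \<in> space M \<Longrightarrow> g x \<le> ?d B x"
    "(\<integral>\<^sup>+x. g x \<partial>M) = (\<integral>\<^sup>+x. ?d B x \<partial>M)"
    using ex_measurable_minorant[of M "?d B"] by blast
  obtain h where [measurable]: "h \<in> borel_measurable M"
    and h: "\<And>x. x \<in> space M \<Longrightarrow> h x \<le> ?d (space M - B) x"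
    "(\<integral>\<^sup>+x. h x \<partial>M) = (\<integral>\<^sup>+x. ?d (space M - B) x \<partial>M)"
    using ex_measurable_minorant[of M "?d (space M - B)"] by blast
  have sum: "?d B x + ?d (space M - B) x = of_nat n" if "x \<in> space M" for x
    using degree_in_compl[OF that sets.sets_into_space[OF B]] by (metis of_nat_add)
  have "(\<integral>\<^sup>+x. g x + h x \<partial>M) = of_nat n * emeasure M B + of_nat n * emeasure M (space M - B)"
    using B by (simp add: nn_integral_add g h nn_integral_degree_in)
  also have "\<dots> = of_nat n * (emeasure M B + emeasure M (space M - B))" by (simp add: distrib_left)
  also have "emeasure M B + emeasure M (space M - B) = 1"
    using B sets.sets_into_space[OF B]
    by (subst plus_emeasure) (auto simp: Un_absorb1 emeasure_space_1)
  finally have int: "(\<integral>\<^sup>+x. g x + h x \<partial>M) = of_nat n" by simp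
  have ae: "AE x in M. g x + h x = of_nat n"
  proof (rule AE_eq_const_of_le_const[OF prob_space_axioms])
    show "g x + h x \<le> of_nat n" if "x \<in> space M" for x
      using add_mono[OF g(1)[OF that] h(1)[OF that]] sum[OF that] by simp
  qed (use int in auto)
  define Y where "Y = {x \<in> space M. g x + h x = of_nat n}"
  have [measurable]: "Y \<in> sets M" unfolding Y_def by measurable
  have "emeasure M (space M - Y) = 0"
  proof -
    have "space M - Y = {x \<in> space M. \<not> (g x + h x = of_nat n)}" by (auto simp: Y_def)
    then show ?thesis using ae by (subst (asm) AE_iff_measurable[OF _ refl]) auto
  qed
  moreover have "?d B x = g x" if "x \<in> Y" for x
  proof -
    have x: "x \<in> space M" "g x + h x = of_nat n" using that by (auto simp: Y_def)
    \<comment> \<open>On \<open>Y\<close> the minorants add up to \<open>n\<close>. Replacing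
      \<open>h\<close> by the degree that it minorizes gives a finite summand common to both sides,
      which cancels.\<close>
    have "?d B x + ?d (space M - B) x \<le> g x + ?d (space M - B) x"
      using sum[OF x(1)] x(2) add_left_mono[OF h(1)[OF x(1)], of "g x"] by simp
    then have "?d B x \<le> g x"
      by (metis add.commute ennreal_add_left_cancel_le of_nat_less_top order_less_irrefl infinity_ennreal_def)
    then show ?thesis using g(1)[OF x(1)] by simp
  qed
  ultimately show ?thesis
    using \<open>Y \<in> sets M\<close> by (intro bexI[of _ Y] bexI[of _ g]) auto
qed

text \<open>The exceptional null set must not depend on \<open>B\<close>. The null sets of a
  countable generator are united, and a pi-lambda induction reaches all \<open>B\<close>:
  complements by regularity, disjoint unions by countable additivity of counting.\<close>

lemma degree_in_measurable:
  "\<exists>Y \<in> sets M. emeasure M (space M - Y) = 0 \<and>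
     (\<forall>B \<in> sets M. (\<lambda>x. if x \<in> Y then of_nat (degree_in E x B) else 0 :: ennreal) \<in> borel_measurable M)"
proof -
  have "standard_borel M" using regular by (simp add: regular_graphing_def graphing_def)
  then obtain G where G: "countable G" "Int_stable G" "G \<subseteq> Pow (space M)"
    "sets M = sigma_sets (space M) G"
    using standard_borel_countable_generator by metis
  have Gs: "V \<in> sets M" if "V \<in> G" for V using that G(4) by auto
  have "\<forall>V\<in>G. \<exists>Y g. Y \<in> sets M \<and> g \<in> borel_measurable M \<and> emeasure M (space M - Y) = 0 \<and>
    (\<forall>x\<in>Y. of_nat (degree_in E x V) = (g x :: ennreal))"
    using degree_in_AE_measurable Gs by blast
  then obtain Yf gf where Yg: "\<And>V. V \<in> G \<Longrightarrow> Yf V \<in> sets M" "\<And>V. V \<in> G \<Longrightarrow> gf V \<in> borel_measurable M"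
    "\<And>V. V \<in> G \<Longrightarrow> emeasure M (space M - Yf V) = 0"
    "\<And>V x. V \<in> G \<Longrightarrow> x \<in> Yf V \<Longrightarrow> of_nat (degree_in E x V) = (gf V x :: ennreal)"
    by metis
  define Y where "Y = space M - (\<Union>V\<in>G. space M - Yf V)"
  have nul: "(\<Union>V\<in>G. space M - Yf V) \<in> null_sets M"
    using Yg G(1) by (intro null_sets_UN') auto
  then have Ys[measurable]: "Y \<in> sets M" unfolding Y_def by auto
  have "space M - Y = (\<Union>V\<in>G. space M - Yf V)" unfolding Y_def by auto
  then have Y0: "emeasure M (space M - Y) = 0" using nul by auto
  let ?f = "\<lambda>B x. if x \<in> Y then of_nat (degree_in E x B) else 0 :: ennreal"
  have "?f B \<in> borel_measurable M" if "B \<in> sigma_sets (space M) G" for B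
    using G(2,3) that
  proof (induction rule: sigma_sets_induct_disjoint)
    case (basic V)
    have [measurable]: "gf V \<in> borel_measurable M" using Yg basic by auto
    have "?f V x = (if x \<in> Y then gf V x else 0)" if "x \<in> space M" for x
      using Yg(4)[OF basic, of x] basic by (auto simp: Y_def)
    then show ?case by (subst measurable_cong) auto
  next
    case empty
    have "?f {} = (\<lambda>_. 0)" by (auto simp: degree_in_def)
    then show ?case by simp
  next
    case (compl A)
    have A: "A \<in> sets M" using compl by (simp add: G(4))
    have eq: "?f (space M - A) x = (if x \<in> Y then of_nat n else 0) - ?f A x" if "x \<in> space M" for x
    proof -
      have "of_nat n = (of_nat (degree_in E x A) :: ennreal) + of_nat (degree_in E x (space M - A))"
        using degree_in_compl[OF that sets.sets_into_space[OF A]] by (metis of_nat_add)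
      then show ?thesis by simp
    qed
    have [measurable]: "?f A \<in> borel_measurable M" by (rule compl)
    have "(\<lambda>x. (if x \<in> Y then of_nat n else 0) - ?f A x) \<in> borel_measurable M" by measurable
    then show ?case
      using measurable_cong[of M "?f (space M - A)" "\<lambda>x. (if x \<in> Y then of_nat n else 0) - ?f A x", OF eq]
      by blast
  next
    case (union A)
    have "?f (\<Union>i. A i) x = (\<Sum>i. ?f (A i) x)" for x
    proof -
      have "(\<Sum>i. of_nat (degree_in E x (A i)) :: ennreal) = of_nat (degree_in E x (\<Union>i. A i))"
        unfolding degree_in_emeasure
        by (subst suminf_emeasure) (use union(1) in \<open>auto simp: disjoint_family_on_def intro!: arg_cong[of _ _ "emeasure _"]\<close>)
      then show ?thesis by simp
    qed
    then show ?case using union by simp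
  qed
  then show ?thesis using Ys Y0 G(4) by blast
qed

text \<open>The vertices with a neighbour in a null set form a null set again, because the integral
  of the degree into a null set vanishes. Removing all iterates of this enlargement leaves a union
  of components.\<close>

lemma saturated_core:
  obtains X0 where "X0 \<in> sets M" "AE x in M. x \<in> X0" "\<And>x y. x \<in> X0 \<Longrightarrow> (x, y) \<in> E \<Longrightarrow> y \<in> X0"
    "\<And>B. B \<in> sets M \<Longrightarrow> (\<lambda>x. if x \<in> X0 then degree_in E x B else 0) \<in> measurable M (count_space UNIV)"
proof -
  obtain Y where Y[measurable]: "Y \<in> sets M" and Y0: "emeasure M (space M - Y) = 0"
    and meas: "\<And>B. B \<in> sets M \<Longrightarrow>
      (\<lambda>x. if x \<in> Y then of_nat (degree_in E x B) else 0 :: ennreal) \<in> borel_measurable M"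
    using degree_in_measurable by blast
  have Ysub: "Y \<subseteq> space M" using sets.sets_into_space[OF Y] .
  define K where "K = rec_nat (space M - Y) (\<lambda>_ A. A \<union> {x \<in> Y. degree_in E x A \<noteq> 0})"
  have K_0: "K 0 = space M - Y" and K_Suc: "K (Suc i) = K i \<union> {x \<in> Y. degree_in E x (K i) \<noteq> 0}" for i
    by (simp_all add: K_def)
  have null_step: "{x \<in> Y. degree_in E x A \<noteq> 0} \<in> null_sets M" if "A \<in> null_sets M" for A
  proof -
    have A: "A \<in> sets M" "emeasure M A = 0" using that by auto
    let ?f = "\<lambda>x. if x \<in> Y then of_nat (degree_in E x A) else 0 :: ennreal"
    have [measurable]: "?f \<in> borel_measurable M" by (rule meas[OF A(1)])
    have "(\<integral>\<^sup>+x. ?f x \<partial>M) \<le> (\<integral>\<^sup>+x. of_nat (degree_in E x A) \<partial>M)"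
      by (intro nn_integral_mono) auto
    also have "\<dots> = 0" using nn_integral_degree_in[OF A(1)] A(2) by simp
    finally have "(\<integral>\<^sup>+x. ?f x \<partial>M) = 0" by simp
    then have "AE x in M. ?f x = 0" by (subst (asm) nn_integral_0_iff_AE) auto
    moreover have eq: "{x \<in> space M. \<not> ?f x = 0} = {x \<in> Y. degree_in E x A \<noteq> 0}" using Ysub by auto
    moreover have "{x \<in> space M. \<not> ?f x = 0} \<in> sets M" by measurable
    ultimately show ?thesis using AE_iff_measurable[OF _ eq] by auto
  qed
  have K_null: "K i \<in> null_sets M" for i
  proof (induction i)
    case 0
    show ?case unfolding K_0 using Y0 by auto
  next
    case (Suc i)
    then show ?case unfolding K_Suc using null_step by blast
  qed
  define X0 where "X0 = space M - (\<Union>i. K i)"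
  have Knull: "(\<Union>i. K i) \<in> null_sets M" using K_null by auto
  have [measurable]: "X0 \<in> sets M" unfolding X0_def using Knull by auto
  have XY: "X0 \<subseteq> Y" using K_0 by (auto simp: X0_def)
  have "AE x in M. x \<notin> (\<Union>i. K i)" by (rule AE_not_in[OF Knull])
  then have "AE x in M. x \<in> X0" using AE_space by eventually_elim (auto simp: X0_def)
  moreover have "y \<in> X0" if xy: "x \<in> X0" "(x, y) \<in> E" for x y
  proof (rule ccontr)
    assume "y \<notin> X0"
    then obtain i where i: "y \<in> K i" using edges_in_space[OF xy(2)] by (auto simp: X0_def)
    then have "{y \<in> K i. (x, y) \<in> E} \<noteq> {}" "finite {y \<in> K i. (x, y) \<in> E}"
      using xy finite_neighbours[of x] by auto
    then have "degree_in E x (K i) \<noteq> 0" by (simp add: degree_in_def)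
    then have "x \<in> K (Suc i)" using XY xy(1) by (auto simp: K_Suc)
    then show False using xy(1) by (auto simp: X0_def)
  qed
  moreover have "(\<lambda>x. if x \<in> X0 then degree_in E x B else 0) \<in> measurable M (count_space UNIV)"
    if "B \<in> sets M" for B
  proof (subst measurable_count_space_eq2_countable, intro conjI ballI)
    fix k :: nat
    have [measurable]: "(\<lambda>x. if x \<in> Y then of_nat (degree_in E x B) else 0 :: ennreal) \<in> borel_measurable M"
      by (rule meas[OF that])
    have "(\<lambda>x. if x \<in> X0 then degree_in E x B else 0) -` {k} \<inter> space M =
      {x \<in> space M. if x \<in> X0 then (if x \<in> Y then of_nat (degree_in E x B) else 0 :: ennreal) = of_nat k else k = 0}"
      using XY by auto
    also have "\<dots> \<in> sets M" by measurable
    finally show "(\<lambda>x. if x \<in> X0 then degree_in E x B else 0) -` {k} \<inter> space M \<in> sets M" .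
  qed auto
  ultimately show thesis using that[of X0] by simp
qed

end

text \<open>
  The dart \<open>j\<close> of a vertex \<open>x\<close> leads to \<open>N j x\<close>, and \<open>r j x\<close> is the dart at \<open>N j x\<close> leading back to \<open>x\<close>.
  The last condition but two is the mass transport principle for darts.
\<close>

locale dart_system = prob_space M for M :: "'a measure" +
  fixes n :: nat and X0 :: "'a set" and N :: "nat \<Rightarrow> 'a \<Rightarrow> 'a" and r :: "nat \<Rightarrow> 'a \<Rightarrow> nat"
    and U :: "nat \<Rightarrow> 'a set"
  assumes X0_sets [measurable]: "X0 \<in> sets M" and AE_X0: "AE x in M. x \<in> X0"
    and N_measurable [measurable]: "\<And>j. N j \<in> measurable M M"
    and r_measurable [measurable]: "\<And>j. r j \<in> measurable M (count_space UNIV)"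
    and N_X0: "\<And>x j. x \<in> X0 \<Longrightarrow> N j x \<in> X0"
    and N_ge: "\<And>x j. n \<le> j \<Longrightarrow> N j x = x"
    and r_less: "\<And>x j. x \<in> X0 \<Longrightarrow> j < n \<Longrightarrow> r j x < n"
    and N_r: "\<And>x j. x \<in> X0 \<Longrightarrow> j < n \<Longrightarrow> N (r j x) (N j x) = x"
    and r_r: "\<And>x j. x \<in> X0 \<Longrightarrow> j < n \<Longrightarrow> r (r j x) (N j x) = j"
    and N_neq: "\<And>x j. x \<in> X0 \<Longrightarrow> j < n \<Longrightarrow> N j x \<noteq> x"
    and N_inj: "\<And>x j k. x \<in> X0 \<Longrightarrow> j < n \<Longrightarrow> k < n \<Longrightarrow> N j x = N k x \<Longrightarrow> j = k"
    and transport: "\<And>j k S. j < n \<Longrightarrow> k < n \<Longrightarrow> S \<in> sets M \<Longrightarrow>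
      emeasure M {x \<in> X0. r j x = k \<and> N j x \<in> S} = emeasure M {x \<in> X0. r k x = j \<and> x \<in> S}"
    and U_sets [measurable]: "\<And>i. U i \<in> sets M"
    and U_separates: "\<And>x y. x \<in> space M \<Longrightarrow> y \<in> space M \<Longrightarrow> x \<noteq> y \<Longrightarrow> \<exists>i. x \<in> U i \<and> y \<notin> U i"

text \<open>A binary number whose digits record membership in \<open>U 0\<close>, ...,
  \<open>U (l - 1)\<close>: it names the atom of \<open>y\<close> in the partition generated by
  these sets.\<close>

fun cell :: "(nat \<Rightarrow> 'a set) \<Rightarrow> nat \<Rightarrow> 'a \<Rightarrow> nat" where
  "cell U 0 y = 0"
| "cell U (Suc l) y = 2 * cell U l y + (if y \<in> U l then 1 else 0)"

lemma cell_measurable: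
  assumes [measurable]: "\<And>i. U i \<in> sets M"
  shows "cell U l \<in> measurable M (count_space UNIV)"
proof (induction l)
  case (Suc l)
  have "(\<lambda>y. if y \<in> U l then 2 * cell U l y + 1 else 2 * cell U l y) \<in> measurable M (count_space UNIV)"
  proof (rule measurable_If)
    show "(\<lambda>y. 2 * cell U l y + 1) \<in> measurable M (count_space UNIV)"
      by (rule measurable_compose[OF Suc]) simp
    show "(\<lambda>y. 2 * cell U l y) \<in> measurable M (count_space UNIV)"
      by (rule measurable_compose[OF Suc]) simp
  qed (use assms in measurable)
  also have "(\<lambda>y. if y \<in> U l then 2 * cell U l y + 1 else 2 * cell U l y) = cell U (Suc l)"
    by (rule ext) simp
  finally show ?case .
qed simp

lemma cell_eqD: "cell U l y = cell U l z \<Longrightarrow> i < l \<Longrightarrow> y \<in> U i \<longleftrightarrow> z \<in> U i"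
proof (induction l)
  case (Suc l)
  from Suc.prems(1) have "cell U l y = cell U l z \<and> (y \<in> U l \<longleftrightarrow> z \<in> U l)"
    by (simp split: if_splits) presburger+
  then show ?case using Suc less_Suc_eq by auto
qed simp

lemma ex_inj_on_cell:
  assumes "finite S" "\<And>x y. x \<in> S \<Longrightarrow> y \<in> S \<Longrightarrow> x \<noteq> y \<Longrightarrow> \<exists>i. x \<in> U i \<and> y \<notin> U i"
  shows "\<exists>l. inj_on (cell U l) S"
proof -
  obtain s where s: "\<And>x y. x \<in> S \<Longrightarrow> y \<in> S \<Longrightarrow> x \<noteq> y \<Longrightarrow> x \<in> U (s x y) \<and> y \<notin> U (s x y)"
    using assms(2) by metis
  have "finite ((\<lambda>(x, y). s x y) ` (S \<times> S))" using assms(1) by auto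
  then obtain l where l: "\<And>i. i \<in> (\<lambda>(x, y). s x y) ` (S \<times> S) \<Longrightarrow> i < l"
    using finite_nat_set_iff_bounded by metis
  have "inj_on (cell U l) S"
  proof (rule inj_onI, rule ccontr)
    fix x y assume xy: "x \<in> S" "y \<in> S" "cell U l x = cell U l y" "x \<noteq> y"
    then have "s x y < l" by (intro l) auto
    then show False using cell_eqD[OF xy(3)] s[OF xy(1,2,4)] by auto
  qed
  then show ?thesis ..
qed

section \<open>Numbering the neighbours\<close>

context regular_graph_measure
begin

text \<open>A vertex uses the least level at which the codes tell its neighbours apart and numbers
  them in the order of these codes. All of this can be expressed by degrees into measurable sets,
  which \<open>deg\<close> makes measurable.\<close>

lemma neighbour_enumeration:
  fixes U :: "nat \<Rightarrow> 'a set"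
  assumes X0 [measurable]: "X0 \<in> sets M" and sat: "\<And>x y. x \<in> X0 \<Longrightarrow> (x, y) \<in> E \<Longrightarrow> y \<in> X0"
    and deg: "\<And>B. B \<in> sets M \<Longrightarrow> (\<lambda>x. if x \<in> X0 then degree_in E x B else 0) \<in> measurable M (count_space UNIV)"
    and U [measurable]: "\<And>i. U i \<in> sets M"
    and sep: "\<And>x y. x \<in> space M \<Longrightarrow> y \<in> space M \<Longrightarrow> x \<noteq> y \<Longrightarrow> \<exists>i. x \<in> U i \<and> y \<notin> U i"
  obtains N where "\<And>j. N j \<in> measurable M M"
    "\<And>x. x \<in> X0 \<Longrightarrow> bij_betw (\<lambda>j. N j x) {..<n} {y. (x, y) \<in> E}"
    "\<And>x j. n \<le> j \<or> x \<notin> X0 \<Longrightarrow> N j x = x"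
proof -
  have X0_sub: "X0 \<subseteq> space M" using sets.sets_into_space[OF X0] .
  define nb where "nb x = {y. (x, y) \<in> E}" for x
  have nb_sub: "nb x \<subseteq> space M" for x using edges_in_space by (auto simp: nb_def)
  have nb_fin: "finite (nb x)" for x by (simp add: nb_def finite_neighbours)
  define lev where "lev x = (LEAST l. inj_on (cell U l) (nb x))" for x
  have lev: "inj_on (cell U (lev x)) (nb x)" for x
    unfolding lev_def by (rule LeastI_ex, rule ex_inj_on_cell[OF nb_fin]) (use sep nb_sub in blast)
  define rk where "rk x y = card {z \<in> nb x. cell U (lev x) z < cell U (lev x) y}" for x y
  have rk: "bij_betw (rk x) (nb x) {..<n}" if "x \<in> X0" for x
    using bij_betw_rank[OF nb_fin lev, of x] card_neighbours[of x] that X0_sub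
    unfolding rk_def by (auto simp: nb_def)
  \<comment> \<open>The identity outside the range makes every list of naturals a walk.\<close>
  define N where "N j x = (if x \<in> X0 \<and> j < n then the_inv_into (nb x) (rk x) j else x)" for j x
  have bij: "bij_betw (\<lambda>j. N j x) {..<n} (nb x)" if "x \<in> X0" for x
    using bij_betw_the_inv_into[OF rk[OF that]] that
    by (subst bij_betw_cong[where g="the_inv_into (nb x) (rk x)"]) (auto simp: N_def)
  have rk_N: "rk x (N j x) = j" "N j x \<in> nb x" if "x \<in> X0" "j < n" for x j
    using that f_the_inv_into_f_bij_betw[OF rk[OF that(1)]] bij_betwE[OF bij[OF that(1)]] by (auto simp: N_def)
  have N_rk: "N (rk x y) x = y" if "x \<in> X0" "y \<in> nb x" for x y
  proof -
    have "rk x y < n" using bij_betwE[OF rk[OF that(1)]] that(2) by auto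
    then show ?thesis
      using that the_inv_into_f_f[OF bij_betw_imp_inj_on[OF rk[OF that(1)]] that(2)] by (simp add: N_def)
  qed
  define dg where "dg B x = (if x \<in> X0 then degree_in E x B else 0)" for B x
  have dg_meas: "dg B \<in> measurable M (count_space UNIV)" if "B \<in> sets M" for B
    using deg[OF that] by (simp add: dg_def[abs_def])
  have cellm [measurable]: "cell U l \<in> measurable M (count_space UNIV)" for l
    by (rule cell_measurable[OF U])
  have [measurable]: "dg {y \<in> space M. cell U l y = v} \<in> measurable M (count_space UNIV)" for l v
    by (rule dg_meas) measurable
  have [measurable]: "dg {y \<in> space M. cell U l y < v} \<in> measurable M (count_space UNIV)" for l v
    by (rule dg_meas) measurable
  have dg_nz: "dg B x \<noteq> 0 \<longleftrightarrow> (\<exists>y\<in>B. y \<in> nb x)" if "x \<in> X0" for B x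
    using that finite_neighbours[of x] by (auto simp: dg_def degree_in_def nb_def)
  have dg_card: "dg {y \<in> space M. P y} x = card {y \<in> nb x. P y}" if "x \<in> X0" for P x
    using that nb_sub[of x] by (auto simp: dg_def degree_in_def nb_def intro!: arg_cong[of _ _ card])
  \<comment> \<open>Injectivity of the codes says that no code is shared by two neighbours, a
    countable condition on degrees.\<close>
  have inj_iff: "inj_on (cell U l) (nb x) \<longleftrightarrow> (\<forall>v. dg {y \<in> space M. cell U l y = v} x \<le> 1)" if "x \<in> X0" for l x
  proof -
    have "card {y \<in> nb x. cell U l y = v} \<le> 1 \<longleftrightarrow>
      (\<forall>y\<in>nb x. \<forall>z\<in>nb x. cell U l y = v \<longrightarrow> cell U l z = v \<longrightarrow> y = z)" for v
      using nb_fin[of x] by (subst One_nat_def, subst card_le_Suc0_iff_eq) auto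
    moreover have "inj_on (cell U l) (nb x) \<longleftrightarrow>
      (\<forall>v. \<forall>y\<in>nb x. \<forall>z\<in>nb x. cell U l y = v \<longrightarrow> cell U l z = v \<longrightarrow> y = z)"
      by (auto simp: inj_on_def)
    ultimately show ?thesis unfolding dg_card[OF that] by presburger
  qed
  have lev_iff: "lev x = l \<longleftrightarrow> inj_on (cell U l) (nb x) \<and> (\<forall>k<l. \<not> inj_on (cell U k) (nb x))" for x l
  proof
    assume "lev x = l"
    then show "inj_on (cell U l) (nb x) \<and> (\<forall>k<l. \<not> inj_on (cell U k) (nb x))"
      using lev not_less_Least unfolding lev_def by metis
  next
    assume "inj_on (cell U l) (nb x) \<and> (\<forall>k<l. \<not> inj_on (cell U k) (nb x))"
    then show "lev x = l" unfolding lev_def by (intro Least_equality) (auto simp: not_less[symmetric])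
  qed
  \<comment> \<open>The quantified \<open>l\<close> is the least separating level and
    \<open>v\<close> the code of the neighbour in question: the nonzero degree puts a neighbour with
    code \<open>v\<close> into \<open>B\<close>, and the last degree is its rank.\<close>
  have N_in: "N j x \<in> B \<longleftrightarrow>
      (\<exists>l v. (\<forall>w. dg {y \<in> space M. cell U l y = w} x \<le> 1) \<and>
        (\<forall>k<l. \<not> (\<forall>w. dg {y \<in> space M. cell U k y = w} x \<le> 1)) \<and>
        dg {y \<in> space M. y \<in> B \<and> cell U l y = v} x \<noteq> 0 \<and> dg {y \<in> space M. cell U l y < v} x = j)"
    if "x \<in> X0" "j < n" "B \<in> sets M" for x j B
  proof -
    have "N j x \<in> B \<longleftrightarrow> (\<exists>v. (\<exists>y\<in>{y \<in> space M. y \<in> B \<and> cell U (lev x) y = v}. y \<in> nb x)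
        \<and> card {z \<in> nb x. cell U (lev x) z < v} = j)" (is "_ = ?R")
    proof
      assume "N j x \<in> B"
      then show ?R using rk_N[OF that(1,2)] nb_sub[of x] unfolding rk_def
        by (intro exI[of _ "cell U (lev x) (N j x)"]) auto
    next
      assume ?R
      then obtain y where y: "y \<in> B" "y \<in> nb x" "rk x y = j" unfolding rk_def by auto
      then show "N j x \<in> B" using N_rk[OF that(1) y(2)] by simp
    qed
    also have "\<dots> \<longleftrightarrow> (\<exists>l v. lev x = l \<and> dg {y \<in> space M. y \<in> B \<and> cell U l y = v} x \<noteq> 0 \<and>
        dg {y \<in> space M. cell U l y < v} x = j)"
      by (simp only: dg_nz[OF that(1)]) (simp add: dg_card[OF that(1)])
    finally show ?thesis unfolding lev_iff inj_iff[OF that(1)] by simp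
  qed
  have "N j \<in> measurable M M" for j
  proof (cases "j < n")
    case True
    show ?thesis
    proof (rule measurableI)
      fix x assume "x \<in> space M" then show "N j x \<in> space M"
        using rk_N(2)[of x j] nb_sub[of x] True by (cases "x \<in> X0") (auto simp: N_def)
    next
      fix B assume B[measurable]: "B \<in> sets M"
      have [measurable]: "dg {y \<in> space M. y \<in> B \<and> cell U l y = v} \<in> measurable M (count_space UNIV)" for l v
        by (rule dg_meas) measurable
      have iff: "N j x \<in> B \<longleftrightarrow> (if x \<in> X0 then
        (\<exists>l v. (\<forall>w. dg {y \<in> space M. cell U l y = w} x \<le> 1) \<and>
        (\<forall>k<l. \<not> (\<forall>w. dg {y \<in> space M. cell U k y = w} x \<le> 1)) \<and>
        dg {y \<in> space M. y \<in> B \<and> cell U l y = v} x \<noteq> 0 \<and> dg {y \<in> space M. cell U l y < v} x = j)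
        else x \<in> B)" for x
      proof (cases "x \<in> X0")
        case True
        then show ?thesis by (simp only: if_True N_in[OF True \<open>j < n\<close> B])
      qed (simp add: N_def)
      have "N j -` B \<inter> space M = {x \<in> space M. N j x \<in> B}" by auto
      also have "\<dots> = {x \<in> space M. if x \<in> X0 then
        (\<exists>l v. (\<forall>w. dg {y \<in> space M. cell U l y = w} x \<le> 1) \<and>
        (\<forall>k<l. \<not> (\<forall>w. dg {y \<in> space M. cell U k y = w} x \<le> 1)) \<and>
        dg {y \<in> space M. y \<in> B \<and> cell U l y = v} x \<noteq> 0 \<and> dg {y \<in> space M. cell U l y < v} x = j)
        else x \<in> B}" by (simp only: iff)
      also have "\<dots> \<in> sets M" by measurable
      finally show "N j -` B \<inter> space M \<in> sets M" .
    qed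
  next
    case False
    then have "N j = (\<lambda>x. x)" by (auto simp: N_def)
    then show ?thesis by simp
  qed
  moreover have "N j x = x" if "n \<le> j \<or> x \<notin> X0" for j x using that by (auto simp: N_def)
  ultimately show thesis using that[of N] bij by (simp add: nb_def)
qed

text \<open>On rectangles this is the mass transport identity of the graphing; a pi-lambda induction
  reaches all measurable sets of pairs. Real-valued probabilities permit the subtraction for
  complements.\<close>

lemma neighbour_transport:
  assumes X0 [measurable]: "X0 \<in> sets M" and ae: "AE x in M. x \<in> X0"
    and N [measurable]: "\<And>j. N j \<in> measurable M M"
    and bij: "\<And>x. x \<in> X0 \<Longrightarrow> bij_betw (\<lambda>j. N j x) {..<n} {y. (x, y) \<in> E}"
    and W: "W \<in> sets (M \<Otimes>\<^sub>M M)"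
  shows "(\<Sum>j<n. prob {x \<in> X0. (x, N j x) \<in> W}) = (\<Sum>j<n. prob {x \<in> X0. (N j x, x) \<in> W})"
proof -
  have X0_sub: "X0 \<subseteq> space M" using sets.sets_into_space[OF X0] .
  let ?G = "{A \<times> B | A B. A \<in> sets M \<and> B \<in> sets M}"
  have deg: "degree_in E x B = (\<Sum>j<n. indicator B (N j x))" if "x \<in> X0" for x B
  proof -
    have "{y \<in> B. (x, y) \<in> E} = (\<lambda>j. N j x) ` {j \<in> {..<n}. N j x \<in> B}"
      using bij[OF that] by (auto simp: bij_betw_def)
    moreover have "inj_on (\<lambda>j. N j x) {j \<in> {..<n}. N j x \<in> B}"
      using bij[OF that] by (auto simp: bij_betw_def intro: inj_on_subset)
    ultimately have "degree_in E x B = card {j \<in> {..<n}. N j x \<in> B}"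
      by (simp add: degree_in_def card_image)
    also have "\<dots> = (\<Sum>j<n. indicator B (N j x))"
      by (simp add: indicator_def of_bool_def sum.If_cases Int_def)
    finally show ?thesis .
  qed
  have int: "(\<integral>\<^sup>+x\<in>A. of_nat (degree_in E x B) \<partial>M) = ennreal (\<Sum>j<n. prob {x \<in> X0. x \<in> A \<and> N j x \<in> B})"
    if [measurable]: "A \<in> sets M" "B \<in> sets M" for A B
  proof -
    have "(\<integral>\<^sup>+x\<in>A. of_nat (degree_in E x B) \<partial>M)
        = (\<integral>\<^sup>+x. (\<Sum>j<n. indicator {x \<in> X0. x \<in> A \<and> N j x \<in> B} x) \<partial>M)"
      using ae by (intro nn_integral_cong_AE, eventually_elim)
        (auto simp: deg indicator_def intro!: sum.cong)
    also have "\<dots> = (\<Sum>j<n. \<integral>\<^sup>+x. indicator {x \<in> X0. x \<in> A \<and> N j x \<in> B} x \<partial>M)"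
      using X0_sub by (intro nn_integral_sum) measurable
    also have "\<dots> = (\<Sum>j<n. ennreal (prob {x \<in> X0. x \<in> A \<and> N j x \<in> B}))"
      by (intro sum.cong refl) (subst nn_integral_indicator, measurable, simp add: emeasure_eq_measure)
    finally show ?thesis by simp
  qed
  have sets: "{x \<in> X0. g x \<in> W} \<in> sets M"
    if [measurable]: "g \<in> measurable M (M \<Otimes>\<^sub>M M)" "W \<in> sets (M \<Otimes>\<^sub>M M)" for g W
    by measurable
  have compl: "prob {x \<in> X0. g x \<in> space M \<times> space M - W} = prob X0 - prob {x \<in> X0. g x \<in> W}"
    if g: "g \<in> measurable M (M \<Otimes>\<^sub>M M)" and W: "W \<in> sets (M \<Otimes>\<^sub>M M)" for g W
  proof -
    have "{x \<in> X0. g x \<in> space M \<times> space M - W} = X0 - {x \<in> X0. g x \<in> W}"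
      using X0_sub measurable_space[OF g] by (auto simp: space_pair_measure)
    then show ?thesis using sets[OF g W] by (simp add: finite_measure_Diff)
  qed
  have union: "(\<lambda>i. prob {x \<in> X0. g x \<in> A i}) sums prob {x \<in> X0. g x \<in> (\<Union>i. A i)}"
    if g: "g \<in> measurable M (M \<Otimes>\<^sub>M M)" and A: "\<And>i. A i \<in> sets (M \<Otimes>\<^sub>M M)" "disjoint_family A" for g A
  proof -
    have "{x \<in> X0. g x \<in> (\<Union>i. A i)} = (\<Union>i. {x \<in> X0. g x \<in> A i})" by auto
    moreover have "disjoint_family (\<lambda>i. {x \<in> X0. g x \<in> A i})"
      using A(2) unfolding disjoint_family_on_def by blast
    ultimately show ?thesis using sets[OF g A(1)] by (auto intro!: finite_measure_UNION)
  qed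
  have out: "(\<lambda>x. (x, N j x)) \<in> measurable M (M \<Otimes>\<^sub>M M)" and inn: "(\<lambda>x. (N j x, x)) \<in> measurable M (M \<Otimes>\<^sub>M M)" for j
    by measurable
  have "Int_stable ?G" by (rule Int_stable_pair_measure_generator)
  moreover have "?G \<subseteq> Pow (space M \<times> space M)" by (auto dest: sets.sets_into_space)
  moreover have "W \<in> sigma_sets (space M \<times> space M) ?G" using W by (simp add: sets_pair_measure)
  ultimately show ?thesis
  proof (induction rule: sigma_sets_induct_disjoint)
    case (basic W)
    then obtain A B where W: "W = A \<times> B" "A \<in> sets M" "B \<in> sets M" by auto
    have "ennreal (\<Sum>j<n. prob {x \<in> X0. x \<in> A \<and> N j x \<in> B})
        = ennreal (\<Sum>j<n. prob {x \<in> X0. x \<in> B \<and> N j x \<in> A})"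
      using int[OF W(2,3)] int[OF W(3,2)] mass_transport[OF W(2,3)] by simp
    then have "(\<Sum>j<n. prob {x \<in> X0. x \<in> A \<and> N j x \<in> B}) = (\<Sum>j<n. prob {x \<in> X0. x \<in> B \<and> N j x \<in> A})"
      by (subst (asm) ennreal_inj) (auto intro: sum_nonneg)
    then show ?case by (simp add: W(1) conj_commute)
  next
    case empty
    show ?case by simp
  next
    case compl': (compl W)
    have W: "W \<in> sets (M \<Otimes>\<^sub>M M)" using compl'(1) by (simp add: sets_pair_measure)
    show ?case using compl'(2) by (simp only: compl[OF out W] compl[OF inn W] sum_subtractf)
  next
    case union': (union A)
    have A: "A i \<in> sets (M \<Otimes>\<^sub>M M)" for i using union'(2) by (auto simp: sets_pair_measure)
    have "(\<lambda>i. \<Sum>j<n. prob {x \<in> X0. (x, N j x) \<in> A i}) sums (\<Sum>j<n. prob {x \<in> X0. (x, N j x) \<in> (\<Union>i. A i)})"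
      by (intro sums_sum union[OF out A union'(1)])
    moreover have "(\<lambda>i. \<Sum>j<n. prob {x \<in> X0. (N j x, x) \<in> A i}) sums (\<Sum>j<n. prob {x \<in> X0. (N j x, x) \<in> (\<Union>i. A i)})"
      by (intro sums_sum union[OF inn A union'(1)])
    ultimately show ?case using union'(3) by (simp add: sums_unique2)
  qed
qed

lemma graph_dart_system:
  obtains X0 N r U where "dart_system M n X0 N r U"
    "\<And>x. x \<in> X0 \<Longrightarrow> {y. (x, y) \<in> E} = (\<lambda>j. N j x) ` {..<n}"
proof -
  have "standard_borel M" using regular by (simp add: regular_graphing_def graphing_def)
  then obtain G where G: "countable G" "sets M = sigma_sets (space M) G" "space M \<in> G"
    "\<And>x y. x \<in> space M \<Longrightarrow> y \<in> space M \<Longrightarrow> x \<noteq> y \<Longrightarrow> \<exists>V\<in>G. x \<in> V \<and> y \<notin> V"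
    using standard_borel_countable_generator[of M] by metis
  define U where "U = from_nat_into G"
  have U_G: "U i \<in> G" for i unfolding U_def using G(3) by (intro from_nat_into) auto
  then have U [measurable]: "U i \<in> sets M" for i unfolding G(2) by blast
  have sep: "\<exists>i. x \<in> U i \<and> y \<notin> U i" if "x \<in> space M" "y \<in> space M" "x \<noteq> y" for x y
    using G(4)[OF that] from_nat_into_surj[OF G(1)] unfolding U_def by metis
  obtain X0 where X0 [measurable]: "X0 \<in> sets M" and ae: "AE x in M. x \<in> X0"
    and sat: "\<And>x y. x \<in> X0 \<Longrightarrow> (x, y) \<in> E \<Longrightarrow> y \<in> X0"
    and deg: "\<And>B. B \<in> sets M \<Longrightarrow> (\<lambda>x. if x \<in> X0 then degree_in E x B else 0) \<in> measurable M (count_space UNIV)"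
    using saturated_core by blast
  obtain N where N [measurable]: "\<And>j. N j \<in> measurable M M"
    and bij: "\<And>x. x \<in> X0 \<Longrightarrow> bij_betw (\<lambda>j. N j x) {..<n} {y. (x, y) \<in> E}"
    and N_id: "\<And>x j. n \<le> j \<or> x \<notin> X0 \<Longrightarrow> N j x = x"
    by (rule neighbour_enumeration[of X0 U]) (use X0 sat deg U sep in blast)+
  have X0_sub: "X0 \<subseteq> space M" using sets.sets_into_space[OF X0] .
  \<comment> \<open>On \<open>X0\<close> and for \<open>j < n\<close> the return dart is the only
    such index below \<open>n\<close>; taking the least one keeps the choice measurable.\<close>
  define r where "r j x = (LEAST k. N k (N j x) = x)" for j x
  have edge: "(x, N j x) \<in> E" if "x \<in> X0" "j < n" for x j
    using bij_betwE[OF bij[OF that(1)]] that(2) by auto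
  have NX0: "N j x \<in> X0" if "x \<in> X0" for x j
    using sat[OF that edge[OF that]] N_id[of j x] that by (cases "j < n") auto
  have inj: "j = k" if "x \<in> X0" "j < n" "k < n" "N j x = N k x" for x j k
    using bij_betw_imp_inj_on[OF bij[OF that(1)]] that by (auto dest: inj_onD)
  have r: "r j x < n \<and> N (r j x) (N j x) = x" if xj: "x \<in> X0" "j < n" for x j
  proof -
    have "(N j x, x) \<in> E" using edge[OF xj] edge_sym by blast
    then have "x \<in> (\<lambda>k. N k (N j x)) ` {..<n}"
      using bij[OF NX0[OF xj(1)], of j] by (simp add: bij_betw_def)
    then obtain k where k: "k < n" "N k (N j x) = x" by auto
    then show ?thesis unfolding r_def using LeastI[of "\<lambda>k. N k (N j x) = x", OF k(2)]
      Least_le[of "\<lambda>k. N k (N j x) = x", OF k(2)] by auto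
  qed
  have rr: "r (r j x) (N j x) = j" if "x \<in> X0" "j < n" for x j
  proof -
    have "r (r j x) (N j x) < n \<and> N (r (r j x) (N j x)) x = N j x"
      using r[OF NX0[OF that(1)], of "r j x" j] r[OF that] by simp
    then show ?thesis using inj[OF that(1) _ that(2)] by blast
  qed
  have "dart_system M n X0 N r U"
  proof
    show "r j \<in> measurable M (count_space UNIV)" for j
    proof -
      have [measurable]: "Measurable.pred M (\<lambda>x. N k (N j x) = x)" for k
      proof (rule pred_eq_of_separating[of U M, OF U sep])
        show "(\<lambda>x. N k (N j x)) \<in> measurable M M" by measurable
      qed auto
      show ?thesis unfolding r_def[abs_def] by measurable
    qed
    show "N j x \<noteq> x" if "x \<in> X0" "j < n" for x j using edge[OF that] edge_neq by metis
  next
    fix j k S assume jk: "j < n" "k < n" and S [measurable]: "S \<in> sets M"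
    have [measurable]: "Measurable.pred (M \<Otimes>\<^sub>M M) (\<lambda>p. N j (fst p) = snd p)"
      "Measurable.pred (M \<Otimes>\<^sub>M M) (\<lambda>p. N k (snd p) = fst p)"
    proof -
      have f: "(\<lambda>p. N j (fst p)) \<in> measurable (M \<Otimes>\<^sub>M M) M" "(\<lambda>p. N k (snd p)) \<in> measurable (M \<Otimes>\<^sub>M M) M"
        by measurable
      show "Measurable.pred (M \<Otimes>\<^sub>M M) (\<lambda>p. N j (fst p) = snd p)"
        by (rule pred_eq_of_separating[of U M, OF U sep]) (assumption | rule f measurable_snd)+
      show "Measurable.pred (M \<Otimes>\<^sub>M M) (\<lambda>p. N k (snd p) = fst p)"
        by (rule pred_eq_of_separating[of U M, OF U sep]) (assumption | rule f measurable_fst)+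
    qed
    \<comment> \<open>Pairs joined by dart \<open>j\<close> one way and dart \<open>k\<close> back,
      with second vertex in \<open>S\<close>. On this set both sums in
      \<open>neighbour_transport\<close> collapse to a single term.\<close>
    define W where "W = {p \<in> space (M \<Otimes>\<^sub>M M). N j (fst p) = snd p \<and> N k (snd p) = fst p \<and> snd p \<in> S}"
    have W [measurable]: "W \<in> sets (M \<Otimes>\<^sub>M M)" unfolding W_def by measurable
    have 1: "(\<Sum>i<n. prob {x \<in> X0. (x, N i x) \<in> W}) = prob {x \<in> X0. r j x = k \<and> N j x \<in> S}"
    proof -
      have "{x \<in> X0. (x, N i x) \<in> W} = (if i = j then {x \<in> X0. r j x = k \<and> N j x \<in> S} else {})" if "i < n" for i
      proof -
        have "(x, N i x) \<in> W \<longleftrightarrow> i = j \<and> r j x = k \<and> N j x \<in> S" if x: "x \<in> X0" for x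
        proof -
          have "(x, N i x) \<in> W \<longleftrightarrow> N j x = N i x \<and> N k (N i x) = x \<and> N i x \<in> S"
            using X0_sub x measurable_space[OF N] by (auto simp: W_def space_pair_measure)
          also have "\<dots> \<longleftrightarrow> i = j \<and> N k (N j x) = x \<and> N j x \<in> S"
            using inj[OF x jk(1) \<open>i < n\<close>] by auto
          also have "N k (N j x) = x \<longleftrightarrow> r j x = k"
            using r[OF x jk(1)] inj[OF NX0[OF x], of "r j x" k j] jk(2) by auto
          finally show ?thesis .
        qed
        then show ?thesis by auto
      qed
      then have "(\<Sum>i<n. prob {x \<in> X0. (x, N i x) \<in> W})
          = (\<Sum>i<n. if i = j then prob {x \<in> X0. r j x = k \<and> N j x \<in> S} else 0)"
        by (intro sum.cong) auto
      then show ?thesis using jk by simp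
    qed
    have 2: "(\<Sum>i<n. prob {x \<in> X0. (N i x, x) \<in> W}) = prob {x \<in> X0. r k x = j \<and> x \<in> S}"
    proof -
      have "{x \<in> X0. (N i x, x) \<in> W} = (if i = k then {x \<in> X0. r k x = j \<and> x \<in> S} else {})" if "i < n" for i
      proof -
        have "(N i x, x) \<in> W \<longleftrightarrow> i = k \<and> r k x = j \<and> x \<in> S" if x: "x \<in> X0" for x
        proof -
          have "(N i x, x) \<in> W \<longleftrightarrow> N k x = N i x \<and> N j (N i x) = x \<and> x \<in> S"
            using X0_sub x measurable_space[OF N] by (auto simp: W_def space_pair_measure)
          also have "\<dots> \<longleftrightarrow> i = k \<and> N j (N k x) = x \<and> x \<in> S"
            using inj[OF x jk(2) \<open>i < n\<close>] by auto
          also have "N j (N k x) = x \<longleftrightarrow> r k x = j"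
            using r[OF x jk(2)] inj[OF NX0[OF x], of "r k x" j k] jk(1) by auto
          finally show ?thesis .
        qed
        then show ?thesis by auto
      qed
      then have "(\<Sum>i<n. prob {x \<in> X0. (N i x, x) \<in> W})
          = (\<Sum>i<n. if i = k then prob {x \<in> X0. r k x = j \<and> x \<in> S} else 0)"
        by (intro sum.cong) auto
      then show ?thesis using jk by simp
    qed
    have "prob {x \<in> X0. r j x = k \<and> N j x \<in> S} = prob {x \<in> X0. r k x = j \<and> x \<in> S}"
      using neighbour_transport[OF X0 ae N bij W] 1 2 by simp
    then show "emeasure M {x \<in> X0. r j x = k \<and> N j x \<in> S} = emeasure M {x \<in> X0. r k x = j \<and> x \<in> S}"
      by (simp add: emeasure_eq_measure)
  next
    show "N j x = x" if "n \<le> j" for x j using N_id that by blast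
    show "r j x < n" if "x \<in> X0" "j < n" for x j using r[OF that] by blast
    show "N (r j x) (N j x) = x" if "x \<in> X0" "j < n" for x j using r[OF that] by blast
    show "j = k" if "x \<in> X0" "j < n" "k < n" "N j x = N k x" for x j k by (rule inj[OF that])
    show "\<exists>i. x \<in> U i \<and> y \<notin> U i" if "x \<in> space M" "y \<in> space M" "x \<noteq> y" for x y by (rule sep[OF that])
  qed (fact X0 ae N NX0 rr U)+
  moreover have "{y. (x, y) \<in> E} = (\<lambda>j. N j x) ` {..<n}" if "x \<in> X0" for x
    using bij[OF that] by (simp add: bij_betw_def)
  ultimately show thesis using that by blast
qed

end

section \<open>Invariant random decorations\<close>

text \<open>
  A labelling \<open>\<sigma>\<close> describes a decoration seen from a root \<open>x\<close>: \<open>\<sigma> (enc w i)\<close> is the slot of the dart \<open>i\<close>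
  at the endpoint of the walk \<open>w\<close> from \<open>x\<close>.  The coordinate \<open>0\<close> is not part of the decoration.
\<close>

definition enc :: "nat list \<Rightarrow> nat \<Rightarrow> nat" where
  "enc w i = Suc (prod_encode (list_encode w, i))"

text \<open>The reindexing of the labels when the root moves along dart \<open>j\<close>: a walk
  from the new root is a walk from the old one that starts with \<open>j\<close>.\<close>

definition shift_index :: "nat \<Rightarrow> nat \<Rightarrow> nat" where
  "shift_index j p = (case p of 0 \<Rightarrow> 0 |
     Suc q \<Rightarrow> enc (j # list_decode (fst (prod_decode q))) (snd (prod_decode q)))"

lemma shift_index_0 [simp]: "shift_index j 0 = 0"
  by (simp add: shift_index_def)

lemma shift_index_enc [simp]: "shift_index j (enc w i) = enc (j # w) i"
  by (simp add: shift_index_def enc_def)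

lemma enc_cases [case_names zero enc]:
  obtains "p = 0" | w i where "p = enc w i"
proof (cases p)
  case (Suc q)
  obtain c i where ci: "prod_decode q = (c, i)" by (cases "prod_decode q")
  have "q = prod_encode (c, i)" using ci by (metis prod_decode_inverse)
  then have "p = enc (list_decode c) i" using Suc by (simp add: enc_def)
  then show ?thesis using that by blast
qed (use that in auto)

lemma pred_eq_countable:
  fixes f g :: "'a \<Rightarrow> 'b::countable"
  assumes [measurable]: "f \<in> measurable K (count_space UNIV)" "g \<in> measurable K (count_space UNIV)"
  shows "Measurable.pred K (\<lambda>x. f x = g x)"
proof -
  have "Measurable.pred K (\<lambda>x. \<exists>k. f x = k \<and> g x = k)" by measurable
  then show ?thesis by simp
qed

text \<open>Slot 0 stands for an undecorated dart. The other slots are numbered up to the degree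
  \<open>n\<close>, so that there are as many slots as darts; \<open>cj\<close> gives the slot of an
  edge seen from its other end.\<close>

locale slot_system = dart_system M n X0 N r U
  for M :: "'a measure" and n X0 N r and U :: "nat \<Rightarrow> 'a set" +
  fixes cj :: "nat \<Rightarrow> nat"
  assumes cj_0 [simp]: "cj 0 = 0"
    and cj_range: "\<And>s. 0 < s \<Longrightarrow> s \<le> n \<Longrightarrow> 0 < cj s \<and> cj s \<le> n"
    and cj_cj: "\<And>s. s \<le> n \<Longrightarrow> cj (cj s) = s"
    and cj_neq: "\<And>s. 0 < s \<Longrightarrow> s \<le> n \<Longrightarrow> cj s \<noteq> s"
begin

abbreviation Z :: "'a cover measure" where "Z \<equiv> labelled M"

definition step :: "nat \<Rightarrow> 'a cover \<Rightarrow> 'a cover" where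
  "step j z = (N j (fst z), \<lambda>p. snd z (shift_index j p))"

text \<open>The two sides of mass transport for labelled points: \<open>into\<close> collects the
  starting points of moves along \<open>j\<close> with return dart \<open>k\<close> that end in
  \<open>S\<close>, and \<open>onto\<close> collects their end points.\<close>

abbreviation into :: "nat \<Rightarrow> nat \<Rightarrow> 'a cover set \<Rightarrow> 'a cover set" where
  "into j k S \<equiv> {z \<in> space Z. fst z \<in> X0 \<and> r j (fst z) = k \<and> step j z \<in> S}"

abbreviation onto :: "nat \<Rightarrow> nat \<Rightarrow> 'a cover set \<Rightarrow> 'a cover set" where
  "onto k j S \<equiv> {z \<in> space Z. fst z \<in> X0 \<and> r k (fst z) = j \<and> z \<in> S}"

definition lab :: "'a cover \<Rightarrow> nat \<Rightarrow> nat" where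
  "lab z i = snd z (enc [] i)"

text \<open>The clause on walks with equal endpoints makes the labels a function on the component
  rather than on the tree of walks. The last clause says that the two darts of an edge carry
  conjugate slots. Coordinate 0 is left free.\<close>

definition good :: "'a cover \<Rightarrow> bool" where
  "good z \<longleftrightarrow> fst z \<in> X0 \<and>
    (\<forall>v w i. fold N v (fst z) = fold N w (fst z) \<longrightarrow> snd z (enc v i) = snd z (enc w i)) \<and>
    (\<forall>w i. snd z (enc w i) \<le> n) \<and>
    (\<forall>w i. n \<le> i \<longrightarrow> snd z (enc w i) = 0) \<and>
    (\<forall>w i j. i < n \<longrightarrow> j < n \<longrightarrow> snd z (enc w i) = snd z (enc w j) \<longrightarrow> snd z (enc w i) \<noteq> 0 \<longrightarrow> i = j) \<and>
    (\<forall>w j k. j < n \<longrightarrow> r j (fold N w (fst z)) = k \<longrightarrow> snd z (enc (w @ [j]) k) = cj (snd z (enc w j)))"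

text \<open>A rule for redecorating the root, computed from the labelled point alone. Applied at the
  end of every walk, it produces a good labelling by these clauses.\<close>

definition decoration :: "('a cover \<Rightarrow> nat \<Rightarrow> nat) \<Rightarrow> bool" where
  "decoration D \<longleftrightarrow> (\<forall>z. good z \<longrightarrow>
    (\<forall>i. D z i \<le> n) \<and> (\<forall>i\<ge>n. D z i = 0) \<and>
    (\<forall>i j. i < n \<longrightarrow> j < n \<longrightarrow> D z i = D z j \<longrightarrow> D z i \<noteq> 0 \<longrightarrow> i = j) \<and>
    (\<forall>j<n. D (step j z) (r j (fst z)) = cj (D z j)))"

text \<open>Invariance under moving the root is stated as mass transport for pairs of mutually
  reverse darts. Coordinate 0 is pinned so that all coordinates are bounded by \<open>n\<close>,
  which the weak limit requires.\<close>

definition admissible :: "'a cover measure \<Rightarrow> bool" where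
  "admissible m \<longleftrightarrow> prob_space m \<and> sets m = sets Z \<and> distr m M fst = M \<and>
    (\<forall>j<n. \<forall>k<n. \<forall>S\<in>sets Z.
      emeasure m (into j k S) =
      emeasure m (onto k j S)) \<and>
    (AE z in m. good z \<and> snd z 0 = 0)"

definition relabel :: "('a cover \<Rightarrow> nat \<Rightarrow> nat) \<Rightarrow> 'a cover \<Rightarrow> 'a cover" where
  "relabel D z = (fst z, \<lambda>p. case p of 0 \<Rightarrow> 0 |
     Suc q \<Rightarrow> D (fold step (list_decode (fst (prod_decode q))) z) (snd (prod_decode q)))"

lemma fst_step [simp]: "fst (step j z) = N j (fst z)"
  and snd_step_0 [simp]: "snd (step j z) 0 = snd z 0"
  and snd_step_enc [simp]: "snd (step j z) (enc w i) = snd z (enc (j # w) i)"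
  by (simp_all add: step_def)

lemma fst_walk [simp]: "fst (fold step w z) = fold N w (fst z)"
  by (induction w arbitrary: z) auto

lemma snd_walk_0 [simp]: "snd (fold step w z) 0 = snd z 0"
  by (induction w arbitrary: z) auto

lemma snd_walk_enc [simp]: "snd (fold step w z) (enc v i) = snd z (enc (w @ v) i)"
  by (induction w arbitrary: z) auto

lemma lab_walk: "lab (fold step w z) i = snd z (enc w i)"
  by (simp add: lab_def)

lemma label_eqI:
  assumes "fst z = fst z'" "snd z 0 = snd z' 0" "\<And>w i. snd z (enc w i) = snd z' (enc w i)"
  shows "z = z'"
proof (rule prod_eqI[OF assms(1)], rule ext)
  fix p show "snd z p = snd z' p" by (cases p rule: enc_cases) (use assms in auto)
qed

lemma snd_relabel_0 [simp]: "snd (relabel D z) 0 = 0"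
  and fst_relabel [simp]: "fst (relabel D z) = fst z"
  and snd_relabel_enc [simp]: "snd (relabel D z) (enc w i) = D (fold step w z) i"
  by (simp_all add: relabel_def enc_def)

lemma lab_relabel [simp]: "lab (relabel D z) i = D z i"
  by (simp add: lab_def)

text \<open>The rule sees only the labelled point that a walk reaches, so moving the root and
  relabelling commute. This equivariance preserves mass transport.\<close>

lemma step_relabel: "step j (relabel D z) = relabel D (step j z)"
  by (rule label_eqI) auto

lemma walk_N_X0: "x \<in> X0 \<Longrightarrow> fold N w x \<in> X0"
  by (induction w arbitrary: x) (auto simp: N_X0)

lemma goodD:
  assumes "good z"
  shows "fst z \<in> X0"
    and "fold N v (fst z) = fold N w (fst z) \<Longrightarrow> snd z (enc v i) = snd z (enc w i)"
    and "snd z (enc w i) \<le> n"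
    and "n \<le> i \<Longrightarrow> snd z (enc w i) = 0"
    and "i < n \<Longrightarrow> j < n \<Longrightarrow> snd z (enc w i) = snd z (enc w j) \<Longrightarrow> snd z (enc w i) \<noteq> 0 \<Longrightarrow> i = j"
    and "j < n \<Longrightarrow> snd z (enc (w @ [j]) (r j (fold N w (fst z)))) = cj (snd z (enc w j))"
  using assms unfolding good_def by blast+

lemma decoration_lab: "decoration lab"
proof -
  have "lab (step j z) (r j (fst z)) = cj (lab z j)" if "good z" "j < n" for z j
    using goodD(6)[OF that, of "[]"] by (simp add: lab_def)
  then show ?thesis unfolding decoration_def using goodD(3-5)[where w="[]"] by (auto simp: lab_def)
qed

lemma good_step:
  assumes g: "good z"
  shows "good (step j z)"
  unfolding good_def
proof (intro conjI allI impI)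
  show "fst (step j z) \<in> X0" using goodD(1)[OF g] N_X0 by simp
next
  fix v w i assume "fold N v (fst (step j z)) = fold N w (fst (step j z))"
  then show "snd (step j z) (enc v i) = snd (step j z) (enc w i)"
    using goodD(2)[OF g, of "j # v" "j # w"] by simp
next
  fix w i show "snd (step j z) (enc w i) \<le> n" using goodD(3)[OF g] by simp
next
  fix w i assume "n \<le> i" then show "snd (step j z) (enc w i) = 0" using goodD(4)[OF g] by simp
next
  fix w i k assume "i < n" "k < n" "snd (step j z) (enc w i) = snd (step j z) (enc w k)"
    "snd (step j z) (enc w i) \<noteq> 0"
  then show "i = k" using goodD(5)[OF g, of i k "j # w"] by simp
next
  fix w i k assume "i < n" "r i (fold N w (fst (step j z))) = k"
  then show "snd (step j z) (enc (w @ [i]) k) = cj (snd (step j z) (enc w i))"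
    using goodD(6)[OF g, of i "j # w"] by simp
qed

lemma good_walk: "good z \<Longrightarrow> good (fold step w z)"
  by (induction w arbitrary: z) (auto simp: good_step)

text \<open>Equal continuations of the two walks also end at the same vertex, so all labels agree.
  This is why the projection will be injective on components of the cover.\<close>

lemma walk_eq:
  assumes "good z" "fold N v (fst z) = fold N w (fst z)"
  shows "fold step v z = fold step w z"
proof (rule label_eqI)
  fix u i
  have "fold N (v @ u) (fst z) = fold N (w @ u) (fst z)" using assms(2) by simp
  from goodD(2)[OF assms(1) this]
  show "snd (fold step v z) (enc u i) = snd (fold step w z) (enc u i)" by simp
qed (use assms(2) in auto)

lemma step_r:
  assumes "good z" "j < n"
  shows "step (r j (fst z)) (step j z) = z"
  using walk_eq[OF assms(1), of "[j, r j (fst z)]" "[]"] N_r[OF goodD(1)[OF assms(1)] assms(2)] by simp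

lemma step_ge:
  assumes "good z" "n \<le> j"
  shows "step j z = z"
  using walk_eq[OF assms(1), of "[j]" "[]"] N_ge[OF assms(2)] by simp

lemma decorationD:
  assumes "decoration D" "good z"
  shows "D z i \<le> n"
    and "n \<le> i \<Longrightarrow> D z i = 0"
    and "i < n \<Longrightarrow> j < n \<Longrightarrow> D z i = D z j \<Longrightarrow> D z i \<noteq> 0 \<Longrightarrow> i = j"
    and "j < n \<Longrightarrow> D (step j z) (r j (fst z)) = cj (D z j)"
  using assms unfolding decoration_def by blast+

lemma good_relabel:
  assumes D: "decoration D" and g: "good z"
  shows "good (relabel D z)"
proof -
  have gw: "good (fold step w z)" for w by (rule good_walk[OF g])
  note D' = decorationD[OF D gw]
  show ?thesis unfolding good_def
  proof (intro conjI allI impI)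
    fix v w i assume "fold N v (fst (relabel D z)) = fold N w (fst (relabel D z))"
    then show "snd (relabel D z) (enc v i) = snd (relabel D z) (enc w i)"
      using walk_eq[OF g, of v w] by simp
  next
    fix w i j k assume "j < n" "r j (fold N w (fst (relabel D z))) = k"
    then show "snd (relabel D z) (enc (w @ [j]) k) = cj (snd (relabel D z) (enc w j))"
      using D'(4)[of j w] by auto
  next
    fix w i j assume "i < n" "j < n" "snd (relabel D z) (enc w i) = snd (relabel D z) (enc w j)"
      "snd (relabel D z) (enc w i) \<noteq> 0"
    then show "i = j" using D'(3)[of i j w] by simp
  qed (use D'(1,2) goodD(1)[OF g] in auto)
qed

section \<open>Measurability of walks, relabellings and goodness\<close>

lemma fold_N_measurable [measurable]: "fold N w \<in> measurable M M"
proof (induction w)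
  case (Cons j w)
  then have "(\<lambda>x. fold N w (N j x)) \<in> measurable M M"
    by (rule measurable_compose[OF N_measurable])
  then show ?case by (simp add: comp_def)
qed (simp add: id_def)

lemma step_measurable [measurable]: "step j \<in> measurable Z Z"
  unfolding step_def[abs_def]
proof (rule measurable_Pair)
  show "(\<lambda>z. N j (fst z)) \<in> measurable Z M" by measurable
  show "(\<lambda>z p. snd z (shift_index j p)) \<in> measurable Z label_space"
    by (rule measurable_into_label_space) measurable
qed

lemma fold_step_measurable [measurable]: "fold step w \<in> measurable Z Z"
proof (induction w)
  case (Cons j w)
  then have "(\<lambda>x. fold step w (step j x)) \<in> measurable Z Z"
    by (rule measurable_compose[OF step_measurable])
  then show ?case by (simp add: comp_def)
qed (simp add: id_def)

lemma snd_measurable [measurable]: "(\<lambda>z. snd z p) \<in> measurable Z (count_space UNIV)"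
  by measurable

lemma lab_measurable [measurable]: "(\<lambda>z. lab z i) \<in> measurable Z (count_space UNIV)"
  unfolding lab_def by measurable

lemma relabel_measurable:
  assumes [measurable]: "\<And>i. (\<lambda>z. D z i) \<in> measurable Z (count_space UNIV)"
  shows "relabel D \<in> measurable Z Z"
  unfolding relabel_def[abs_def]
proof (rule measurable_Pair)
  show "(\<lambda>z p. case p of 0 \<Rightarrow> 0 | Suc q \<Rightarrow>
     D (fold step (list_decode (fst (prod_decode q))) z) (snd (prod_decode q))) \<in> measurable Z label_space"
  proof (rule measurable_into_label_space)
    fix p
    show "(\<lambda>z. case p of 0 \<Rightarrow> 0 | Suc q \<Rightarrow>
     D (fold step (list_decode (fst (prod_decode q))) z) (snd (prod_decode q))) \<in> measurable Z (count_space UNIV)"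
      by (cases p) (auto intro: measurable_compose[OF fold_step_measurable assms])
  qed
qed measurable

lemma pred_eq_N:
  assumes "f \<in> measurable K M" "g \<in> measurable K M"
  shows "Measurable.pred K (\<lambda>x. f x = g x)"
  by (rule pred_eq_of_separating[of U M, OF U_sets U_separates]) (assumption | rule assms)+

lemma pred_walk_eq: "Measurable.pred Z (\<lambda>z. fold N v (fst z) = fold N w (fst z))"
  by (rule pred_eq_N) measurable

lemma pred_snd_eq: "Measurable.pred Z (\<lambda>z. snd z p = snd z q)"
  by (rule pred_eq_countable) measurable

lemma pred_r_walk: "Measurable.pred Z (\<lambda>z. r j (fold N w (fst z)) = k)"
proof (rule pred_eq_countable)
  show "(\<lambda>z. r j (fold N w (fst z))) \<in> measurable Z (count_space UNIV)"
    by (rule measurable_compose[OF measurable_compose[OF measurable_fst fold_N_measurable] r_measurable])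
qed simp

lemma pred_snd_cj: "Measurable.pred Z (\<lambda>z. snd z p = cj (snd z q))"
proof (rule pred_eq_countable)
  show "(\<lambda>z. cj (snd z q)) \<in> measurable Z (count_space UNIV)"
    by (rule measurable_compose[OF snd_measurable]) simp
qed measurable

lemma pred_good [measurable]: "Measurable.pred Z good"
proof -
  have 3: "Measurable.pred Z (\<lambda>z. (\<forall>w i. snd z (enc w i) \<le> n) \<and> (\<forall>w i. n \<le> i \<longrightarrow> snd z (enc w i) = 0))"
    by measurable
  have 4: "Measurable.pred Z (\<lambda>z. \<forall>w i j. i < n \<longrightarrow> j < n \<longrightarrow>
      snd z (enc w i) = snd z (enc w j) \<longrightarrow> snd z (enc w i) \<noteq> 0 \<longrightarrow> i = j)"
    by (intro pred_intros_countable pred_intros_logic pred_snd_eq) measurable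
  have 5: "Measurable.pred Z (\<lambda>z. \<forall>w j k. j < n \<longrightarrow> r j (fold N w (fst z)) = k \<longrightarrow>
      snd z (enc (w @ [j]) k) = cj (snd z (enc w j)))"
    by (intro pred_intros_countable pred_intros_logic pred_r_walk pred_snd_cj) simp
  have 6: "Measurable.pred Z (\<lambda>z. fst z \<in> X0)" by measurable
  have 7: "Measurable.pred Z (\<lambda>z. \<forall>v w i. fold N v (fst z) = fold N w (fst z) \<longrightarrow>
      snd z (enc v i) = snd z (enc w i))"
    by (intro pred_intros_countable pred_intros_logic pred_walk_eq pred_snd_eq)
  show ?thesis unfolding good_def[abs_def]
    using pred_intros_logic(3)[OF 6 pred_intros_logic(3)[OF 7 pred_intros_logic(3)[OF 3 pred_intros_logic(3)[OF 4 5]]]]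
    by (simp add: conj_assoc)
qed

section \<open>Admissible measures\<close>

definition coverage :: "'a cover measure \<Rightarrow> real" where
  "coverage m = (\<Sum>j<n. measure m {z \<in> space Z. lab z j \<noteq> 0})"

lemma in_space_Z: "z \<in> space Z \<longleftrightarrow> fst z \<in> space M"
  by (cases z) (auto simp: space_labelled)

lemma step_space: "z \<in> space Z \<Longrightarrow> step j z \<in> space Z"
  using measurable_space[OF step_measurable] .

lemma r_pred: "Measurable.pred Z (\<lambda>z. r j (fst z) = k)"
proof (rule pred_eq_countable)
  show "(\<lambda>z. r j (fst z)) \<in> measurable Z (count_space UNIV)"
    by (rule measurable_compose[OF measurable_fst r_measurable])
qed simp

lemma sets_from [measurable]:
  "S \<in> sets Z \<Longrightarrow> onto k j S \<in> sets Z"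
proof -
  assume [measurable]: "S \<in> sets Z"
  note [measurable] = r_pred
  show ?thesis by measurable
qed

lemma sets_to [measurable]:
  "S \<in> sets Z \<Longrightarrow> into j k S \<in> sets Z"
proof -
  assume [measurable]: "S \<in> sets Z"
  note [measurable] = r_pred
  show ?thesis by measurable
qed

lemma admissibleD:
  assumes "admissible m"
  shows "prob_space m" "sets m = sets Z" "distr m M fst = M" "space m = space Z"
    and "j < n \<Longrightarrow> k < n \<Longrightarrow> S \<in> sets Z \<Longrightarrow>
      emeasure m (into j k S) =
      emeasure m (onto k j S)"
    and "AE z in m. good z" "AE z in m. snd z 0 = 0"
  using assms sets_eq_imp_space_eq[of m Z] unfolding admissible_def by auto

text \<open>Relabelling commutes with \<open>step\<close> and fixes the vertex, so transport for
  \<open>S\<close> under the image measure is transport for the preimage of \<open>S\<close> under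
  \<open>m\<close>.\<close>

lemma admissible_relabel:
  assumes m: "admissible m" and D: "decoration D"
    and Dm: "\<And>i. (\<lambda>z. D z i) \<in> measurable Z (count_space UNIV)"
  shows "admissible (distr m Z (relabel D))"
proof -
  note ad = admissibleD[OF m]
  interpret m: prob_space m by (rule ad(1))
  have rz [measurable]: "relabel D \<in> measurable Z Z" by (rule relabel_measurable[OF Dm])
  have rm [measurable]: "relabel D \<in> measurable m Z" using rz ad(2) by (simp cong: measurable_cong_sets)
  have em: "emeasure (distr m Z (relabel D)) A = emeasure m {z \<in> space Z. relabel D z \<in> A}" if "A \<in> sets Z" for A
    using that rm by (simp add: emeasure_distr ad(4) vimage_def Int_def conj_commute)
  show ?thesis
    unfolding admissible_def
  proof (intro conjI ballI allI impI)
    show "prob_space (distr m Z (relabel D))" by (rule m.prob_space_distr) measurable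
    show "sets (distr m Z (relabel D)) = sets Z" by simp
    have "fst \<circ> relabel D = fst" by auto
    then show "distr (distr m Z (relabel D)) M fst = M"
      by (subst distr_distr) (use ad(3) in auto)
    fix j k S assume jk: "j < n" "k < n" and S: "S \<in> sets Z"
    have S': "{z \<in> space Z. relabel D z \<in> S} \<in> sets Z" using S by measurable
    have "emeasure (distr m Z (relabel D)) (into j k S)
      = emeasure m {z \<in> space Z. fst z \<in> X0 \<and> r j (fst z) = k \<and> step j z \<in> {z \<in> space Z. relabel D z \<in> S}}"
      unfolding em[OF sets_to[OF S]]
      by (rule arg_cong[where f="emeasure m"]) (auto simp: step_relabel in_space_Z measurable_space[OF N_measurable])
    also have "\<dots> = emeasure m {z \<in> space Z. fst z \<in> X0 \<and> r k (fst z) = j \<and> z \<in> {z \<in> space Z. relabel D z \<in> S}}"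
      by (rule ad(5)[OF jk S'])
    also have "\<dots> = emeasure (distr m Z (relabel D)) (onto k j S)"
      unfolding em[OF sets_from[OF S]]
      by (rule arg_cong[where f="emeasure m"]) (auto simp: in_space_Z)
    finally show "emeasure (distr m Z (relabel D)) (into j k S)
      = emeasure (distr m Z (relabel D)) (onto k j S)" .
  next
    have "{z \<in> space Z. good z \<and> snd z 0 = 0} \<in> sets Z" by measurable
    then show "AE z in distr m Z (relabel D). good z \<and> snd z 0 = 0"
      using ad(6) good_relabel[OF D] by (subst AE_distr_iff[OF rm]) auto
  qed
qed

text \<open>The labelling without any decorated dart is constantly 0, and its mass transport is that
  of \<open>M\<close>.\<close>

lemma admissible_exists: "\<exists>m. admissible m"
proof -
  let ?f = "\<lambda>x. (x, \<lambda>_::nat. 0::nat)"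
  have f [measurable]: "?f \<in> measurable M Z"
    by (rule measurable_Pair) (auto intro: measurable_into_label_space)
  have em: "emeasure (distr M Z ?f) A = emeasure M {x \<in> space M. ?f x \<in> A}" if "A \<in> sets Z" for A
    using that f by (simp add: emeasure_distr vimage_def Int_def conj_commute)
  have stepf: "step j (?f x) = ?f (N j x)" for j x by (simp add: step_def)
  have "admissible (distr M Z ?f)"
    unfolding admissible_def
  proof (intro conjI ballI allI impI)
    show "prob_space (distr M Z ?f)" by (rule prob_space_distr) measurable
    show "distr (distr M Z ?f) M fst = M"
      by (subst distr_distr) (auto simp: comp_def)
    fix j k S assume jk: "j < n" "k < n" and S [measurable]: "S \<in> sets Z"
    have S': "{x \<in> space M. ?f x \<in> S} \<in> sets M" by measurable
    have X0_sub: "X0 \<subseteq> space M" using sets.sets_into_space[OF X0_sets] .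
    have "emeasure (distr M Z ?f) (into j k S)
      = emeasure M {x \<in> X0. r j x = k \<and> N j x \<in> {x \<in> space M. ?f x \<in> S}}"
      unfolding em[OF sets_to[OF S]] using X0_sub measurable_space[OF N_measurable]
      by (intro arg_cong[where f="emeasure M"]) (auto simp: stepf in_space_Z)
    also have "\<dots> = emeasure M {x \<in> X0. r k x = j \<and> x \<in> {x \<in> space M. ?f x \<in> S}}"
      by (rule transport[OF jk S'])
    also have "\<dots> = emeasure (distr M Z ?f) (onto k j S)"
      unfolding em[OF sets_from[OF S]] using X0_sub
      by (intro arg_cong[where f="emeasure M"]) (auto simp: in_space_Z)
    finally show "emeasure (distr M Z ?f) (into j k S)
      = emeasure (distr M Z ?f) (onto k j S)" .
  next
    have "{z \<in> space Z. good z \<and> snd z 0 = 0} \<in> sets Z" by measurable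
    moreover have "good (?f x) \<and> snd (?f x) 0 = 0" if "x \<in> X0" for x
      using that by (simp add: good_def)
    ultimately show "AE z in distr M Z ?f. good z \<and> snd z 0 = 0"
      using AE_X0 by (subst AE_distr_iff[OF f]) (auto elim: eventually_mono)
  qed simp
  then show ?thesis ..
qed

section \<open>Closure of the admissible measures under limits\<close>

lemma cylinderI:
  assumes "Measurable.pred Z P" and "\<And>x \<sigma> \<tau>. (\<And>p. p < k \<Longrightarrow> \<sigma> p = \<tau> p) \<Longrightarrow> P (x, \<sigma>) \<Longrightarrow> P (x, \<tau>)"
  shows "{z \<in> space Z. P z} \<in> cylinders M"
proof -
  have "{z \<in> space Z. P z} \<in> sets Z" using assms(1) by measurable
  moreover have "depends_below k {z \<in> space Z. P z}"
    unfolding depends_below_def using assms(2) by (auto simp: in_space_Z)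
  ultimately show ?thesis unfolding cylinders_def by blast
qed

lemma cylinder_to:
  assumes "S \<in> cylinders M"
  shows "into j k S \<in> cylinders M"
proof -
  from assms obtain l where S: "S \<in> sets Z" and l: "depends_below l S" by (auto simp: cylinders_def)
  \<comment> \<open>A crude bound: each of the finitely many shifted indices is at most their
    sum.\<close>
  define b where "b = Suc (\<Sum>p<l. shift_index j p)"
  have b: "shift_index j p < b" if "p < l" for p
    unfolding b_def using member_le_sum[of p "{..<l}" "shift_index j"] that by auto
  have "depends_below b (into j k S)"
    unfolding depends_below_def
  proof (intro allI impI)
    fix x \<sigma> \<tau> assume eq: "\<forall>p<b. \<sigma> p = \<tau> p"
      and x: "(x, \<sigma>) \<in> into j k S"
    have "(N j x, \<lambda>p. \<tau> (shift_index j p)) \<in> S"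
      by (rule l[unfolded depends_below_def, rule_format, of "\<lambda>p. \<sigma> (shift_index j p)"])
        (use x eq b in \<open>auto simp: step_def\<close>)
    then show "(x, \<tau>) \<in> into j k S"
      using x by (auto simp: step_def in_space_Z)
  qed
  then show ?thesis using sets_to[OF S] unfolding cylinders_def by blast
qed

lemma cylinder_from:
  assumes "S \<in> cylinders M"
  shows "onto k j S \<in> cylinders M"
proof -
  from assms obtain l where S: "S \<in> sets Z" and l: "depends_below l S" by (auto simp: cylinders_def)
  have "depends_below l (onto k j S)"
    using l unfolding depends_below_def by (fastforce simp: in_space_Z)
  then show ?thesis using sets_from[OF S] unfolding cylinders_def by blast
qed

text \<open>Both sides are finite measures in \<open>S\<close>, namely images of restrictions of
  \<open>m\<close>, and the cylinders are a generator stable under intersection.\<close>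

lemma transport_from_cylinders:
  assumes "prob_space m" and sm: "sets m = sets Z"
    and cyl: "\<And>S. S \<in> cylinders M \<Longrightarrow>
      emeasure m (into j k S) =
      emeasure m (onto k j S)"
    and S: "S \<in> sets Z"
  shows "emeasure m (into j k S) =
      emeasure m (onto k j S)"
proof -
  interpret m: prob_space m by fact
  interpret cyl: algebra "space Z" "cylinders M" by (rule cylinders_algebra)
  have spm: "space m = space Z" by (rule sets_eq_imp_space_eq[OF sm])
  let ?A = "{z \<in> space Z. fst z \<in> X0 \<and> r j (fst z) = k}"
  let ?B = "{z \<in> space Z. fst z \<in> X0 \<and> r k (fst z) = j}"
  have AB: "?A \<in> sets Z" "?B \<in> sets Z"
    using sets_from[OF sets.top, of j k] sets_from[OF sets.top, of k j] by (auto simp: conj_ac cong: conj_cong)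
  define m1 where "m1 = distr (restrict_space m ?A) Z (step j)"
  define m2 where "m2 = distr (restrict_space m ?B) Z (\<lambda>z. z)"
  have e1: "emeasure m1 S = emeasure m (into j k S)" if "S \<in> sets Z" for S
  proof -
    have "step j \<in> measurable (restrict_space m ?A) Z"
      by (rule measurable_restrict_space1) (use sm in \<open>simp cong: measurable_cong_sets\<close>)
    then have "emeasure m1 S = emeasure (restrict_space m ?A) (step j -` S \<inter> ?A)"
      unfolding m1_def using that by (simp add: emeasure_distr space_restrict_space spm Int_absorb1)
    also have "\<dots> = emeasure m (step j -` S \<inter> ?A)"
      using AB sm by (intro emeasure_restrict_space) (auto simp: spm Int_absorb2)
    also have "step j -` S \<inter> ?A = into j k S" by auto
    finally show ?thesis .
  qed
  have e2: "emeasure m2 S = emeasure m (onto k j S)" if "S \<in> sets Z" for S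
  proof -
    have "(\<lambda>z. z) \<in> measurable (restrict_space m ?B) Z"
      by (rule measurable_restrict_space1) (use sm in \<open>simp cong: measurable_cong_sets\<close>)
    then have "emeasure m2 S = emeasure (restrict_space m ?B) ((\<lambda>z. z) -` S \<inter> ?B)"
      unfolding m2_def using that by (subst emeasure_distr) (auto simp: space_restrict_space spm Int_absorb1)
    also have "\<dots> = emeasure m ((\<lambda>z. z) -` S \<inter> ?B)"
      using AB sm by (intro emeasure_restrict_space) (auto simp: spm Int_absorb2)
    also have "(\<lambda>z. z) -` S \<inter> ?B = onto k j S" by auto
    finally show ?thesis .
  qed
  have "m1 = m2"
  proof (rule measure_eqI_generator_eq[where E="cylinders M" and \<Omega>="space Z" and A="\<lambda>_. space Z"])
    show "Int_stable (cylinders M)" by (rule Int_stableI) (rule cyl.Int)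
    show "cylinders M \<subseteq> Pow (space Z)" by (rule cyl.space_closed)
    show "emeasure m1 C = emeasure m2 C" if "C \<in> cylinders M" for C
      using e1 e2 cyl[OF that] cylinders_sets[OF that] by simp
    show "sets m1 = sigma_sets (space Z) (cylinders M)" "sets m2 = sigma_sets (space Z) (cylinders M)"
      by (simp_all add: m1_def m2_def sigma_sets_cylinders)
    show "emeasure m1 (space Z) \<noteq> \<infinity>" by (simp add: e1 m.emeasure_eq_measure)
  qed auto
  then show ?thesis using e1[OF S] e2[OF S] by simp
qed

text \<open>Goodness is a countable conjunction of conditions on the vertex and finitely many
  labels. Each holds almost surely along the sequence, hence in the limit. Transport passes through
  as an equation between measures of cylinders, and coverage as a finite sum of them.\<close>

lemma coverage_limit:
  assumes ad: "\<And>t::nat. admissible (\<mu> t)" and V: "(\<lambda>t. coverage (\<mu> t)) \<longlonglongrightarrow> V"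
  shows "\<exists>m. admissible m \<and> coverage m = V"
proof -
  have bounded: "AE z in \<mu> t. \<forall>p. snd z p \<le> n" for t
    using admissibleD(6,7)[OF ad[of t]]
  proof eventually_elim
    case (elim z)
    show ?case
    proof
      fix p show "snd z p \<le> n" by (cases p rule: enc_cases) (use elim goodD(3) in auto)
    qed
  qed
  obtain m F where m: "prob_space m" "sets m = sets Z" and F: "F \<noteq> bot" "F \<le> sequentially"
    and lim: "\<And>S. S \<in> cylinders M \<Longrightarrow> ((\<lambda>t. measure (\<mu> t) S) \<longlongrightarrow> measure m S) F"
    using weak_limit[of M \<mu> n] admissibleD(1-3)[OF ad] bounded prob_space_axioms by metis
  interpret m: prob_space m by (rule m(1))
  interpret \<mu>: prob_space "\<mu> t" for t by (rule admissibleD(1)[OF ad])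
  have spm: "space m = space Z" by (rule sets_eq_imp_space_eq[OF m(2)])
  have transfer: "AE z in m. P z"
    if "\<And>t. AE z in \<mu> t. P z" "{z \<in> space Z. \<not> P z} \<in> cylinders M" for P
  proof -
    have "measure (\<mu> t) {z \<in> space Z. \<not> P z} = 0" for t
      using that(1)[of t] cylinders_sets[OF that(2)] admissibleD(2,4)[OF ad[of t]]
      by (subst \<mu>.prob_eq_0) auto
    then have "measure m {z \<in> space Z. \<not> P z} = 0"
      using tendsto_unique[OF F(1) lim[OF that(2)]] by simp
    then have "AE z in m. z \<notin> {z \<in> space Z. \<not> P z}"
      using cylinders_sets[OF that(2)] m(2) by (subst (asm) m.prob_eq_0) auto
    then show ?thesis using AE_space by eventually_elim (auto simp: spm)
  qed
  have AE_m: "AE z in m. P z"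
    if P: "\<And>z. good z \<Longrightarrow> snd z 0 = 0 \<Longrightarrow> P z" "Measurable.pred Z P"
      "\<And>x \<sigma> \<tau>. (\<And>p. p < b \<Longrightarrow> \<sigma> p = \<tau> p) \<Longrightarrow> P (x, \<sigma>) \<longleftrightarrow> P (x, \<tau>)" for P and b :: nat
  proof (rule transfer)
    show "AE z in \<mu> t. P z" for t
      using admissibleD(6,7)[OF ad[of t]] by eventually_elim (rule P(1))
    show "{z \<in> space Z. \<not> P z} \<in> cylinders M"
    proof (rule cylinderI[where k=b])
      show "Measurable.pred Z (\<lambda>z. \<not> P z)" by (rule pred_intros_logic(2)[OF P(2)])
      show "\<not> P (x, \<tau>)" if "\<And>p. p < b \<Longrightarrow> \<sigma> p = \<tau> p" "\<not> P (x, \<sigma>)" for x \<sigma> \<tau>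
      proof -
        have "P (x, \<sigma>) \<longleftrightarrow> P (x, \<tau>)" by (rule P(3)) (rule that(1))
        then show ?thesis using that(2) by blast
      qed
    qed
  qed
  have A1: "AE z in m. fst z \<in> X0"
    by (rule AE_m[of _ 0]) (auto dest: goodD(1))
  have A2: "AE z in m. \<forall>v w i. fold N v (fst z) = fold N w (fst z) \<longrightarrow> snd z (enc v i) = snd z (enc w i)"
    unfolding AE_all_countable
  proof (intro allI)
    fix v w i
    show "AE z in m. fold N v (fst z) = fold N w (fst z) \<longrightarrow> snd z (enc v i) = snd z (enc w i)"
      by (rule AE_m[of _ "Suc (max (enc v i) (enc w i))"])
        (auto intro!: pred_intros_logic pred_walk_eq pred_snd_eq dest: goodD(2))
  qed
  have A3: "AE z in m. \<forall>w i. snd z (enc w i) \<le> n"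
    unfolding AE_all_countable
  proof (intro allI)
    fix w i
    show "AE z in m. snd z (enc w i) \<le> n"
      by (rule AE_m[of _ "Suc (enc w i)"]) (auto dest: goodD(3))
  qed
  have A4: "AE z in m. \<forall>w i. n \<le> i \<longrightarrow> snd z (enc w i) = 0"
    unfolding AE_all_countable
  proof (intro allI)
    fix w i
    show "AE z in m. n \<le> i \<longrightarrow> snd z (enc w i) = 0"
      by (rule AE_m[of _ "Suc (enc w i)"]) (auto dest: goodD(4))
  qed
  have A5: "AE z in m. \<forall>w i j. i < n \<longrightarrow> j < n \<longrightarrow> snd z (enc w i) = snd z (enc w j) \<longrightarrow>
      snd z (enc w i) \<noteq> 0 \<longrightarrow> i = j"
    unfolding AE_all_countable
  proof (intro allI)
    fix w i j
    let ?P = "\<lambda>z. i < n \<longrightarrow> j < n \<longrightarrow> snd z (enc w i) = snd z (enc w j) \<longrightarrow> snd z (enc w i) \<noteq> 0 \<longrightarrow> i = j"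
    have "Measurable.pred Z ?P" by (intro pred_intros_logic pred_snd_eq) measurable
    then show "AE z in m. ?P z"
      by (rule AE_m[of _ "Suc (max (enc w i) (enc w j))", rotated]) (auto dest: goodD(5))
  qed
  have A6: "AE z in m. \<forall>w j k. j < n \<longrightarrow> r j (fold N w (fst z)) = k \<longrightarrow>
      snd z (enc (w @ [j]) k) = cj (snd z (enc w j))"
    unfolding AE_all_countable
  proof (intro allI)
    fix w j k
    let ?P = "\<lambda>z. j < n \<longrightarrow> r j (fold N w (fst z)) = k \<longrightarrow> snd z (enc (w @ [j]) k) = cj (snd z (enc w j))"
    have "Measurable.pred Z ?P" by (intro pred_intros_logic pred_r_walk pred_snd_cj) simp
    then show "AE z in m. ?P z"
      by (rule AE_m[of _ "Suc (max (enc w j) (enc (w @ [j]) k))", rotated]) (auto dest: goodD(6))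
  qed
  have A7: "AE z in m. snd z 0 = 0"
    by (rule AE_m[of _ 1]) auto
  have "AE z in m. good z \<and> snd z 0 = 0"
    using A1 A2 A3 A4 A5 A6 A7 unfolding good_def by eventually_elim blast
  moreover have "distr m M fst = M"
  proof (rule measure_eqI)
    fix A assume A: "A \<in> sets (distr m M fst)"
    have C: "{z \<in> space Z. fst z \<in> A} \<in> cylinders M"
      by (rule cylinderI[where k=0]) (use A in auto)
    have "measure (\<mu> t) {z \<in> space Z. fst z \<in> A} = measure M A" for t
    proof -
      have "fst \<in> measurable (\<mu> t) M" using admissibleD(2)[OF ad[of t]] by (simp cong: measurable_cong_sets)
      then have "measure (distr (\<mu> t) M fst) A = measure (\<mu> t) (fst -` A \<inter> space (\<mu> t))"
        using A by (simp add: measure_distr)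
      moreover have "fst -` A \<inter> space (\<mu> t) = {z \<in> space Z. fst z \<in> A}"
        using admissibleD(4)[OF ad[of t]] by auto
      ultimately show ?thesis using admissibleD(3)[OF ad[of t]] by simp
    qed
    then have "measure m {z \<in> space Z. fst z \<in> A} = measure M A"
      using tendsto_unique[OF F(1) lim[OF C]] by simp
    moreover have "fst \<in> measurable m M" using m(2) by (simp cong: measurable_cong_sets)
    moreover have "fst -` A \<inter> space m = {z \<in> space Z. fst z \<in> A}" using spm by auto
    ultimately show "emeasure (distr m M fst) A = emeasure M A"
      using A by (simp add: emeasure_distr m.emeasure_eq_measure emeasure_eq_measure)
  qed simp
  moreover have "emeasure m (into j k S) =
      emeasure m (onto k j S)"
    if jk: "j < n" "k < n" and S: "S \<in> sets Z" for j k S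
  proof (rule transport_from_cylinders[OF m _ S])
    fix C assume C: "C \<in> cylinders M"
    have "measure (\<mu> t) (into j k C) =
      measure (\<mu> t) (onto k j C)" for t
      using admissibleD(5)[OF ad[of t] jk cylinders_sets[OF C]] by (simp add: measure_def)
    then have "measure m (into j k C) =
      measure m (onto k j C)"
      using tendsto_unique[OF F(1) lim[OF cylinder_to[OF C, of j k]]] lim[OF cylinder_from[OF C, of k j]] by simp
    then show "emeasure m (into j k C) =
      emeasure m (onto k j C)"
      by (simp add: m.emeasure_eq_measure)
  qed
  ultimately have "admissible m" unfolding admissible_def using m by blast
  moreover have "coverage m = V"
  proof (rule tendsto_unique[OF F(1)])
    show "((\<lambda>t. coverage (\<mu> t)) \<longlongrightarrow> V) F" using V F(2) by (rule tendsto_mono[rotated])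
    show "((\<lambda>t. coverage (\<mu> t)) \<longlongrightarrow> coverage m) F"
      unfolding coverage_def
    proof (intro tendsto_sum lim)
      fix j
      show "{z \<in> space Z. lab z j \<noteq> 0} \<in> cylinders M"
        by (rule cylinderI[where k="Suc (enc [] j)"]) (auto simp: lab_def)
    qed
  qed
  ultimately show ?thesis by blast
qed

lemma ex_max_coverage:
  obtains m where "admissible m" "\<And>m'. admissible m' \<Longrightarrow> coverage m' \<le> coverage m"
proof -
  let ?D = "coverage ` {m. admissible m}"
  have le: "coverage m \<le> n" if "admissible m" for m
  proof -
    interpret m: prob_space m by (rule admissibleD(1)[OF that])
    have "coverage m \<le> (\<Sum>j<n. 1)" unfolding coverage_def by (intro sum_mono) simp
    then show ?thesis by simp
  qed
  then have bdd: "bdd_above ?D" by (auto intro!: bdd_aboveI2)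
  have ne: "?D \<noteq> {}" using admissible_exists by auto
  have "\<exists>m. admissible m \<and> Sup ?D - 1 / Suc t < coverage m" for t
  proof -
    have "Sup ?D - 1 / Suc t < Sup ?D" by simp
    then show ?thesis using less_cSup_iff[OF ne bdd] by auto
  qed
  then obtain \<mu> where \<mu>: "\<And>t::nat. admissible (\<mu> t)" "\<And>t. Sup ?D - 1 / Suc t < coverage (\<mu> t)" by metis
  have "(\<lambda>t. coverage (\<mu> t)) \<longlonglongrightarrow> Sup ?D"
  proof (rule tendsto_sandwich)
    show "(\<lambda>t. Sup ?D - 1 / Suc t) \<longlonglongrightarrow> Sup ?D"
      using tendsto_diff[OF tendsto_const LIMSEQ_Suc[OF lim_1_over_n], of "Sup ?D"] by simp
    show "(\<lambda>t. Sup ?D) \<longlonglongrightarrow> Sup ?D" by simp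
    show "eventually (\<lambda>t. Sup ?D - 1 / Suc t \<le> coverage (\<mu> t)) sequentially"
      using \<mu>(2) by (intro always_eventually allI less_imp_le)
    show "eventually (\<lambda>t. coverage (\<mu> t) \<le> Sup ?D) sequentially"
      using \<mu>(1) bdd by (intro always_eventually allI cSup_upper) auto
  qed
  then obtain m where "admissible m" "coverage m = Sup ?D" using coverage_limit[of \<mu> "Sup ?D"] \<mu>(1) by blast
  then show thesis using that[of m] bdd by (auto intro: cSup_upper)
qed

section \<open>Augmentation along Kempe chains\<close>

text \<open>
  A vertex on a Kempe chain has a type \<open>b\<close>: a vertex of type \<open>False\<close> is entered through slot \<open>t\<close>
  and left through slot \<open>cj s\<close>, a vertex of type \<open>True\<close> is entered through \<open>s\<close> and left through \<open>cj t\<close>.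
  Chains start with type \<open>False\<close> at the vertices of \<open>C\<close>, and \<open>m\<close> bounds the number of steps.
\<close>

primrec chain_upto :: "'a cover set \<Rightarrow> nat \<Rightarrow> nat \<Rightarrow> nat \<Rightarrow> bool \<Rightarrow> 'a cover \<Rightarrow> bool" where
  "chain_upto C s t 0 b u = (\<not> b \<and> u \<in> C)"
| "chain_upto C s t (Suc m) b u = (\<not> b \<and> u \<in> C \<or>
     (\<exists>i<n. lab u i = (if b then s else t) \<and> chain_upto C s t m (\<not> b) (step i u)))"

text \<open>A vertex lies on a chain if tracing back reaches a start after finitely many steps, so
  even an infinite chain is exhausted by countably many measurable stages.\<close>

definition chain :: "'a cover set \<Rightarrow> nat \<Rightarrow> nat \<Rightarrow> bool \<Rightarrow> 'a cover \<Rightarrow> bool" where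
  "chain C s t b u \<longleftrightarrow> (\<exists>m. chain_upto C s t m b u)"

lemma chain_iff: "chain C s t b u \<longleftrightarrow> \<not> b \<and> u \<in> C \<or>
    (\<exists>i<n. lab u i = (if b then s else t) \<and> chain C s t (\<not> b) (step i u))"
proof
  assume "chain C s t b u"
  then obtain m where "chain_upto C s t m b u" by (auto simp: chain_def)
  then show "\<not> b \<and> u \<in> C \<or> (\<exists>i<n. lab u i = (if b then s else t) \<and> chain C s t (\<not> b) (step i u))"
  proof (cases m)
    case (Suc m')
    with \<open>chain_upto C s t m b u\<close> show ?thesis unfolding chain_def Suc chain_upto.simps by blast
  qed auto
next
  assume "\<not> b \<and> u \<in> C \<or> (\<exists>i<n. lab u i = (if b then s else t) \<and> chain C s t (\<not> b) (step i u))"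
  then show "chain C s t b u"
  proof
    assume "\<not> b \<and> u \<in> C"
    then have "chain_upto C s t 0 b u" by simp
    then show ?thesis unfolding chain_def by blast
  next
    assume "\<exists>i<n. lab u i = (if b then s else t) \<and> chain C s t (\<not> b) (step i u)"
    then obtain i m where "i < n" "lab u i = (if b then s else t)" "chain_upto C s t m (\<not> b) (step i u)"
      unfolding chain_def by blast
    then have "chain_upto C s t (Suc m) b u" unfolding chain_upto.simps by blast
    then show ?thesis unfolding chain_def by blast
  qed
qed

lemma pred_lab_eq: "Measurable.pred Z (\<lambda>z. lab z i = v)"
  by (rule pred_eq_countable) auto

lemma chain_upto_measurable:
  assumes "C \<in> sets Z"
  shows "Measurable.pred Z (chain_upto C s t m b)"
proof (induction m arbitrary: b)
  case 0
  show ?case unfolding chain_upto.simps[abs_def] using assms by (intro pred_intros_logic) auto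
next
  case (Suc m)
  have "Measurable.pred Z (\<lambda>u. chain_upto C s t m (\<not> b) (step i u))" for i
    by (rule measurable_compose[OF step_measurable Suc])
  moreover have "Measurable.pred Z (\<lambda>u. u \<in> C)" using assms by measurable
  ultimately have "Measurable.pred Z (\<lambda>u. \<not> b \<and> u \<in> C \<or>
     (\<exists>i. i < n \<and> lab u i = (if b then s else t) \<and> chain_upto C s t m (\<not> b) (step i u)))"
    by (intro pred_intros_logic pred_intros_countable pred_lab_eq) auto
  then show ?case by simp
qed

lemma chain_measurable:
  assumes "C \<in> sets Z"
  shows "Measurable.pred Z (chain C s t b)"
  unfolding chain_def[abs_def] by (intro pred_intros_countable chain_upto_measurable assms)

lemma lab_inj: "good z \<Longrightarrow> i < n \<Longrightarrow> j < n \<Longrightarrow> lab z i = lab z j \<Longrightarrow> lab z i \<noteq> 0 \<Longrightarrow> i = j"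
  using decorationD(3)[OF decoration_lab] by blast

lemma lab_rev: "good z \<Longrightarrow> j < n \<Longrightarrow> lab (step j z) (r j (fst z)) = cj (lab z j)"
  using decorationD(4)[OF decoration_lab] by blast

lemma lab_le: "good z \<Longrightarrow> lab z j \<le> n"
  using decorationD(1)[OF decoration_lab] by blast

lemma cj_inj: "a \<le> n \<Longrightarrow> b \<le> n \<Longrightarrow> cj a = cj b \<Longrightarrow> a = b"
  using cj_cj by metis

text \<open>The edges to be added leave the points of \<open>B\<close> along dart \<open>j\<close>
  and return along \<open>k\<close>. As the darts are fixed and no point of \<open>B\<close> leads
  to \<open>B\<close>, these edges are pairwise disjoint.\<close>

context
  fixes B :: "'a cover set" and j k s t :: nat
  assumes jk: "j < n" "k < n" and s: "0 < s" "s \<le> n" and t: "0 < t" "t \<le> n"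
    and B_sets: "B \<in> sets Z"
    and B_good: "\<And>z. z \<in> B \<Longrightarrow> good z"
    and B_r: "\<And>z. z \<in> B \<Longrightarrow> r j (fst z) = k"
    and B_lab: "\<And>z. z \<in> B \<Longrightarrow> lab z j = 0"
    and B_s: "\<And>z i. z \<in> B \<Longrightarrow> i < n \<Longrightarrow> lab z i \<noteq> s"
    and B_t: "\<And>z i. z \<in> B \<Longrightarrow> i < n \<Longrightarrow> lab (step j z) i \<noteq> t"
    and B_disj: "\<And>z. z \<in> B \<Longrightarrow> step j z \<notin> B"
begin

text \<open>The far ends of the edges to be added, which are the starting points of the
  chains.\<close>

definition C :: "'a cover set" where
  "C = {y \<in> space Z. good y \<and> r k (fst y) = j \<and> step k y \<in> B}"

text \<open>For \<open>s = t\<close> both types enter through \<open>s\<close> and leave through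
  \<open>cj s\<close>. They then call for the same exchange and have to be merged.\<close>

definition swapped :: "bool \<Rightarrow> 'a cover \<Rightarrow> bool" where
  "swapped b u \<longleftrightarrow> (if s = t then chain C s t False u \<or> chain C s t True u else chain C s t b u)"

text \<open>Type \<open>False\<close> exchanges \<open>t\<close> with \<open>cj s\<close>, type
  \<open>True\<close> exchanges \<open>s\<close> with \<open>cj t\<close>. For
  \<open>t = cj s\<close> both exchanges are trivial, as they should be: the far end then already
  misses \<open>cj s\<close>.\<close>

definition flip :: "'a cover \<Rightarrow> nat \<Rightarrow> nat" where
  "flip u a =
    (if a = t \<or> a = cj s then (if swapped False u then (if a = t then cj s else t) else a)
     else if a = s \<or> a = cj t then (if swapped True u then (if a = s then cj t else s) else a)
     else a)"

text \<open>After the exchange \<open>s\<close> is free at the end in \<open>B\<close> and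
  \<open>cj s\<close> is free at the end in \<open>C\<close>; the new edge receives this
  pair.\<close>

definition recolour :: "'a cover \<Rightarrow> nat \<Rightarrow> nat" where
  "recolour y i = (if y \<in> B \<and> i = j then s else if y \<in> C \<and> i = k then cj s else flip y (lab y i))"

lemma C_step: "y \<in> C \<Longrightarrow> step k y \<in> B" by (simp add: C_def)

lemma C_back: "y \<in> C \<Longrightarrow> step j (step k y) = y"
  using step_r[of y k] jk by (simp add: C_def)

lemma step_C: "z \<in> B \<Longrightarrow> step j z \<in> C"
proof -
  assume x: "z \<in> B"
  have g: "good z" using B_good[OF x] .
  have "step j z \<in> space Z" using step_space x sets.sets_into_space[OF B_sets] by blast
  moreover have "step k (step j z) = z" using step_r[OF g jk(1)] B_r[OF x] by simp
  moreover have "r k (fst (step j z)) = j" using r_r[OF goodD(1)[OF g] jk(1)] B_r[OF x] by simp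
  ultimately show ?thesis using x good_step[OF g] by (simp add: C_def)
qed

lemma C_t: "y \<in> C \<Longrightarrow> i < n \<Longrightarrow> lab y i \<noteq> t"
  using B_t[OF C_step] C_back by metis

lemma B_C: "z \<in> B \<Longrightarrow> z \<notin> C"
  using B_disj[OF C_step] C_back by metis

lemma C_sets: "C \<in> sets Z"
proof -
  have "Measurable.pred Z (\<lambda>y. step k y \<in> B)" using B_sets by measurable
  then have "Measurable.pred Z (\<lambda>y. good y \<and> r k (fst y) = j \<and> step k y \<in> B)"
    by (intro pred_intros_logic pred_good r_pred)
  then show ?thesis unfolding C_def by (simp add: pred_def)
qed

text \<open>Conversely, suppose that the neighbour lies on a chain. It is no start, since starts
  have type \<open>False\<close> and miss \<open>t\<close>. Slots being injective, the chain can
  only have entered it through the dart that leads back to \<open>y\<close>.\<close>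

lemma chain_edge:
  assumes g: "good y" and i: "i < n" and out: "lab y i = cj (if b then t else s)"
  shows "chain C s t b y \<longleftrightarrow> chain C s t (\<not> b) (step i y)"
proof -
  let ?r = "r i (fst y)"
  have r: "?r < n" using r_less[OF goodD(1)[OF g] i] .
  have ret: "step ?r (step i y) = y" by (rule step_r[OF g i])
  have lr: "lab (step i y) ?r = (if \<not> b then s else t)"
    using lab_rev[OF g i] out cj_cj s t by auto
  show ?thesis
  proof
    assume "chain C s t b y"
    then show "chain C s t (\<not> b) (step i y)"
      using r lr ret by (subst chain_iff) auto
  next
    assume "chain C s t (\<not> b) (step i y)"
    then consider "b" "step i y \<in> C"
      | l where "l < n" "lab (step i y) l = (if \<not> b then s else t)" "chain C s t b (step l (step i y))"
      by (subst (asm) chain_iff) auto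
    then show "chain C s t b y"
    proof cases
      case 1
      then show ?thesis using C_t[OF 1(2) r] lr by simp
    next
      case 2
      have "l = ?r" using lab_inj[OF good_step[OF g] 2(1) r] 2(2) lr s t by (auto split: if_splits)
      then show ?thesis using 2(3) ret by simp
    qed
  qed
qed

text \<open>The same edge read from its other end, where it is the leaving one.\<close>

lemma chain_edge':
  assumes g: "good y" and i: "i < n" and inn: "lab y i = (if b then s else t)"
  shows "chain C s t b y \<longleftrightarrow> chain C s t (\<not> b) (step i y)"
proof -
  let ?r = "r i (fst y)"
  have r: "?r < n" using r_less[OF goodD(1)[OF g] i] .
  have ret: "step ?r (step i y) = y" by (rule step_r[OF g i])
  have "lab (step i y) ?r = cj (if \<not> b then t else s)" using lab_rev[OF g i] inn by auto
  from chain_edge[OF good_step[OF g] r this] show ?thesis using ret by simp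
qed

text \<open>For \<open>s = t\<close> the edge is a chain edge for both types, so the equivalence is
  needed for each of them.\<close>

lemma swapped_edge:
  assumes g: "good y" and i: "i < n"
    and l: "lab y i = (if b then s else t) \<or> lab y i = cj (if b then t else s)"
  shows "swapped b y \<longleftrightarrow> swapped (\<not> b) (step i y)"
proof (cases "s = t")
  case True
  then have "chain C s t b' y \<longleftrightarrow> chain C s t (\<not> b') (step i y)" for b'
    using chain_edge[OF g i, of b'] chain_edge'[OF g i, of b'] l by auto
  from this[of True] this[of False] show ?thesis unfolding swapped_def by (auto simp: True)
next
  case False
  then show ?thesis
    using chain_edge[OF g i, of b] chain_edge'[OF g i, of b] l by (auto simp: swapped_def)
qed

lemma swapped_same: "s = t \<Longrightarrow> swapped b u = swapped b' u"
  unfolding swapped_def by simp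

lemma cj_facts:
  "cj (cj s) = s" "cj (cj t) = t" "cj s \<noteq> s" "cj t \<noteq> t" "0 < cj s" "0 < cj t" "cj s \<le> n" "cj t \<le> n"
  "cj s = cj t \<longleftrightarrow> s = t" "cj s = t \<longleftrightarrow> s = cj t"
  using cj_cj cj_neq cj_range s t by metis+

lemma flip_flip: "flip u (flip u a) = a"
proof (cases "s = t")
  case True
  have "swapped True u = swapped False u" by (rule swapped_same[OF True])
  then show ?thesis unfolding flip_def by (simp add: True)
next
  case False
  consider "a = t" | "a = cj s" | "a = s" | "a = cj t" | "a \<noteq> t" "a \<noteq> cj s" "a \<noteq> s" "a \<noteq> cj t" by blast
  then show ?thesis
    using False cj_facts by cases (simp_all add: flip_def)
qed

lemma flip_inj: "flip u a = flip u b \<Longrightarrow> a = b"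
  using flip_flip by metis

lemma flip_le: "a \<le> n \<Longrightarrow> flip u a \<le> n"
  using cj_facts s t unfolding flip_def by auto

lemma flip_0: "flip u a = 0 \<longleftrightarrow> a = 0"
  using cj_facts s t unfolding flip_def by auto

text \<open>The slots \<open>t\<close> and \<open>cj s\<close> of type \<open>False\<close> appear
  at the other end as \<open>cj t\<close> and \<open>s\<close> of type \<open>True\<close>, and vice
  versa. As the type alternates along a chain, either both ends make the exchange or neither
  does.\<close>

lemma flip_edge:
  assumes g: "good y" and i: "i < n"
  shows "flip (step i y) (cj (lab y i)) = cj (flip y (lab y i))"
proof -
  let ?a = "lab y i"
  have le: "?a \<le> n" using lab_le[OF g] .
  have iff: "cj ?a = t \<longleftrightarrow> ?a = cj t" "cj ?a = s \<longleftrightarrow> ?a = cj s" "cj ?a = cj s \<longleftrightarrow> ?a = s" "cj ?a = cj t \<longleftrightarrow> ?a = t"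
    using cj_cj le s t by metis+
  have F: "swapped False y \<longleftrightarrow> swapped True (step i y)" if "?a = t \<or> ?a = cj s"
    using swapped_edge[OF g i, of False] that by simp
  have T: "swapped True y \<longleftrightarrow> swapped False (step i y)" if "?a = s \<or> ?a = cj t"
    using swapped_edge[OF g i, of True] that by simp
  show ?thesis
    unfolding flip_def iff using F T cj_facts swapped_same[of True y False] swapped_same[of True "step i y" False]
    by (auto split: if_splits)
qed

text \<open>Only an exchange of type \<open>True\<close>, or of the merged type if
  \<open>s = t\<close>, could produce \<open>s\<close>. Such chains enter through \<open>s\<close>,
  which \<open>z\<close> misses, and \<open>z\<close> is not a start.\<close>

lemma flip_B:
  assumes x: "z \<in> B" and i: "i < n"
  shows "flip z (lab z i) \<noteq> s"
proof -
  have "\<not> chain C s t True z" using B_s[OF x] by (subst chain_iff) auto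
  moreover have "\<not> chain C s t False z" if "s = t"
    using B_s[OF x] B_C[OF x] that by (subst chain_iff) auto
  ultimately have "\<not> swapped True z" "s = t \<Longrightarrow> \<not> swapped False z" unfolding swapped_def by auto
  then show ?thesis using B_s[OF x i] cj_facts unfolding flip_def by (auto split: if_splits)
qed

text \<open>A start exchanges \<open>t\<close> with \<open>cj s\<close>; since \<open>t\<close> was
  missing before, \<open>cj s\<close> is missing afterwards.\<close>

lemma flip_C:
  assumes x: "y \<in> C" and i: "i < n"
  shows "flip y (lab y i) \<noteq> cj s"
proof -
  have "chain C s t False y" using x by (subst chain_iff) auto
  then have "swapped False y" unfolding swapped_def by auto
  then show ?thesis using C_t[OF x i] cj_facts unfolding flip_def by (auto split: if_splits)
qed

lemma recolour_decoration: "decoration recolour"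
  unfolding decoration_def
proof (intro allI impI conjI)
  fix y i assume g: "good y"
  show "recolour y i \<le> n" unfolding recolour_def using s cj_facts flip_le[OF lab_le[OF g]] by auto
next
  fix y i assume g: "good y" and i: "n \<le> i"
  have "lab y i = 0" using decorationD(2)[OF decoration_lab g i] .
  then show "recolour y i = 0" unfolding recolour_def using i jk flip_0 by auto
next
  fix y i l assume g: "good y" and il: "i < n" "l < n"
    and eq: "recolour y i = recolour y l" and nz: "recolour y i \<noteq> 0"
  show "i = l"
  proof (rule ccontr)
    assume ne: "i \<noteq> l"
    have fl: False if "flip y (lab y i) = flip y (lab y l)" "flip y (lab y i) \<noteq> 0"
    proof -
      have "lab y i = lab y l" "lab y i \<noteq> 0" using flip_inj[OF that(1)] that(2) flip_0 by auto
      then show False using lab_inj[OF g il] ne by blast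
    qed
    consider "y \<in> B" | "y \<in> C" "y \<notin> B" | "y \<notin> B" "y \<notin> C" by blast
    then show False
    proof cases
      case 1
      have R: "recolour y x = (if x = j then s else flip y (lab y x))" for x
        using 1 B_C[OF 1] by (simp add: recolour_def)
      show False
        using eq nz ne fl flip_B[OF 1 il(1)] flip_B[OF 1 il(2)] unfolding R
        by (cases "i = j"; cases "l = j") auto
    next
      case 2
      have R: "recolour y x = (if x = k then cj s else flip y (lab y x))" for x
        using 2 by (simp add: recolour_def)
      show False
        using eq nz ne fl flip_C[OF 2(1) il(1)] flip_C[OF 2(1) il(2)] unfolding R
        by (cases "i = k"; cases "l = k") auto
    next
      case 3
      have R: "recolour y x = flip y (lab y x)" for x
        using 3 by (simp add: recolour_def)
      show False using eq nz fl unfolding R by blast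
    qed
  qed
next
  fix y i assume g: "good y" and i: "i < n"
  let ?r = "r i (fst y)" and ?u = "step i y"
  have ret: "step ?r ?u = y" by (rule step_r[OF g i])
  have rret: "r ?r (fst ?u) = i" using r_r[OF goodD(1)[OF g] i] by simp
  \<comment> \<open>The first two cases are the two directions of a new edge. For any other dart the
    reverse dart is not new either, and \<open>flip_edge\<close> applies.\<close>
  consider (B) "y \<in> B" "i = j" | (C) "y \<in> C" "i = k" | (n) "\<not> (y \<in> B \<and> i = j)" "\<not> (y \<in> C \<and> i = k)"
    by blast
  then show "recolour ?u ?r = cj (recolour y i)"
  proof cases
    case B
    have "?u \<in> C" "?r = k" "?u \<notin> B"
      unfolding B(2) by (rule step_C[OF B(1)] B_r[OF B(1)] B_disj[OF B(1)])+
    then have "recolour ?u ?r = cj s" unfolding recolour_def by simp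
    moreover have "recolour y i = s" using B unfolding recolour_def by simp
    ultimately show ?thesis by simp
  next
    case C
    have "?u \<in> B" unfolding C(2) by (rule C_step[OF C(1)])
    moreover have "?r = j" using C unfolding C_def by simp
    ultimately have "recolour ?u ?r = s" unfolding recolour_def by simp
    moreover have "y \<notin> B" using C(1) B_C by blast
    then have "recolour y i = cj s" using C unfolding recolour_def by simp
    ultimately show ?thesis using cj_facts(1) by simp
  next
    case n
    have "\<not> (?u \<in> B \<and> ?r = j)"
    proof
      assume a: "?u \<in> B \<and> ?r = j"
      then have "y \<in> C" using step_C[of ?u] ret by simp
      moreover have "i = k" using a rret B_r[of ?u] by simp
      ultimately show False using n by blast
    qed
    moreover have "\<not> (?u \<in> C \<and> ?r = k)"
    proof
      assume a: "?u \<in> C \<and> ?r = k"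
      then have "y \<in> B" using C_step[of ?u] ret by simp
      moreover have "i = j" using a rret by (auto simp: C_def)
      ultimately show False using n by blast
    qed
    ultimately have 1: "recolour ?u ?r = flip ?u (lab ?u ?r)" unfolding recolour_def by auto
    have 2: "recolour y i = flip y (lab y i)" using n unfolding recolour_def by auto
    show ?thesis unfolding 1 2 lab_rev[OF g i] by (rule flip_edge[OF g i])
  qed
qed

lemma recolour_measurable: "(\<lambda>z. recolour z i) \<in> measurable Z (count_space UNIV)"
proof -
  have sw: "Measurable.pred Z (swapped b)" for b
    unfolding swapped_def[abs_def] using chain_measurable[OF C_sets]
    by (cases "s = t") (auto intro: pred_intros_logic)
  have [measurable]: "(\<lambda>u. flip u a) \<in> measurable Z (count_space UNIV)" for a
    unfolding flip_def using sw[of True] sw[of False] by (auto intro!: measurable_If simp: pred_def)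
  have fl: "(\<lambda>u. flip u (lab u i)) \<in> measurable Z (count_space UNIV)"
    by (rule measurable_compose_countable[OF _ lab_measurable]) measurable
  show ?thesis unfolding recolour_def[abs_def]
    using B_sets C_sets fl by (intro measurable_If) auto
qed

lemma recolour_nonzero: "lab z i \<noteq> 0 \<Longrightarrow> recolour z i \<noteq> 0"
  using s(1) cj_facts(5) flip_0[of z "lab z i"] unfolding recolour_def by simp

lemma recolour_B: "z \<in> B \<Longrightarrow> recolour z j \<noteq> 0"
  using s by (simp add: recolour_def)

end

text \<open>Undecorated darts are sorted into countably many classes, each of which can serve as
  \<open>B\<close>. Recolouring raises the coverage by at least the measure of the class, so by
  maximality every class is null.\<close>

lemma max_coverage_full:
  assumes m: "admissible m" and max: "\<And>m'. admissible m' \<Longrightarrow> coverage m' \<le> coverage m"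
  shows "AE z in m. \<forall>i<n. lab z i \<noteq> 0"
proof -
  interpret m: prob_space m by (rule admissibleD(1)[OF m])
  have sm: "sets m = sets Z" and spm: "space m = space Z" using admissibleD[OF m] by auto
  \<comment> \<open>The set \<open>U i\<close> contains the root but not its neighbour, so the
    neighbour cannot belong to the same class. This is the disjointness required of
    \<open>B\<close>.\<close>
  define A where "A j k s t i = {z \<in> space Z. good z \<and> r j (fst z) = k \<and> lab z j = 0 \<and>
    (\<forall>l<n. lab z l \<noteq> s) \<and> (\<forall>l<n. lab (step j z) l \<noteq> t) \<and> fst z \<in> U i \<and> N j (fst z) \<notin> U i}" for j k s t i
  have A_sets: "A j k s t i \<in> sets Z" for j k s t i
  proof -
    have "Measurable.pred Z (\<lambda>z. lab (step j z) l = t)" for l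
      by (rule measurable_compose[OF step_measurable pred_lab_eq])
    moreover have "Measurable.pred Z (\<lambda>z. fst z \<in> U i)" by measurable
    moreover have "Measurable.pred Z (\<lambda>z. N j (fst z) \<in> U i)" by measurable
    ultimately have "Measurable.pred Z (\<lambda>z. good z \<and> r j (fst z) = k \<and> lab z j = 0 \<and>
      (\<forall>l. l < n \<longrightarrow> \<not> lab z l = s) \<and> (\<forall>l. l < n \<longrightarrow> \<not> lab (step j z) l = t) \<and> fst z \<in> U i \<and> \<not> N j (fst z) \<in> U i)"
      by (intro pred_intros_logic pred_intros_countable pred_good r_pred pred_lab_eq) auto
    then show ?thesis unfolding A_def by (simp add: pred_def)
  qed
  have null: "measure m (A j k s t i) = 0"
    if jk: "j < n" "k < n" and s: "0 < s" "s \<le> n" and t: "0 < t" "t \<le> n" for j k s t i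
  proof -
    define B where "B = A j k s t i"
    have B_sets: "B \<in> sets Z" unfolding B_def by (rule A_sets)
    have B: "z \<in> B \<Longrightarrow> good z" "z \<in> B \<Longrightarrow> r j (fst z) = k" "z \<in> B \<Longrightarrow> lab z j = 0"
      "z \<in> B \<Longrightarrow> l < n \<Longrightarrow> lab z l \<noteq> s" "z \<in> B \<Longrightarrow> l < n \<Longrightarrow> lab (step j z) l \<noteq> t"
      "z \<in> B \<Longrightarrow> step j z \<notin> B" for z l
      unfolding B_def A_def by auto
    define D where "D = recolour B j k s t"
    note pars = jk s t B_sets B
    have dec: "decoration D" unfolding D_def by (rule recolour_decoration) (assumption | rule pars)+
    have meas: "(\<lambda>z. D z l) \<in> measurable Z (count_space UNIV)" for l
      unfolding D_def by (rule recolour_measurable) (assumption | rule pars)+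
    have nz: "lab z l \<noteq> 0 \<Longrightarrow> D z l \<noteq> 0" for z l
      unfolding D_def by (rule recolour_nonzero) (assumption | rule pars)+
    have nzB: "z \<in> B \<Longrightarrow> D z j \<noteq> 0" for z
      unfolding D_def by (rule recolour_B) (assumption | rule pars)+
    let ?m = "distr m Z (relabel D)"
    have rel: "relabel D \<in> measurable m Z"
      using relabel_measurable[OF meas] sm by (simp cong: measurable_cong_sets)
    have lab0: "{z \<in> space Z. lab z l \<noteq> 0} \<in> sets Z" for l by measurable
    have D0: "{z \<in> space Z. D z l \<noteq> 0} \<in> sets Z" for l
      using measurable_sets[OF meas, of "- {0}" l] by (simp add: vimage_def Int_def conj_commute)
    have dm: "measure ?m {z \<in> space Z. lab z l \<noteq> 0} = measure m {z \<in> space Z. D z l \<noteq> 0}" for l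
      unfolding measure_distr[OF rel lab0]
      by (rule arg_cong[where f="measure m"]) (auto simp: spm in_space_Z)
    \<comment> \<open>Decorated darts stay decorated, and dart \<open>j\<close> becomes decorated on
      all of \<open>B\<close>, where it was not before.\<close>
    have ge: "measure m {z \<in> space Z. lab z l \<noteq> 0} + (if l = j then measure m B else 0)
        \<le> measure m {z \<in> space Z. D z l \<noteq> 0}" for l
    proof (cases "l = j")
      case True
      have "measure m {z \<in> space Z. lab z l \<noteq> 0} + measure m B = measure m ({z \<in> space Z. lab z l \<noteq> 0} \<union> B)"
        using lab0[of l] B_sets sm B(3) True by (intro m.finite_measure_Union[symmetric]) auto
      also have "\<dots> \<le> measure m {z \<in> space Z. D z l \<noteq> 0}"
        using nz nzB True D0[of l] sm sets.sets_into_space[OF B_sets] by (intro m.finite_measure_mono) auto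
      finally show ?thesis using True by simp
    next
      case False
      have "measure m {z \<in> space Z. lab z l \<noteq> 0} \<le> measure m {z \<in> space Z. D z l \<noteq> 0}"
        using nz D0[of l] sm by (intro m.finite_measure_mono) auto
      then show ?thesis using False by simp
    qed
    have "coverage m + measure m B = (\<Sum>l<n. measure m {z \<in> space Z. lab z l \<noteq> 0} + (if l = j then measure m B else 0))"
      using jk by (simp add: coverage_def sum.distrib)
    also have "\<dots> \<le> coverage ?m" unfolding coverage_def dm by (intro sum_mono ge)
    also have "\<dots> \<le> coverage m" by (rule max[OF admissible_relabel[OF m dec meas]])
    finally show ?thesis using measure_nonneg[of m B] unfolding B_def by linarith
  qed
  have "AE z in m. \<forall>j k s t i. j < n \<longrightarrow> k < n \<longrightarrow> 0 < s \<and> s \<le> n \<longrightarrow> 0 < t \<and> t \<le> n \<longrightarrow> z \<notin> A j k s t i"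
    unfolding AE_all_countable
  proof (intro allI)
    fix j k s t i
    show "AE z in m. j < n \<longrightarrow> k < n \<longrightarrow> 0 < s \<and> s \<le> n \<longrightarrow> 0 < t \<and> t \<le> n \<longrightarrow> z \<notin> A j k s t i"
    proof (cases "j < n \<and> k < n \<and> (0 < s \<and> s \<le> n) \<and> 0 < t \<and> t \<le> n")
      case True
      then have "AE z in m. z \<notin> A j k s t i"
        using null[of j k s t i] m.prob_eq_0[of "A j k s t i"] A_sets sm by auto
      then show ?thesis by eventually_elim simp
    qed auto
  qed
  then show ?thesis using admissibleD(6)[OF m] AE_space
  proof eventually_elim
    case (elim z)
    \<comment> \<open>Pigeonhole: \<open>n\<close> slots face at most \<open>n - 1\<close> decorated
      darts.\<close>
    have missing: "\<exists>s. 0 < s \<and> s \<le> n \<and> (\<forall>l<n. lab z' l \<noteq> s)" if "j < n" "lab z' j = 0" for z' j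
    proof (rule ccontr)
      assume "\<not> ?thesis"
      then have "{1..n} \<subseteq> lab z' ` ({..<n} - {j})"
        using that by (force simp: Suc_le_eq)
      then have "card {1..n} \<le> card ({..<n} - {j})"
        by (meson card_image_le card_mono finite_Diff finite_imageI finite_lessThan order_trans)
      then show False using that by simp
    qed
    show ?case
    proof (intro allI impI notI)
      fix j assume j: "j < n" "lab z j = 0"
      have x: "fst z \<in> X0" using goodD(1) elim by blast
      let ?k = "r j (fst z)"
      have k: "?k < n" using r_less[OF x j(1)] .
      have "lab (step j z) ?k = 0" using lab_rev[of z j] elim j by simp
      then obtain t where t: "0 < t" "t \<le> n" "\<forall>l<n. lab (step j z) l \<noteq> t" using missing[OF k] by blast
      obtain s where s: "0 < s" "s \<le> n" "\<forall>l<n. lab z l \<noteq> s" using missing[OF j] by blast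
      have "fst z \<in> space M" "N j (fst z) \<in> space M"
        using x N_X0[OF x] sets.sets_into_space[OF X0_sets] by auto
      then obtain i where "fst z \<in> U i" "N j (fst z) \<notin> U i"
        using U_separates N_neq[OF x j(1)] by metis
      then have "z \<in> A j ?k s t i" unfolding A_def using elim s t j by (simp add: spm)
      then show False using elim(1) j(1) k s t by blast
    qed
  qed
qed

lemma ex_full_decoration:
  obtains m where "admissible m" "AE z in m. \<forall>i<n. lab z i \<noteq> 0"
proof -
  obtain m where m: "admissible m" "\<And>m'. admissible m' \<Longrightarrow> coverage m' \<le> coverage m"
    using ex_max_coverage by blast
  show thesis by (rule that[OF m(1) max_coverage_full[OF m]])
qed

end

section \<open>The cover\<close>

lemma ex_countable_base_euclidean:
  "\<exists>B :: 'a::second_countable_topology set set. countable B \<and> (\<forall>V\<in>B. open V) \<and>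
     (\<forall>U x. open U \<and> x \<in> U \<longrightarrow> (\<exists>V\<in>B. x \<in> V \<and> V \<subseteq> U))"
proof -
  obtain B :: "'a set set" where B: "countable B" "topological_basis B"
    using ex_countable_basis by blast
  have "\<exists>V\<in>B. x \<in> V \<and> V \<subseteq> U" if "open U \<and> x \<in> U" for U x
    using topological_basisE[OF B(2), of U x] that by metis
  then show ?thesis
    using B(1) topological_basis_open[OF B(2)] by (intro exI[of _ B]) simp
qed

lemma completely_metrizable_baire:
  "completely_metrizable_space (euclidean :: (nat \<Rightarrow> nat) topology)"
proof -
  have "(euclidean :: nat topology) = discrete_topology UNIV"
    by (simp add: topology_eq Topological_Spaces.open_discrete)
  then have "completely_metrizable_space (euclidean :: nat topology)"
    by (simp add: completely_metrizable_space_discrete_topology)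
  then show ?thesis
    unfolding euclidean_product_topology[symmetric] completely_metrizable_space_product_topology by simp
qed

lemma sets_label_space: "sets label_space = sets (borel :: (nat \<Rightarrow> nat) measure)"
proof -
  have "sets label_space = sets (Pi\<^sub>M UNIV (\<lambda>_::nat. borel :: nat measure))"
    by (rule sets_PiM_cong) (simp_all add: sets_borel_eq_count_space)
  then show ?thesis by (simp add: sets_PiM_equal_borel)
qed

text \<open>The topology is the product of the one on \<open>M\<close> with Baire space. It has a
  countable base of rectangles, so every open set is a countable union of these and the Borel sets
  are those of the product sigma-algebra.\<close>

lemma standard_borel_labelled:
  fixes M :: "'a measure"
  assumes "standard_borel M" and sm: "sets m = sets (labelled M)"
  shows "standard_borel m"
proof -
  have spm: "space m = space M \<times> UNIV" using sets_eq_imp_space_eq[OF sm] by (simp add: space_labelled)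
  from assms(1) obtain T where T: "completely_metrizable_space T" "second_countable T"
    and top: "topspace T = space M" and sets: "sets M = sigma_sets (topspace T) {U. openin T U}"
    unfolding standard_borel_def by blast
  obtain B where B: "countable B" "\<And>V. V \<in> B \<Longrightarrow> openin T V"
    "\<And>U x. openin T U \<Longrightarrow> x \<in> U \<Longrightarrow> \<exists>V\<in>B. x \<in> V \<and> V \<subseteq> U"
    using T(2) unfolding second_countable_def by metis
  obtain D :: "(nat \<Rightarrow> nat) set set" where D: "countable D" "\<And>V. V \<in> D \<Longrightarrow> open V"
    "\<And>U x. open U \<Longrightarrow> x \<in> U \<Longrightarrow> \<exists>V\<in>D. x \<in> V \<and> V \<subseteq> U"
    using ex_countable_base_euclidean by metis
  let ?P = "prod_topology T (euclidean :: (nat \<Rightarrow> nat) topology)"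
  let ?BD = "(\<lambda>(a, b). a \<times> b) ` (B \<times> D)"
  have BD: "countable ?BD" using B(1) D(1) by auto
  have BD_open: "openin ?P V" if "V \<in> ?BD" for V
    using that B(2) D(2) by (auto simp: openin_prod_Times_iff)
  have BD_base: "\<exists>V\<in>?BD. p \<in> V \<and> V \<subseteq> W" if W: "openin ?P W" "p \<in> W" for W p
  proof -
    obtain x y where p: "p = (x, y)" by (cases p)
    obtain U V where UV: "openin T U" "open V" "x \<in> U" "y \<in> V" "U \<times> V \<subseteq> W"
      using W unfolding openin_prod_topology_alt p by (metis open_openin)
    obtain b where b: "b \<in> B" "x \<in> b" "b \<subseteq> U" using B(3)[OF UV(1,3)] by blast
    obtain c where c: "c \<in> D" "y \<in> c" "c \<subseteq> V" using D(3)[OF UV(2,4)] by blast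
    show ?thesis
    proof (rule bexI[of _ "b \<times> c"])
      show "p \<in> b \<times> c \<and> b \<times> c \<subseteq> W" using b c UV(5) p by auto
      show "b \<times> c \<in> ?BD" using b c by auto
    qed
  qed
  have "second_countable ?P"
    unfolding second_countable_def
  proof (intro exI[of _ ?BD] conjI ballI allI impI)
    show "countable ?BD" by (rule BD)
    show "openin ?P V" if "V \<in> ?BD" for V by (rule BD_open[OF that])
    show "\<exists>V\<in>?BD. p \<in> V \<and> V \<subseteq> W" if "openin ?P W \<and> p \<in> W" for W p
      using that by (intro BD_base) auto
  qed
  moreover have "completely_metrizable_space ?P"
    unfolding completely_metrizable_space_prod_topology using T(1) completely_metrizable_baire by blast
  moreover have tP: "topspace ?P = space m" by (simp add: top spm)
  moreover have "sets m = sigma_sets (topspace ?P) {U. openin ?P U}"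
  proof
    let ?S = "sigma (topspace ?P) {U. openin ?P U}"
    have sub: "{U. openin ?P U} \<subseteq> Pow (topspace ?P)" using openin_subset by blast
    have spS: "space ?S = space M \<times> UNIV" using sub by (simp add: space_measure_of top)
    have "fst \<in> measurable ?S M"
    proof (rule measurable_sigma_sets[OF sets])
      show "{U. openin T U} \<subseteq> Pow (topspace T)" using openin_subset by blast
      show "fst \<in> space ?S \<rightarrow> topspace T" unfolding spS top by auto
      fix U assume U: "U \<in> {U. openin T U}"
      have "fst -` U \<inter> space ?S = U \<times> UNIV" using openin_subset[of T U] U unfolding spS top by auto
      moreover have "openin ?P (U \<times> UNIV)" using U by (simp add: openin_prod_Times_iff)
      ultimately show "fst -` U \<inter> space ?S \<in> sets ?S" using sub by (simp add: sets_measure_of)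
    qed
    moreover have "snd \<in> measurable ?S label_space"
    proof -
      have "snd \<in> measurable ?S (borel :: (nat \<Rightarrow> nat) measure)"
      proof (rule borel_measurableI)
        fix V :: "(nat \<Rightarrow> nat) set" assume V: "open V"
        have "snd -` V \<inter> space ?S = topspace T \<times> V" unfolding spS top by auto
        moreover have "openin ?P (topspace T \<times> V)" using V by (simp add: openin_prod_Times_iff)
        ultimately show "snd -` V \<inter> space ?S \<in> sets ?S" using sub by (simp add: sets_measure_of)
      qed
      then show ?thesis using sets_label_space by (simp cong: measurable_cong_sets)
    qed
    ultimately have "(\<lambda>p. (fst p, snd p)) \<in> measurable ?S (labelled M)" by (rule measurable_Pair)
    then have id: "(\<lambda>p. p) \<in> measurable ?S (labelled M)" by simp
    show "sets m \<subseteq> sigma_sets (topspace ?P) {U. openin ?P U}"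
    proof
      fix A assume A: "A \<in> sets m"
      have "A \<subseteq> space ?S" using sets.sets_into_space[OF A] unfolding spS spm .
      moreover have "(\<lambda>p. p) -` A \<inter> space ?S \<in> sets ?S"
        using measurable_sets[OF id, of A] A sm by simp
      ultimately have "A \<in> sets ?S" by (simp add: Int_absorb2)
      then show "A \<in> sigma_sets (topspace ?P) {U. openin ?P U}" using sub by (simp add: sets_measure_of)
    qed
    show "sigma_sets (topspace ?P) {U. openin ?P U} \<subseteq> sets m"
      unfolding tP
    proof (rule sets.sigma_sets_subset, rule subsetI)
      fix W assume W: "W \<in> {U. openin ?P U}"
      have "W = \<Union>{V \<in> ?BD. V \<subseteq> W}"
      proof (intro equalityI subsetI)
        fix p assume "p \<in> W"
        then obtain V where "V \<in> ?BD" "p \<in> V \<and> V \<subseteq> W" using BD_base[of W p] W by auto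
        then show "p \<in> \<Union>{V \<in> ?BD. V \<subseteq> W}" by (intro UnionI[of V]) simp_all
      next
        fix p assume "p \<in> \<Union>{V \<in> ?BD. V \<subseteq> W}"
        then obtain V where "V \<subseteq> W" "p \<in> V" by auto
        then show "p \<in> W" by auto
      qed
      moreover have "\<Union>{V \<in> ?BD. V \<subseteq> W} \<in> sets m"
      proof (rule sets.countable_Union)
        show "countable {V \<in> ?BD. V \<subseteq> W}" using BD by (rule countable_subset[rotated]) auto
        show "{V \<in> ?BD. V \<subseteq> W} \<subseteq> sets m"
        proof
          fix V assume "V \<in> {V \<in> ?BD. V \<subseteq> W}"
          then obtain b c where bc: "V = b \<times> c" "b \<in> B" "c \<in> D" by auto
          have "b \<in> sets M" unfolding sets using B(2)[OF bc(2)] by auto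
          moreover have "c \<in> sets label_space" unfolding sets_label_space using D(2)[OF bc(3)] by auto
          ultimately show "V \<in> sets m" unfolding sm bc(1) by (rule pair_measureI)
        qed
      qed
      ultimately show "W \<in> sets m" by simp
    qed
  qed
  ultimately show ?thesis unfolding standard_borel_def by blast
qed

text \<open>Slots from 1 to \<open>d\<close> are outgoing edges of the respective colour; adding
  \<open>d\<close> gives the incoming edge of the same colour.\<close>

definition conj_slot :: "nat \<Rightarrow> nat \<Rightarrow> nat" where
  "conj_slot d s = (if s = 0 then 0 else if s \<le> d then s + d else s - d)"

text \<open>Colour \<open>i\<close> becomes translation of the integers by \<open>i\<close> and its
  inverse translation by \<open>- i\<close>: conjugate slots get opposite values, and distinct slots
  distinct nonzero values.\<close>

definition slot_shift :: "nat \<Rightarrow> nat \<Rightarrow> int" where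
  "slot_shift d v = (if v \<le> d then int v else - int (v - d))"

locale schreier_cover = slot_system M "2 * d" X0 N r U "conj_slot d"
  for M :: "'a measure" and d X0 N r and U :: "nat \<Rightarrow> 'a set" +
  fixes E :: "('a \<times> 'a) set" and m :: "'a cover measure"
  assumes adm: "admissible m" and AE_lab: "AE z in m. \<forall>i<2 * d. lab z i \<noteq> 0"
    and neighbours: "\<And>x. x \<in> X0 \<Longrightarrow> {y. (x, y) \<in> E} = (\<lambda>j. N j x) ` {..<2 * d}"
    and standard: "standard_borel M"
begin

sublocale m: prob_space m by (rule admissibleD(1)[OF adm])

lemma sets_m [measurable_cong, simp]: "sets m = sets Z" and space_m [simp]: "space m = space Z"
  using admissibleD[OF adm] by auto

definition full :: "'a cover \<Rightarrow> bool" where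
  "full z \<longleftrightarrow> good z \<and> (\<forall>w. \<forall>i<2 * d. snd z (enc w i) \<noteq> 0)"

lemma full_good: "full z \<Longrightarrow> good z" by (simp add: full_def)

lemma full_lab: "full z \<Longrightarrow> i < 2 * d \<Longrightarrow> lab z i \<noteq> 0" by (simp add: full_def lab_def)

lemma full_step: "full z \<Longrightarrow> full (step j z)"
  using good_step by (simp add: full_def)

lemma full_walk: "full z \<Longrightarrow> full (fold step w z)"
  by (induction w arbitrary: z) (auto simp: full_step)

lemma pred_full [measurable]: "Measurable.pred Z full"
proof -
  have 1: "Measurable.pred Z (\<lambda>z. snd z p = 0)" for p by (rule pred_eq_countable) auto
  have "Measurable.pred Z (\<lambda>z. good z \<and> (\<forall>w i. i < 2 * d \<longrightarrow> \<not> snd z (enc w i) = 0))"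
    by (intro pred_intros_logic pred_intros_countable pred_good 1) auto
  then show ?thesis unfolding full_def[abs_def] by simp
qed

text \<open>For each return dart \<open>k\<close>, the points that \<open>step j\<close> sends into
  a null set have the mass of a part of that null set, by transport.\<close>

lemma AE_step:
  assumes P: "Measurable.pred Z P" and ae: "AE z in m. P z"
  shows "AE z in m. P (step j z)"
proof (cases "j < 2 * d")
  case False
  show ?thesis using ae admissibleD(6)[OF adm]
    by eventually_elim (use step_ge False in auto)
next
  case j: True
  let ?S = "{z \<in> space Z. \<not> P z}"
  have S: "?S \<in> sets Z" using P by measurable
  have S0: "emeasure m ?S = 0" using AE_iff_measurable[of ?S m P] ae S by simp
  have "AE z in m. \<forall>k\<in>{..<2 * d}. fst z \<in> X0 \<and> r j (fst z) = k \<longrightarrow> P (step j z)"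
  proof (rule AE_finite_allI)
    fix k assume k: "k \<in> {..<2 * d}"
    let ?A = "{z \<in> space Z. fst z \<in> X0 \<and> r j (fst z) = k \<and> step j z \<in> ?S}"
    have "emeasure m ?A = emeasure m {z \<in> space Z. fst z \<in> X0 \<and> r k (fst z) = j \<and> z \<in> ?S}"
      using admissibleD(5)[OF adm j _ S] k by simp
    also have "\<dots> \<le> emeasure m ?S" using S by (intro emeasure_mono) auto
    finally have "emeasure m ?A = 0" using S0 by simp
    then have "AE z in m. z \<notin> ?A" using sets_to[OF S] by (intro AE_not_in) (auto simp: null_sets_def)
    then show "AE z in m. fst z \<in> X0 \<and> r j (fst z) = k \<longrightarrow> P (step j z)"
      using AE_space by eventually_elim (use step_space in auto)
  qed simp
  then show ?thesis using admissibleD(6)[OF adm]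
  proof eventually_elim
    case (elim z)
    then show ?case using goodD(1)[of z] r_less[of "fst z" j] j by auto
  qed
qed

text \<open>There are only countably many walks, and each step preserves almost sure
  statements.\<close>

lemma AE_full: "AE z in m. full z"
proof -
  let ?P = "\<lambda>z. \<forall>i<2 * d. lab z i \<noteq> 0"
  have "Measurable.pred Z (\<lambda>z. \<forall>i. i < 2 * d \<longrightarrow> \<not> lab z i = 0)"
    by (intro pred_intros_logic pred_intros_countable pred_lab_eq) auto
  then have P: "Measurable.pred Z ?P" by simp
  have aew: "AE z in m. ?P (fold step w z)" for w
  proof (induction w)
    case (Cons j w)
    have "Measurable.pred Z (\<lambda>z. ?P (fold step w z))"
      by (rule measurable_compose[OF fold_step_measurable P])
    from AE_step[OF this Cons] show ?case by simp
  qed (use AE_lab in simp)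
  have "AE z in m. \<forall>w. ?P (fold step w z)"
    by (rule AE_all_countable[THEN iffD2]) (rule allI, rule aew)
  then show ?thesis using admissibleD(6)[OF adm]
    by eventually_elim (auto simp: full_def lab_walk)
qed

lemma conj_slot_range: "0 < v \<Longrightarrow> v \<le> 2 * d \<Longrightarrow> 0 < conj_slot d v \<and> conj_slot d v \<le> 2 * d"
  using cj_range .

lemma conj_slot_conj: "v \<le> 2 * d \<Longrightarrow> conj_slot d (conj_slot d v) = v"
  using cj_cj .

definition dart :: "nat \<Rightarrow> 'a cover \<Rightarrow> nat" where
  "dart v z = (LEAST i. lab z i = v)"

text \<open>
  Points without a full decoration form a null set; there the generators act by translations of
  the coordinate \<open>0\<close>, which keeps the Schreier graph simple everywhere.
\<close>

definition move :: "nat \<Rightarrow> 'a cover \<Rightarrow> 'a cover" where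
  "move v z = (if full z then step (dart v z) z
     else (fst z, (snd z)(0 := int_encode (int_decode (snd z 0) + slot_shift d v))))"

lemma lab_bij: "full z \<Longrightarrow> bij_betw (lab z) {..<2 * d} {1..2 * d}"
proof -
  assume f: "full z"
  have inj: "inj_on (lab z) {..<2 * d}"
    using lab_inj[OF full_good[OF f]] full_lab[OF f] by (intro inj_onI) auto
  have "lab z ` {..<2 * d} \<subseteq> {1..2 * d}"
    using lab_le[OF full_good[OF f]] full_lab[OF f] by (auto simp: Suc_le_eq)
  then have "lab z ` {..<2 * d} = {1..2 * d}"
    using inj by (intro card_subset_eq) (auto simp: card_image)
  then show ?thesis using inj by (simp add: bij_betw_def)
qed

lemma dart:
  assumes f: "full z" and v: "v \<in> {1..2 * d}"
  shows "dart v z < 2 * d" "lab z (dart v z) = v"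
    and "i < 2 * d \<Longrightarrow> lab z i = v \<Longrightarrow> dart v z = i"
proof -
  obtain k where k: "k < 2 * d" "lab z k = v"
    using bij_betw_imp_surj_on[OF lab_bij[OF f]] v by (metis imageE lessThan_iff)
  show l: "lab z (dart v z) = v" unfolding dart_def by (rule LeastI[of _ k]) (rule k(2))
  have "dart v z \<le> k" unfolding dart_def by (rule Least_le) (rule k(2))
  then show d: "dart v z < 2 * d" using k(1) by simp
  show "i < 2 * d \<Longrightarrow> lab z i = v \<Longrightarrow> dart v z = i"
    using lab_inj[OF full_good[OF f] d, of i] l v by auto
qed

lemma move_full: "full z \<Longrightarrow> move v z = step (dart v z) z"
  by (simp add: move_def)

text \<open>Coordinate 0 does not occur in \<open>full\<close>, so the translations by
  \<open>move\<close> on the exceptional set do not leave that set.\<close>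

lemma full_cong:
  assumes "fst z = fst z'" "\<And>w i. snd z (enc w i) = snd z' (enc w i)"
  shows "full z \<longleftrightarrow> full z'"
  unfolding full_def good_def assms ..

lemma full_move_iff: "full (move v z) \<longleftrightarrow> full z"
proof (cases "full z")
  case True
  then show ?thesis by (simp add: move_full full_step)
next
  case False
  show ?thesis by (rule full_cong) (simp_all add: move_def False enc_def)
qed

lemma slot_shift_conj: "v \<in> {1..2 * d} \<Longrightarrow> slot_shift d (conj_slot d v) = - slot_shift d v"
  by (auto simp: slot_shift_def conj_slot_def)

lemma slot_shift_neq: "v \<in> {1..2 * d} \<Longrightarrow> slot_shift d v \<noteq> 0"
  by (auto simp: slot_shift_def)

lemma slot_shift_inj: "v \<in> {1..2 * d} \<Longrightarrow> w \<in> {1..2 * d} \<Longrightarrow> slot_shift d v = slot_shift d w \<Longrightarrow> v = w"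
  unfolding slot_shift_def by (simp split: if_splits)

text \<open>At a full point the return dart carries the conjugate slot; elsewhere the two
  translations are opposite.\<close>

lemma move_conj:
  assumes v: "v \<in> {1..2 * d}"
  shows "move (conj_slot d v) (move v z) = z"
proof (cases "full z")
  case True
  let ?i = "dart v z"
  have g: "good z" by (rule full_good[OF True])
  have i: "?i < 2 * d" "lab z ?i = v" by (rule dart[OF True v])+
  have cv: "conj_slot d v \<in> {1..2 * d}" using conj_slot_range[of v] v by auto
  have "dart (conj_slot d v) (step ?i z) = r ?i (fst z)"
    using dart(3)[OF full_step[OF True] cv r_less[OF goodD(1)[OF g] i(1)]] lab_rev[OF g i(1)] i(2) by simp
  then show ?thesis using True full_step[OF True] step_r[OF g i(1)] by (simp add: move_full)
next
  case False
  then have "\<not> full (move v z)" by (simp add: full_move_iff)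
  then show ?thesis using False slot_shift_conj[OF v]
    by (simp add: move_def prod_eq_iff)
qed

lemma move_conj':
  assumes v: "v \<in> {1..2 * d}"
  shows "move v (move (conj_slot d v) z) = z"
  using move_conj[of "conj_slot d v" z] conj_slot_conj[of v] conj_slot_range[of v] v by simp

lemma move_neq:
  assumes v: "v \<in> {1..2 * d}"
  shows "move v z \<noteq> z"
proof (cases "full z")
  case True
  have "fst (move v z) \<noteq> fst z"
    using N_neq[OF goodD(1)[OF full_good[OF True]] dart(1)[OF True v]] True by (simp add: move_full)
  then show ?thesis by auto
next
  case False
  have "snd (move v z) 0 \<noteq> snd z 0"
    using False slot_shift_neq[OF v] by (simp add: move_def) (metis add_cancel_left_right int_encode_inverse)
  then show ?thesis by auto
qed

lemma move_inj:
  assumes v: "v \<in> {1..2 * d}" and w: "w \<in> {1..2 * d}" and eq: "move v z = move w z"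
  shows "v = w"
proof (cases "full z")
  case True
  have "N (dart v z) (fst z) = N (dart w z) (fst z)"
    using arg_cong[OF eq, of fst] True by (simp add: move_full)
  then have "dart v z = dart w z"
    using N_inj[OF goodD(1)[OF full_good[OF True]] dart(1)[OF True v] dart(1)[OF True w]] by blast
  then show ?thesis using dart(2)[OF True v] dart(2)[OF True w] by metis
next
  case False
  have "int_encode (int_decode (snd z 0) + slot_shift d v) = int_encode (int_decode (snd z 0) + slot_shift d w)"
    using arg_cong[OF eq, of "\<lambda>z'. snd z' 0"] False by (simp add: move_def)
  then have "slot_shift d v = slot_shift d w" by (simp add: int_encode_eq)
  then show ?thesis by (rule slot_shift_inj[OF v w])
qed

lemma move_space: "z \<in> space Z \<Longrightarrow> move v z \<in> space Z"
  using step_space[of z "dart v z"] by (simp add: move_def in_space_Z)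

lemma dart_measurable: "dart v \<in> measurable Z (count_space UNIV)"
  unfolding dart_def[abs_def] by (rule measurable_Least) (rule pred_lab_eq)

lemma move_measurable [measurable]: "move v \<in> measurable Z Z"
proof -
  have 1: "(\<lambda>z. step (dart v z) z) \<in> measurable Z Z"
    by (rule measurable_compose_countable[OF step_measurable dart_measurable])
  have 2: "(\<lambda>z. (fst z, (snd z)(0 := int_encode (int_decode (snd z 0) + slot_shift d v)))) \<in> measurable Z Z"
  proof (rule measurable_Pair)
    show "(\<lambda>z. (snd z)(0 := int_encode (int_decode (snd z 0) + slot_shift d v))) \<in> measurable Z label_space"
    proof (rule measurable_into_label_space)
      fix p
      have "(\<lambda>z. int_encode (int_decode (snd z 0) + slot_shift d v)) \<in> measurable Z (count_space UNIV)"
        by (rule measurable_compose[OF snd_measurable]) simp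
      then show "(\<lambda>z. ((snd z)(0 := int_encode (int_decode (snd z 0) + slot_shift d v))) p)
          \<in> measurable Z (count_space UNIV)"
        by (cases "p = 0") auto
    qed
  qed measurable
  show ?thesis unfolding move_def[abs_def]
    by (rule measurable_If[OF 1 2]) (use pred_full in \<open>simp add: pred_def\<close>)
qed

text \<open>Full points are sorted by the dart \<open>j\<close> with slot \<open>v\<close> and its
  return dart \<open>k\<close>. Each piece is one instance of transport, applied to the points of
  \<open>S\<close> whose dart \<open>k\<close> carries the conjugate slot; the pieces add up on both
  sides.\<close>

lemma move_preserves_emeasure:
  assumes v: "v \<in> {1..2 * d}" and S: "S \<in> sets Z"
  shows "emeasure m {z \<in> space Z. move v z \<in> S} = emeasure m S"
proof -
  let ?n = "2 * d"
  let ?c = "conj_slot d v"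
  have c: "?c \<in> {1..?n}" using conj_slot_range[of v] v by auto
  define T where "T k = {y \<in> space Z. lab y k = ?c \<and> y \<in> S}" for k
  have T: "T k \<in> sets Z" for k
  proof -
    have "Measurable.pred Z (\<lambda>y. lab y k = ?c \<and> y \<in> S)"
      using S by (intro pred_intros_logic pred_lab_eq) auto
    then show ?thesis unfolding T_def by (simp add: pred_def)
  qed
  define P where "P j k = {z \<in> space Z. fst z \<in> X0 \<and> r j (fst z) = k \<and> step j z \<in> T k}" for j k
  define Q where "Q j k = {z \<in> space Z. fst z \<in> X0 \<and> r k (fst z) = j \<and> z \<in> T k}" for j k
  have PQ: "P j k \<in> sets Z" "Q j k \<in> sets Z" for j k
    unfolding P_def Q_def using sets_to[OF T] sets_from[OF T] by auto
  have in_P: "z \<in> P j k \<longleftrightarrow> j = dart v z \<and> k = r j (fst z) \<and> move v z \<in> S"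
    if f: "full z" and x: "z \<in> space Z" and j: "j < ?n" for z j k
  proof -
    have g: "good z" by (rule full_good[OF f])
    have "lab (step j z) (r j (fst z)) = ?c \<longleftrightarrow> lab z j = v"
      using lab_rev[OF g j] cj_inj[OF lab_le[OF g, of j], of v] v by auto
    also have "\<dots> \<longleftrightarrow> j = dart v z" using dart(2)[OF f v] dart(3)[OF f v j] by auto
    finally show ?thesis
      using goodD(1)[OF g] x step_space[OF x] unfolding P_def T_def by (auto simp: move_full[OF f])
  qed
  have in_Q: "z \<in> Q j k \<longleftrightarrow> k = dart ?c z \<and> j = r k (fst z) \<and> z \<in> S"
    if f: "full z" and x: "z \<in> space Z" and k: "k < ?n" for z j k
  proof -
    have g: "good z" by (rule full_good[OF f])
    have "lab z k = ?c \<longleftrightarrow> k = dart ?c z" using dart(2)[OF f c] dart(3)[OF f c k] by auto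
    then show ?thesis using goodD(1)[OF g] x unfolding Q_def T_def by auto
  qed
  have sumP: "(\<Sum>j<?n. \<Sum>k<?n. indicator (P j k) z) = (indicator {z \<in> space Z. move v z \<in> S} z :: ennreal)"
    if f: "full z" and x: "z \<in> space Z" for z
  proof -
    let ?j = "dart v z" let ?k = "r ?j (fst z)"
    have jn: "?j < ?n" by (rule dart(1)[OF f v])
    have kn: "?k < ?n" by (rule r_less[OF goodD(1)[OF full_good[OF f]] jn])
    have "(\<Sum>j<?n. \<Sum>k<?n. indicator (P j k) z) =
      (\<Sum>j<?n. \<Sum>k<?n. if j = ?j then if k = ?k then indicator {z \<in> space Z. move v z \<in> S} z else 0 else (0::ennreal))"
      using in_P[OF f x] x by (intro sum.cong refl) (auto simp: indicator_def)
    also have "\<dots> = (\<Sum>j<?n. if j = ?j then \<Sum>k<?n. if k = ?k then indicator {z \<in> space Z. move v z \<in> S} z else 0 else 0)"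
      by (intro sum.cong refl) auto
    also have "\<dots> = indicator {z \<in> space Z. move v z \<in> S} z" using jn kn by simp
    finally show ?thesis .
  qed
  have sumQ: "(\<Sum>j<?n. \<Sum>k<?n. indicator (Q j k) z) = (indicator S z :: ennreal)"
    if f: "full z" and x: "z \<in> space Z" for z
  proof -
    let ?k = "dart ?c z" let ?j = "r ?k (fst z)"
    have kn: "?k < ?n" by (rule dart(1)[OF f c])
    have jn: "?j < ?n" by (rule r_less[OF goodD(1)[OF full_good[OF f]] kn])
    have "(\<Sum>j<?n. \<Sum>k<?n. indicator (Q j k) z) =
      (\<Sum>j<?n. \<Sum>k<?n. if j = ?j then if k = ?k then indicator S z else 0 else (0::ennreal))"
      using in_Q[OF f x] by (intro sum.cong refl) (auto simp: indicator_def)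
    also have "\<dots> = (\<Sum>j<?n. if j = ?j then \<Sum>k<?n. if k = ?k then indicator S z else 0 else 0)"
      by (intro sum.cong refl) auto
    also have "\<dots> = indicator S z" using jn kn by simp
    finally show ?thesis .
  qed
  have mS: "{z \<in> space Z. move v z \<in> S} \<in> sets Z"
    using measurable_sets[OF move_measurable S, of v] by (simp add: vimage_def Int_def conj_commute)
  have "emeasure m {z \<in> space Z. move v z \<in> S} = (\<integral>\<^sup>+z. indicator {z \<in> space Z. move v z \<in> S} z \<partial>m)"
    using mS by simp
  also have "\<dots> = (\<integral>\<^sup>+z. (\<Sum>j<?n. \<Sum>k<?n. indicator (P j k) z) \<partial>m)"
    using AE_full AE_space by (intro nn_integral_cong_AE, eventually_elim) (simp add: sumP)
  also have "\<dots> = (\<Sum>j<?n. \<Sum>k<?n. emeasure m (P j k))"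
    using PQ by (simp add: nn_integral_sum)
  also have "\<dots> = (\<Sum>j<?n. \<Sum>k<?n. emeasure m (Q j k))"
    unfolding P_def Q_def by (intro sum.cong refl admissibleD(5)[OF adm _ _ T]) auto
  also have "\<dots> = (\<integral>\<^sup>+z. (\<Sum>j<?n. \<Sum>k<?n. indicator (Q j k) z) \<partial>m)"
    using PQ by (simp add: nn_integral_sum)
  also have "\<dots> = (\<integral>\<^sup>+z. indicator S z \<partial>m)"
    using AE_full AE_space by (intro nn_integral_cong_AE, eventually_elim) (simp add: sumQ)
  also have "\<dots> = emeasure m S" using S by simp
  finally show ?thesis .
qed

lemma distr_move:
  assumes "v \<in> {1..2 * d}"
  shows "distr m m (move v) = m"
proof (rule measure_eqI)
  fix S assume S: "S \<in> sets (distr m m (move v))"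
  have "move v \<in> measurable m m" by measurable
  then have "emeasure (distr m m (move v)) S = emeasure m (move v -` S \<inter> space m)"
    using S by (simp add: emeasure_distr)
  also have "move v -` S \<inter> space m = {z \<in> space Z. move v z \<in> S}" by auto
  finally show "emeasure (distr m m (move v)) S = emeasure m S"
    using move_preserves_emeasure[OF assms] S by simp
qed simp

lemma conj_slot_in: "v \<in> {1..2 * d} \<Longrightarrow> conj_slot d v \<in> {1..2 * d}"
  using conj_slot_range[of v] by auto

lemma bij_betw_conj_slot: "bij_betw (conj_slot d) {1..2 * d} {1..2 * d}"
  by (rule bij_betw_byWitness[where f'="conj_slot d"]) (use conj_slot_conj conj_slot_in in auto)

lemma bij_betw_move: "v \<in> {1..2 * d} \<Longrightarrow> bij_betw (move v) (space Z) (space Z)"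
  by (rule bij_betw_byWitness[where f'="move (conj_slot d v)"])
    (use move_conj[of v] move_conj'[of v] move_space in \<open>simp_all add: image_subset_iff\<close>)

section \<open>The action of the free group\<close>

definition slot_of :: "letter \<Rightarrow> nat" where
  "slot_of a = (if snd a then fst a else fst a + d)"

definition act_word :: "letter list \<Rightarrow> 'a cover \<Rightarrow> 'a cover" where
  "act_word w z = foldr (\<lambda>a. move (slot_of a)) w z"

text \<open>Elements of \<open>BijGroup\<close> are extensional functions, hence the
  restriction.\<close>

definition act :: "letter list \<Rightarrow> 'a cover \<Rightarrow> 'a cover" where
  "act w = restrict (act_word w) (space Z)"

lemma act_word_simps [simp]:
  "act_word [] z = z" "act_word (a # w) z = move (slot_of a) (act_word w z)"
  by (simp_all add: act_word_def)

lemma slot_of_in: "a \<in> {1..d} \<times> UNIV \<Longrightarrow> slot_of a \<in> {1..2 * d}"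
  by (auto simp: slot_of_def)

lemma slot_of_inv: "a \<in> {1..d} \<times> UNIV \<Longrightarrow> slot_of (letter_inv a) = conj_slot d (slot_of a)"
  by (auto simp: slot_of_def letter_inv_def conj_slot_def)

text \<open>When the letter cancels against the head of the word, the corresponding moves cancel as
  well.\<close>

lemma act_word_push:
  assumes a: "a \<in> {1..d} \<times> UNIV"
  shows "act_word (push_letter a w) z = move (slot_of a) (act_word w z)"
proof (cases w)
  case (Cons b w')
  show ?thesis
  proof (cases "b = letter_inv a")
    case True
    then show ?thesis using Cons move_conj'[OF slot_of_in[OF a]] slot_of_inv[OF a] by simp
  qed (simp add: Cons)
qed simp

lemma act_word_mult:
  "set u \<subseteq> {1..d} \<times> UNIV \<Longrightarrow> act_word (foldr push_letter u v) z = act_word u (act_word v z)"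
  by (induction u) (simp_all add: act_word_push)

lemma bij_betw_act_word:
  "set w \<subseteq> {1..d} \<times> UNIV \<Longrightarrow> bij_betw (act_word w) (space Z) (space Z)"
proof (induction w)
  case Nil
  have "act_word [] = id" by (rule ext) simp
  then show ?case by (simp only: bij_betw_id)
next
  case (Cons a w)
  have eq: "act_word (a # w) = move (slot_of a) \<circ> act_word w" by (rule ext) simp
  have "bij_betw (act_word w) (space Z) (space Z)" by (rule Cons.IH) (use Cons.prems in simp)
  moreover have "bij_betw (move (slot_of a)) (space Z) (space Z)"
    by (rule bij_betw_move[OF slot_of_in]) (use Cons.prems in simp)
  ultimately show ?case unfolding eq by (rule bij_betw_trans)
qed

lemma act_Bij:
  assumes w: "set w \<subseteq> {1..d} \<times> UNIV"
  shows "act w \<in> Bij (space Z)"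
proof -
  have "bij_betw (act w) (space Z) (space Z) \<longleftrightarrow> bij_betw (act_word w) (space Z) (space Z)"
    by (rule bij_betw_cong) (simp add: act_def)
  then show ?thesis using bij_betw_act_word[OF w] by (simp add: Bij_def act_def)
qed

lemma group_action_act: "group_action (free_group d) (space Z) act"
  unfolding group_action_def group_hom_def group_hom_axioms_def
proof (intro conjI homI)
  show "group (free_group d)" by (rule group_free_group)
  show "group (BijGroup (space Z))" by (rule group_BijGroup)
  fix u assume u: "u \<in> carrier (free_group d)"
  then have u': "set u \<subseteq> {1..d} \<times> UNIV" by (simp add: free_group_def)
  then show "act u \<in> carrier (BijGroup (space Z))" using act_Bij by (simp add: BijGroup_def)
  fix v assume v: "v \<in> carrier (free_group d)"
  then have v': "set v \<subseteq> {1..d} \<times> UNIV" by (simp add: free_group_def)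
  have "act (u \<otimes>\<^bsub>free_group d\<^esub> v) = compose (space Z) (act u) (act v)"
  proof (rule ext)
    fix z
    show "act (u \<otimes>\<^bsub>free_group d\<^esub> v) z = compose (space Z) (act u) (act v) z"
    proof (cases "z \<in> space Z")
      case True
      then have "act_word v z \<in> space Z" using bij_betwE[OF bij_betw_act_word[OF v']] by blast
      then show ?thesis using True act_word_mult[OF u'] by (simp add: act_def compose_def free_group_def)
    qed (simp add: act_def compose_def)
  qed
  then show "act (u \<otimes>\<^bsub>free_group d\<^esub> v) = act u \<otimes>\<^bsub>BijGroup (space Z)\<^esub> act v"
    using act_Bij[OF u'] act_Bij[OF v'] by (simp add: BijGroup_def)
qed

lemma move_measurable_m: "move v \<in> measurable m m"
  using move_measurable by (simp cong: measurable_cong_sets)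

lemma act_word_pmp:
  "set w \<subseteq> {1..d} \<times> UNIV \<Longrightarrow> act_word w \<in> measurable m m \<and> distr m m (act_word w) = m"
proof (induction w)
  case Nil
  have "act_word [] = (\<lambda>z. z)" by (rule ext) simp
  then show ?case by (simp add: distr_id)
next
  case (Cons a w)
  then have IH: "act_word w \<in> measurable m m" "distr m m (act_word w) = m" by simp_all
  have eq: "act_word (a # w) = move (slot_of a) \<circ> act_word w" by (rule ext) simp
  have a: "slot_of a \<in> {1..2 * d}" by (rule slot_of_in) (use Cons.prems in simp)
  have "distr m m (move (slot_of a) \<circ> act_word w) = distr (distr m m (act_word w)) m (move (slot_of a))"
    by (rule distr_distr[symmetric, OF move_measurable_m IH(1)])
  also have "\<dots> = m" unfolding IH(2) by (rule distr_move[OF a])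
  finally show ?case unfolding eq using measurable_comp[OF IH(1) move_measurable_m] by blast
qed

lemma pmp_action_act: "pmp_action (free_group d) m act"
  unfolding pmp_action_def
proof (intro conjI ballI)
  show "standard_borel m" by (rule standard_borel_labelled[OF standard sets_m])
  show "group_action (free_group d) (space m) act" using group_action_act by simp
  fix w assume "w \<in> carrier (free_group d)"
  then have w: "set w \<subseteq> {1..d} \<times> UNIV" by (simp add: free_group_def)
  have eq: "act w z = act_word w z" if "z \<in> space m" for z using that by (simp add: act_def)
  show "act w \<in> measurable m m"
    using measurable_cong[of m "act w" "act_word w", OF eq] act_word_pmp[OF w] by blast
  show "distr m m (act w) = m"
    using distr_cong[of m m m m "act w" "act_word w"] eq act_word_pmp[OF w] by simp
qed (rule m.prob_space_axioms)

section \<open>The Schreier graph with its orientation and colours\<close>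

definition graph :: "nat \<Rightarrow> ('a cover \<times> 'a cover) set" where
  "graph v = {p. fst p \<in> space Z \<and> snd p = move v (fst p)}"

definition edges :: "('a cover \<times> 'a cover) set" where
  "edges = (\<Union>v\<in>{1..2 * d}. graph v)"

definition arcs :: "('a cover \<times> 'a cover) set" where
  "arcs = (\<Union>i\<in>{1..d}. graph i)"

text \<open>Well defined on edges because different slots move a point to different targets.\<close>

definition slot_at :: "'a cover \<times> 'a cover \<Rightarrow> nat" where
  "slot_at p = (THE v. v \<in> {1..2 * d} \<and> snd p = move v (fst p))"

definition colour :: "'a cover \<times> 'a cover \<Rightarrow> nat" where
  "colour p = (if slot_at p \<le> d then slot_at p else slot_at p - d)"

lemma in_graph: "(x, y) \<in> graph v \<longleftrightarrow> x \<in> space Z \<and> y = move v x"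
  by (simp add: graph_def)

lemma slot_at_move: "v \<in> {1..2 * d} \<Longrightarrow> slot_at (x, move v x) = v"
  unfolding slot_at_def
proof (rule the_equality)
  fix w assume v: "v \<in> {1..2 * d}" and w: "w \<in> {1..2 * d} \<and> snd (x, move v x) = move w (fst (x, move v x))"
  then show "w = v" using move_inj[of w v x] by simp
qed simp

lemma graph_flip: "v \<in> {1..2 * d} \<Longrightarrow> (x, y) \<in> graph v \<Longrightarrow> (y, x) \<in> graph (conj_slot d v)"
  using move_conj[of v x] move_space[of x v] by (simp add: in_graph)

lemma edges_sym: "(x, y) \<in> edges \<Longrightarrow> (y, x) \<in> edges"
  unfolding edges_def using graph_flip conj_slot_in by blast

lemma colour_move: "v \<in> {1..2 * d} \<Longrightarrow> colour (x, move v x) = (if v \<le> d then v else v - d)"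
  by (simp only: colour_def slot_at_move)

lemma colour_graph: "v \<in> {1..2 * d} \<Longrightarrow> (x, y) \<in> graph v \<Longrightarrow> colour (x, y) = (if v \<le> d then v else v - d)"
  using colour_move by (simp add: in_graph)

lemma graph_unique: "v \<in> {1..2 * d} \<Longrightarrow> w \<in> {1..2 * d} \<Longrightarrow> p \<in> graph v \<Longrightarrow> p \<in> graph w \<Longrightarrow> v = w"
  by (rule move_inj[of v w "fst p"]) (auto simp: graph_def)

text \<open>Equality of labelled points is tested by the separating sets on the vertex and by
  countably many label coordinates.\<close>

lemma graph_sets: "graph v \<in> sets (m \<Otimes>\<^sub>M m)"
proof -
  let ?K = "m \<Otimes>\<^sub>M m"
  have f: "(\<lambda>p. snd p) \<in> measurable ?K Z" "(\<lambda>p. move v (fst p)) \<in> measurable ?K Z"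
  proof -
    show "(\<lambda>p. snd p) \<in> measurable ?K Z" using measurable_snd[of m m] by (simp cong: measurable_cong_sets)
    have "fst \<in> measurable ?K Z" using measurable_fst[of m m] by (simp cong: measurable_cong_sets)
    then show "(\<lambda>p. move v (fst p)) \<in> measurable ?K Z" by (rule measurable_compose[OF _ move_measurable])
  qed
  have 1: "Measurable.pred ?K (\<lambda>p. fst (snd p) = fst (move v (fst p)))"
    by (rule pred_eq_N) (rule measurable_compose[OF f(1) measurable_fst] measurable_compose[OF f(2) measurable_fst])+
  have 2: "Measurable.pred ?K (\<lambda>p. snd (snd p) q = snd (move v (fst p)) q)" for q
    by (rule pred_eq_countable) (rule measurable_compose[OF f(1) snd_measurable] measurable_compose[OF f(2) snd_measurable])+
  have "Measurable.pred ?K (\<lambda>p. fst (snd p) = fst (move v (fst p)) \<and> (\<forall>q. snd (snd p) q = snd (move v (fst p)) q))"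
    by (intro pred_intros_logic pred_intros_countable 1 2)
  then have "Measurable.pred ?K (\<lambda>p. snd p = move v (fst p))"
    by (simp only: prod_eq_iff[of "snd _"] fun_eq_iff[symmetric])
  then have "{p \<in> space ?K. snd p = move v (fst p)} \<in> sets ?K" by (simp add: pred_def)
  moreover have "{p \<in> space ?K. snd p = move v (fst p)} = graph v"
  proof (rule Set.set_eqI)
    fix p
    have "p \<in> space ?K \<longleftrightarrow> fst p \<in> space Z \<and> snd p \<in> space Z"
      by (simp only: space_pair_measure[of m m] space_m mem_Times_iff)
    then show "p \<in> {p \<in> space ?K. snd p = move v (fst p)} \<longleftrightarrow> p \<in> graph v"
      using move_space[of "fst p" v] unfolding graph_def mem_Collect_eq by metis
  qed
  ultimately show ?thesis by simp
qed

lemma edges_sets: "edges \<in> sets (m \<Otimes>\<^sub>M m)"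
  unfolding edges_def using graph_sets by auto

lemma arcs_iff: "v \<in> {1..2 * d} \<Longrightarrow> (x, y) \<in> graph v \<Longrightarrow> (x, y) \<in> arcs \<longleftrightarrow> v \<le> d"
proof
  assume v: "v \<in> {1..2 * d}" and g: "(x, y) \<in> graph v"
  { assume "(x, y) \<in> arcs"
    then obtain i where i: "i \<in> {1..d}" "(x, y) \<in> graph i" by (auto simp: arcs_def)
    then have "v = i" using graph_unique[OF v _ g i(2)] by simp
    then show "v \<le> d" using i by simp }
  { assume "v \<le> d"
    then show "(x, y) \<in> arcs" using v g by (auto simp: arcs_def) }
qed

lemma orientation: "measurable_orientation m edges arcs"
  unfolding measurable_orientation_def
proof (intro conjI ballI)
  show "arcs \<in> sets (m \<Otimes>\<^sub>M m)" unfolding arcs_def using graph_sets by auto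
  show "arcs \<subseteq> edges"
  proof
    fix p assume "p \<in> arcs"
    then obtain i where "i \<in> {1..d}" "p \<in> graph i" by (auto simp: arcs_def)
    then show "p \<in> edges" unfolding edges_def by (intro UN_I[of i]) auto
  qed
  fix p assume "p \<in> edges"
  then obtain v where v: "v \<in> {1..2 * d}" "p \<in> graph v" by (auto simp: edges_def)
  obtain x y where p: "p = (x, y)" by (cases p)
  have "(y, x) \<in> graph (conj_slot d v)" using graph_flip v p by simp
  then have "(y, x) \<in> arcs \<longleftrightarrow> conj_slot d v \<le> d" by (rule arcs_iff[OF conj_slot_in[OF v(1)]])
  moreover have "(x, y) \<in> arcs \<longleftrightarrow> v \<le> d" using arcs_iff[OF v(1)] v(2) p by simp
  moreover have "conj_slot d v \<le> d \<longleftrightarrow> \<not> v \<le> d" using v(1) by (auto simp: conj_slot_def)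
  ultimately show "case p of (x, y) \<Rightarrow> ((x, y) \<in> arcs) = ((y, x) \<notin> arcs)" by (simp add: p)
qed

lemma colouring: "measurable_edge_coloring d m edges colour"
  unfolding measurable_edge_coloring_def
proof (intro conjI ballI)
  have col: "colour p \<in> {1..d}" if "p \<in> edges" for p
  proof -
    obtain v where v: "v \<in> {1..2 * d}" "p \<in> graph v" using \<open>p \<in> edges\<close> by (auto simp: edges_def)
    have "colour p = (if v \<le> d then v else v - d)" using colour_graph[OF v(1), of "fst p" "snd p"] v(2) by simp
    then show ?thesis using v(1) by auto
  qed
  have sp: "space (restrict_space (m \<Otimes>\<^sub>M m) edges) = edges"
    using sets.sets_into_space[OF edges_sets] by (auto simp: space_restrict_space)
  show "colour \<in> measurable (restrict_space (m \<Otimes>\<^sub>M m) edges) (count_space {1..d})"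
  proof (subst measurable_count_space_eq2, simp, intro conjI ballI)
    show "colour \<in> space (restrict_space (m \<Otimes>\<^sub>M m) edges) \<rightarrow> {1..d}" unfolding sp using col by auto
    fix i assume i: "i \<in> {1..d}"
    have "colour -` {i} \<inter> edges = edges \<inter> (graph i \<union> graph (i + d))"
    proof (intro equalityI subsetI)
      fix p assume p: "p \<in> colour -` {i} \<inter> edges"
      then obtain v where v: "v \<in> {1..2 * d}" "p \<in> graph v" by (auto simp: edges_def)
      have "colour p = (if v \<le> d then v else v - d)" using colour_graph[OF v(1), of "fst p" "snd p"] v(2) by simp
      then have "v = i \<or> v = i + d" using p by (auto split: if_splits)
      then show "p \<in> edges \<inter> (graph i \<union> graph (i + d))" using p v(2) by auto
    next
      fix p assume p: "p \<in> edges \<inter> (graph i \<union> graph (i + d))"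
      then have "colour p = i"
        using colour_graph[of i "fst p" "snd p"] colour_graph[of "i + d" "fst p" "snd p"] i by auto
      then show "p \<in> colour -` {i} \<inter> edges" using p by simp
    qed
    then show "colour -` {i} \<inter> space (restrict_space (m \<Otimes>\<^sub>M m) edges) \<in> sets (restrict_space (m \<Otimes>\<^sub>M m) edges)"
      unfolding sp sets_restrict_space using graph_sets by auto
  qed
  fix p assume "p \<in> edges"
  then obtain v where v: "v \<in> {1..2 * d}" "p \<in> graph v" by (auto simp: edges_def)
  obtain x y where p: "p = (x, y)" by (cases p)
  have "colour (y, x) = (if conj_slot d v \<le> d then conj_slot d v else conj_slot d v - d)"
    using colour_graph[OF conj_slot_in[OF v(1)]] graph_flip v p by simp
  also have "\<dots> = (if v \<le> d then v else v - d)" using v(1) by (auto simp: conj_slot_def)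
  also have "\<dots> = colour (x, y)" using colour_graph[OF v(1)] v(2) p by simp
  finally show "case p of (x, y) \<Rightarrow> colour (x, y) = colour (y, x)" by (simp add: p)
qed

lemma arc_colour: "i \<in> {1..d} \<Longrightarrow> (x, y) \<in> arcs \<and> colour (x, y) = i \<longleftrightarrow> x \<in> space Z \<and> y = move i x"
proof
  assume i: "i \<in> {1..d}"
  { assume a: "(x, y) \<in> arcs \<and> colour (x, y) = i"
    then obtain k where k: "k \<in> {1..d}" "(x, y) \<in> graph k" by (auto simp: arcs_def)
    then have "k = i" using a colour_graph[of k x y] by simp
    then show "x \<in> space Z \<and> y = move i x" using k by (simp add: in_graph) }
  { assume a: "x \<in> space Z \<and> y = move i x"
    then have "(x, y) \<in> graph i" by (simp add: in_graph)
    then show "(x, y) \<in> arcs \<and> colour (x, y) = i" using i colour_graph[of i x y] by (auto simp: arcs_def) }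
qed

lemma decoration_arcs: "schreier_decoration d m edges arcs colour"
  unfolding schreier_decoration_def
proof (intro conjI ballI orientation colouring)
  fix x i assume x: "x \<in> space m" and i: "i \<in> {1..d}"
  show "\<exists>!y. (x, y) \<in> arcs \<and> colour (x, y) = i"
    unfolding arc_colour[OF i] using x by auto
  have v: "i \<in> {1..2 * d}" using i by auto
  have "y \<in> space Z \<and> x = move i y \<longleftrightarrow> y = move (conj_slot d i) x" for y
    using move_conj[OF v, of y] move_conj'[OF v, of x] move_space[of x "conj_slot d i"] x by auto
  then show "\<exists>!y. (y, x) \<in> arcs \<and> colour (y, x) = i"
    unfolding arc_colour[OF i] by simp
qed

lemma comes_from_action_act: "comes_from_action d m edges act arcs colour"
  unfolding comes_from_action_def
proof (intro conjI pmp_action_act decoration_arcs)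
  have gen: "act (generator i) x = move i x" if "x \<in> space Z" for i x
    using that by (simp add: act_def generator_def slot_of_def)
  have col: "i \<in> {1..d}" if xy: "(x, y) \<in> arcs" "colour (x, y) = i" for x y i
  proof -
    obtain k where k: "k \<in> {1..d}" "(x, y) \<in> graph k" using xy(1) by (auto simp: arcs_def)
    then show ?thesis using xy(2) colour_graph[of k x y] by simp
  qed
  show "{(x, y, i). (x, y) \<in> arcs \<and> colour (x, y) = i} = schreier_arcs d m act"
  proof (intro equalityI subsetI)
    fix q assume "q \<in> {(x, y, i). (x, y) \<in> arcs \<and> colour (x, y) = i}"
    then obtain x y i where q: "q = (x, y, i)" "(x, y) \<in> arcs" "colour (x, y) = i" by auto
    have i: "i \<in> {1..d}" using col q by blast
    have "x \<in> space Z" "y = move i x" using arc_colour[OF i, of x y] q by auto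
    then have "q = (x, act (generator i) x, i) \<and> x \<in> space m \<and> i \<in> {1..d}"
      using q(1) gen[of x i] i by simp
    then show "q \<in> schreier_arcs d m act" unfolding schreier_arcs_def by blast
  next
    fix q assume "q \<in> schreier_arcs d m act"
    then obtain x i where q: "q = (x, act (generator i) x, i)" "x \<in> space Z" "i \<in> {1..d}"
      unfolding schreier_arcs_def by auto
    then show "q \<in> {(x, y, i). (x, y) \<in> arcs \<and> colour (x, y) = i}"
      using arc_colour[OF q(3), of x "move i x"] gen[OF q(2)] by simp
  qed
qed

section \<open>The cover is a graphing\<close>

lemma edges_iff: "(x, y) \<in> edges \<longleftrightarrow> x \<in> space Z \<and> y \<in> (\<lambda>v. move v x) ` {1..2 * d}"
  by (auto simp: edges_def in_graph)

lemma degree_edges: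
  assumes "x \<in> space Z"
  shows "degree_in edges x B = (\<Sum>v\<in>{1..2 * d}. indicator B (move v x))"
proof -
  have "{y \<in> B. (x, y) \<in> edges} = (\<lambda>v. move v x) ` {v \<in> {1..2 * d}. move v x \<in> B}"
    using assms by (auto simp: edges_iff)
  moreover have "inj_on (\<lambda>v. move v x) {v \<in> {1..2 * d}. move v x \<in> B}"
    by (rule inj_onI) (use move_inj in blast)
  ultimately have "degree_in edges x B = card {v \<in> {1..2 * d}. move v x \<in> B}"
    by (simp add: degree_in_def card_image)
  also have "\<dots> = (\<Sum>v\<in>{1..2 * d}. indicator B (move v x))"
    by (simp add: indicator_def of_bool_def sum.If_cases Int_def)
  finally show ?thesis .
qed

text \<open>Substituting along the measure-preserving map \<open>move (conj_slot d v)\<close>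
  exchanges \<open>A\<close> and \<open>B\<close> and conjugates the slot; conjugation merely
  permutes the slots in the sum.\<close>

lemma mass_transport_edges:
  assumes A: "A \<in> sets m" and B: "B \<in> sets m"
  shows "(\<integral>\<^sup>+x\<in>A. of_nat (degree_in edges x B) \<partial>m) = (\<integral>\<^sup>+x\<in>B. of_nat (degree_in edges x A) \<partial>m)"
proof -
  let ?V = "{1..2 * d}"
  have mv [measurable]: "move v \<in> measurable m m" for v by (rule move_measurable_m)
  have int: "(\<integral>\<^sup>+x\<in>A. of_nat (degree_in edges x B) \<partial>m)
      = (\<Sum>v\<in>?V. \<integral>\<^sup>+x. indicator A x * indicator B (move v x) \<partial>m)"
    if [measurable]: "A \<in> sets m" "B \<in> sets m" for A B
  proof -
    have "(\<integral>\<^sup>+x\<in>A. of_nat (degree_in edges x B) \<partial>m)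
        = (\<integral>\<^sup>+x. (\<Sum>v\<in>?V. indicator A x * indicator B (move v x)) \<partial>m)"
      by (intro nn_integral_cong) (auto simp: degree_edges indicator_def intro!: sum.cong)
    also have "\<dots> = (\<Sum>v\<in>?V. \<integral>\<^sup>+x. indicator A x * indicator B (move v x) \<partial>m)"
      by (rule nn_integral_sum) measurable
    finally show ?thesis .
  qed
  have swap: "(\<integral>\<^sup>+x. indicator A x * indicator B (move v x) \<partial>m)
      = (\<integral>\<^sup>+x. indicator B x * indicator A (move (conj_slot d v) x) \<partial>m)" if v: "v \<in> ?V" for v
  proof -
    have "(\<integral>\<^sup>+x. indicator A x * indicator B (move v x) \<partial>m)
        = (\<integral>\<^sup>+x. indicator A x * indicator B (move v x) \<partial>(distr m m (move (conj_slot d v))))"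
      by (simp only: distr_move[OF conj_slot_in[OF v]])
    also have "\<dots> = (\<integral>\<^sup>+x. indicator A (move (conj_slot d v) x) * indicator B (move v (move (conj_slot d v) x)) \<partial>m)"
    proof (rule nn_integral_distr[OF mv])
      note [measurable] = A B
      have "(\<lambda>x. indicator A x * indicator B (move v x) :: ennreal) \<in> borel_measurable m" by measurable
      then show "(\<lambda>x. indicator A x * indicator B (move v x) :: ennreal)
          \<in> borel_measurable (distr m m (move (conj_slot d v)))" by simp
    qed
    finally show ?thesis by (simp add: move_conj'[OF v] mult.commute)
  qed
  have "(\<integral>\<^sup>+x\<in>A. of_nat (degree_in edges x B) \<partial>m)
      = (\<Sum>v\<in>?V. \<integral>\<^sup>+x. indicator B x * indicator A (move (conj_slot d v) x) \<partial>m)"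
    unfolding int[OF A B] by (rule sum.cong[OF refl swap])
  also have "\<dots> = (\<Sum>v\<in>?V. \<integral>\<^sup>+x. indicator B x * indicator A (move v x) \<partial>m)"
    by (rule sum.reindex_bij_betw[OF bij_betw_conj_slot])
  finally show ?thesis unfolding int[OF B A] .
qed

lemma graphing_edges: "graphing m edges"
  unfolding graphing_def
proof (intro conjI ballI)
  show "sym edges" by (rule symI) (rule edges_sym)
  show "irrefl edges"
  proof (rule irreflI)
    fix x
    have "x \<notin> (\<lambda>v. move v x) ` {1..2 * d}"
    proof
      assume "x \<in> (\<lambda>v. move v x) ` {1..2 * d}"
      then obtain v where "v \<in> {1..2 * d}" "x = move v x" by blast
      then show False using move_neq[of v x] by simp
    qed
    then show "(x, x) \<notin> edges" unfolding edges_iff by blast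
  qed
  have sub: "{y. (x, y) \<in> edges} \<subseteq> (\<lambda>v. move v x) ` {1..2 * d}" for x by (auto simp: edges_iff)
  have "degree_in edges x (space m) \<le> 2 * d" for x
  proof -
    have "degree_in edges x (space m) \<le> card ((\<lambda>v. move v x) ` {1..2 * d})"
      unfolding degree_in_def using sub[of x] by (intro card_mono) auto
    also have "\<dots> \<le> 2 * d" using card_image_le[of "{1..2 * d}" "\<lambda>v. move v x"] by simp
    finally show ?thesis .
  qed
  moreover have "finite {y. (x, y) \<in> edges}" for x by (rule finite_subset[OF sub]) simp
  ultimately show "\<exists>D. \<forall>x\<in>space m. finite {y. (x, y) \<in> edges} \<and> degree_in edges x (space m) \<le> D" by blast
  show "standard_borel m" by (rule standard_borel_labelled[OF standard sets_m])
  show "(\<integral>\<^sup>+x\<in>A. of_nat (degree_in edges x B) \<partial>m) = (\<integral>\<^sup>+x\<in>B. of_nat (degree_in edges x A) \<partial>m)"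
    if "A \<in> sets m" "B \<in> sets m" for A B
    by (rule mass_transport_edges[OF that])
qed (rule m.prob_space_axioms edges_sets)+

section \<open>Components and the local isomorphism\<close>

lemma step_edge:
  assumes "full z" "z \<in> space Z" "j < 2 * d"
  shows "(z, step j z) \<in> edges"
proof -
  have v: "lab z j \<in> {1..2 * d}" using bij_betwE[OF lab_bij[OF assms(1)]] assms(3) by auto
  have "dart (lab z j) z = j" by (rule dart(3)[OF assms(1) v assms(3) refl])
  then have "move (lab z j) z = step j z" using assms(1) by (simp add: move_full)
  then show ?thesis unfolding edges_iff using assms(2) v by (metis imageI)
qed

lemma edge_step:
  assumes "full z" "(z, z') \<in> edges"
  obtains j where "j < 2 * d" "z' = step j z"
proof -
  obtain v where v: "v \<in> {1..2 * d}" "z' = move v z" using assms(2) by (auto simp: edges_iff)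
  show thesis using that[OF dart(1)[OF assms(1) v(1)]] v(2) assms(1) by (simp add: move_full)
qed

lemma walk_space: "z \<in> space Z \<Longrightarrow> fold step w z \<in> space Z"
  by (induction w arbitrary: z) (auto simp: step_space)

lemma component_edges:
  assumes f: "full z" and x: "z \<in> space Z"
  shows "component edges z = {fold step w z | w. True}"
proof (intro equalityI subsetI)
  fix z' assume "z' \<in> component edges z"
  then have "(z, z') \<in> edges\<^sup>*" by (simp add: component_def)
  then have "\<exists>w. z' = fold step w z"
  proof (induction rule: rtrancl_induct)
    case base
    show ?case by (rule exI[of _ "[]"]) simp
  next
    case (step z' y)
    then obtain w where w: "z' = fold step w z" by blast
    obtain j where "y = local.step j z'" using edge_step[OF _ step(2)] full_walk[OF f] w by blast
    then show ?case using w by (intro exI[of _ "w @ [j]"]) simp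
  qed
  then show "z' \<in> {fold step w z | w. True}" by blast
next
  fix z' assume "z' \<in> {fold step w z | w. True}"
  then obtain w where w: "z' = fold step w z" by blast
  have "(z, fold step w z) \<in> edges\<^sup>*" for w
  proof (induction w rule: rev_induct)
    case (snoc j w)
    have fw: "full (fold step w z)" by (rule full_walk[OF f])
    show ?case
    proof (cases "j < 2 * d")
      case True
      have "(fold step w z, step j (fold step w z)) \<in> edges"
        by (rule step_edge[OF fw walk_space[OF x] True])
      then show ?thesis using snoc by simp
    next
      case False
      then show ?thesis using snoc step_ge[OF full_good[OF fw], of j] by simp
    qed
  qed simp
  then show "z' \<in> component edges z" by (simp add: component_def w)
qed

lemma component_base:
  assumes x: "x \<in> X0"
  shows "component E x = {fold N w x | w. True}"
proof (intro equalityI subsetI)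
  fix y assume "y \<in> component E x"
  then have "(x, y) \<in> E\<^sup>*" by (simp add: component_def)
  then have "\<exists>w. y = fold N w x"
  proof (induction rule: rtrancl_induct)
    case base
    show ?case by (rule exI[of _ "[]"]) simp
  next
    case (step y z)
    then obtain w where w: "y = fold N w x" by blast
    have "z \<in> (\<lambda>j. N j y) ` {..<2 * d}" using neighbours[OF walk_N_X0[OF x], of w] step(2) w by auto
    then obtain j where "z = N j y" by blast
    then show ?case using w by (intro exI[of _ "w @ [j]"]) simp
  qed
  then show "y \<in> {fold N w x | w. True}" by blast
next
  fix y assume "y \<in> {fold N w x | w. True}"
  then obtain w where w: "y = fold N w x" by blast
  have "(x, fold N w x) \<in> E\<^sup>*" for w
  proof (induction w rule: rev_induct)
    case (snoc j w)
    show ?case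
    proof (cases "j < 2 * d")
      case True
      then have "N j (fold N w x) \<in> {y. (fold N w x, y) \<in> E}"
        unfolding neighbours[OF walk_N_X0[OF x]] by blast
      then show ?thesis using snoc by simp
    next
      case False
      then show ?thesis using snoc N_ge[of j] by simp
    qed
  qed simp
  then show "y \<in> component E x" by (simp add: component_def w)
qed

text \<open>Every walk in the base lifts, and by \<open>walk_eq\<close> walks with equal endpoints
  have equal lifts, so the projection is a bijection. In both graphs the neighbours of a vertex are
  the ends of its \<open>2 * d\<close> darts, so edges correspond.\<close>

lemma component_iso:
  assumes f: "full z" and x: "z \<in> space Z"
  shows "graph_iso_on edges (component edges z) E (component E (fst z)) fst"
  unfolding graph_iso_on_def
proof (intro conjI ballI)
  have g: "good z" by (rule full_good[OF f])
  have X: "fst z \<in> X0" by (rule goodD(1)[OF g])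
  show "bij_betw fst (component edges z) (component E (fst z))"
  proof (rule bij_betw_imageI)
    show "inj_on fst (component edges z)"
      unfolding component_edges[OF f x]
    proof (rule inj_onI)
      fix u v assume uv: "u \<in> {fold step w z | w. True}" "v \<in> {fold step w z | w. True}" "fst u = fst v"
      then obtain a b where ab: "u = fold step a z" "v = fold step b z" by blast
      have "fold N a (fst z) = fold N b (fst z)" using uv(3) unfolding ab fst_walk .
      then show "u = v" unfolding ab by (rule walk_eq[OF g])
    qed
    show "fst ` component edges z = component E (fst z)"
      unfolding component_edges[OF f x] component_base[OF X] 
    proof (intro equalityI subsetI)
      fix y assume "y \<in> fst ` {fold step w z | w. True}"
      then obtain w where "y = fst (fold step w z)" by blast
      then show "y \<in> {fold N w (fst z) | w. True}" by auto
    next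
      fix y assume "y \<in> {fold N w (fst z) | w. True}"
      then obtain w where "y = fst (fold step w z)" by auto
      then show "y \<in> fst ` {fold step w z | w. True}" by blast
    qed
  qed
  fix u v assume "u \<in> component edges z" "v \<in> component edges z"
  then obtain a b where u: "u = fold step a z" and v: "v = fold step b z"
    unfolding component_edges[OF f x] by blast
  have fu: "full u" "u \<in> space Z" unfolding u by (rule full_walk[OF f], rule walk_space[OF x])
  have Xu: "fst u \<in> X0" by (rule goodD(1)[OF full_good[OF fu(1)]])
  show "(u, v) \<in> edges \<longleftrightarrow> (fst u, fst v) \<in> E"
  proof
    assume "(u, v) \<in> edges"
    then obtain j where "j < 2 * d" "v = step j u" using edge_step[OF fu(1)] by blast
    then have "fst v \<in> (\<lambda>j. N j (fst u)) ` {..<2 * d}" by simp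
    then show "(fst u, fst v) \<in> E" using neighbours[OF Xu] by blast
  next
    assume "(fst u, fst v) \<in> E"
    then have "fst v \<in> (\<lambda>j. N j (fst u)) ` {..<2 * d}" using neighbours[OF Xu] by blast
    then obtain j where j: "j < 2 * d" "fst v = N j (fst u)" by blast
    have "fold N b (fst z) = fold N (a @ [j]) (fst z)" using j(2) by (simp add: u v)
    then have "fold step b z = fold step (a @ [j]) z" by (rule walk_eq[OF g])
    then have "v = step j u" unfolding u v by simp
    then show "(u, v) \<in> edges" using step_edge[OF fu j(1)] by simp
  qed
qed

lemma local_isomorphism: "local_isomorphic_image M E m edges"
  unfolding local_isomorphic_image_def
proof (intro bexI[of _ fst] conjI)
  show "fst \<in> measurable m M" using measurable_fst[of M label_space] by (simp cong: measurable_cong_sets)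
  show "distr m M fst = M" by (rule admissibleD(3)[OF adm])
  show "AE z in m. graph_iso_on edges (component edges z) E (component E (fst z)) fst"
    using AE_full AE_space by eventually_elim (simp add: component_iso)
qed

end

theorem corollary4:
  fixes d :: nat and M :: "'a measure" and E :: "('a \<times> 'a) set"
  assumes "d \<ge> 1" and "regular_graphing (2 * d) M E"
  shows "\<exists>(M' :: 'a cover measure) E' act Or c.
           graphing M' E' \<and>
           local_isomorphic_image M E M' E' \<and>
           comes_from_action d M' E' act Or c"
proof -
  interpret regular_graph_measure "2 * d" M E by unfold_locales (rule assms(2))
  obtain X0 N r U where ds: "dart_system M (2 * d) X0 N r U"
    and nb: "\<And>x. x \<in> X0 \<Longrightarrow> {y. (x, y) \<in> E} = (\<lambda>j. N j x) ` {..<2 * d}"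
    using graph_dart_system by blast
  interpret ds: dart_system M "2 * d" X0 N r U by (rule ds)
  \<comment> \<open>The degree equals the number of slots: \<open>d\<close> colours with two
    directions each.\<close>
  interpret S: slot_system M "2 * d" X0 N r U "conj_slot d"
    by unfold_locales (auto simp: conj_slot_def)
  obtain m where m: "S.admissible m" "AE z in m. \<forall>i<2 * d. S.lab z i \<noteq> 0"
    using S.ex_full_decoration by blast
  interpret C: schreier_cover M d X0 N r U E m
  proof unfold_locales
    show "standard_borel M" using assms(2) by (simp add: regular_graphing_def graphing_def)
  qed (fact m nb)+
  show ?thesis
    using C.graphing_edges C.local_isomorphism C.comes_from_action_act by blast
qed

end
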